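(* Let $\mathcal{N}\to\mathcal{G}_4$ be an $n$-fold covering over $\mathcal{G}_4$. If $n$ is odd then $\mathcal{N}$ is homeomorphic to $\mathcal{G}_4$. If $n$ is even but not divisible by $4$ then $\mathcal{N}$ is homeomorphic to $\mathcal{G}_4$ or $\mathcal{G}_2$. Finally, if $n$ is divisible by $4$ then $\mathcal{N}$ is homeomorphic to one of $\mathcal{G}_4$, $\mathcal{G}_2$ and $\mathcal{G}_1$. The corresponding numbers of nonequivalent $n$-fold coverings (with $\mathcal{N}$ homeomorphic to $\mathcal{G}_4$ in (i), to $\mathcal{G}_2$ in (ii), and to $\mathcal{G}_1$ in (iii)) are given by the following formulas: (i) $c_{\pi_1(\mathcal{G}_4),\pi_1(\mathcal{G}_4)}(n)=\sum_{a\mid n}\tau(a)-\sum_{a\mid\frac{n}{4}}\tau(a)$; (ii) $c_{\pi_1(\mathcal{G}_2),\pi_1(\mathcal{G}_4)}(n)=\frac{1}{2}\left(\sigma_2\left(\frac{n}{2}\right)+2\sigma_2\left(\frac{n}{4}\right)-3\sigma_2\left(\frac{n}{8}\right)+\sum_{a\mid\frac{n}{2}}\tau(a)-\sum_{a\mid\frac{n}{8}}\tau(a)\right)$; (iii) $c_{\mathbb{Z}^3,\pi_1(\mathcal{G}_4)}(n)=\frac{1}{4}\left(\omega\left(\frac{n}{4}\right)+\sigma_2\left(\frac{n}{4}\right)+3\sigma_2\left(\frac{n}{8}\right)+2\sum_{a\mid\frac{n}{4}}\tau(a)+2\sum_{a\mid\frac{n}{8}}\tau(a)\right)$.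
   Context: $\mathcal{G}_1,\mathcal{G}_2,\mathcal{G}_4$ are the closed orientable flat (Euclidean) 3-manifolds, determined up to homeomorphism by their fundamental groups $\pi_1(\mathcal{G}_1)=\mathbb{Z}^3$ (so $\mathcal{G}_1$ is the 3-torus), $\pi_1(\mathcal{G}_2)=\langle x,y,z : xyx^{-1}y^{-1}=1,\ zxz^{-1}=x^{-1},\ zyz^{-1}=y^{-1}\rangle$ and $\pi_1(\mathcal{G}_4)=\langle \tilde x,\tilde y,\tilde z : \tilde x\tilde y\tilde x^{-1}\tilde y^{-1}=1,\ \tilde z\tilde x\tilde z^{-1}=\tilde y,\ \tilde z\tilde y\tilde z^{-1}=\tilde x^{-1}\rangle$. Coverings have connected total space. Two coverings $p_1:\mathcal{M}_1\to\mathcal{M}$ and $p_2:\mathcal{M}_2\to\mathcal{M}$ are equivalent if there is a homeomorphism $h:\mathcal{M}_1\to\mathcal{M}_2$ with $p_1=p_2\circ h$; equivalence classes of $n$-fold coverings of $\mathcal{M}$ correspond bijectively to conjugacy classes of subgroups of index $n$ in $\pi_1(\mathcal{M})$. For groups $H,G$, $c_{H,G}(n)$ denotes the number of conjugacy classes of subgroups of index $n$ in $G$ that are isomorphic to $H$. For a positive integer $n$, $\sigma_1(n)=\sum_{k\mid n}k$, $\sigma_2(n)=\sum_{k\mid n}\sigma_1(k)$, $\omega(n)=\sum_{k\mid n}k\,\sigma_1(k)$, and $\tau(n)=|\{(s,t) : s,t\in\mathbb{Z},\ s>0,\ t\ge 0,\ s^2+t^2=n\}|$. Divisor sums run over positive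 divisors. By convention these functions vanish at arguments that are not positive integers, and a sum over $a\mid r$ is $0$ if $r$ is not a positive integer. *)

theory Defs
  imports "HOL-Analysis.Analysis" "HOL-Algebra.Algebra"
begin

section \<open>Arithmetic functions\<close>

text \<open>Positive divisors of a real number: the set is empty unless the argument is a positive
  integer. So divisor sums over, say, \<open>n / 4\<close> vanish when \<open>n / 4\<close> is not an integer.\<close>

definition pos_divisors :: "real \<Rightarrow> nat set" where
  "pos_divisors x = {k. 0 < k \<and> (\<exists>m::nat. 0 < m \<and> x = real (k * m))}"

definition sigma1 :: "real \<Rightarrow> nat" where
  "sigma1 x = (\<Sum>k\<in>pos_divisors x. k)"

definition sigma2 :: "real \<Rightarrow> nat" where
  "sigma2 x = (\<Sum>k\<in>pos_divisors x. sigma1 (real k))"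

definition omega :: "real \<Rightarrow> nat" where
  "omega x = (\<Sum>k\<in>pos_divisors x. k * sigma1 (real k))"

definition tau :: "nat \<Rightarrow> nat" where
  "tau n = card {(s, t). (0::int) < s \<and> (0::int) \<le> t \<and> s\<^sup>2 + t\<^sup>2 = int n}"

lemma pos_divisors_of_nat:
  assumes "0 < n" shows "pos_divisors (real n) = {k. k dvd n}"
proof -
  have "(0 < k \<and> (\<exists>m::nat. 0 < m \<and> real n = real (k * m))) \<longleftrightarrow> k dvd n" for k
    using assms by (auto simp: dvd_def simp del: of_nat_mult)
  then show ?thesis by (simp add: pos_divisors_def)
qed

lemma pos_divisors_divide:
  assumes "0 < n" "0 < d"
  shows "pos_divisors (real n / real d) = (if d dvd n then {k. k dvd n div d} else {})"
proof (cases "d dvd n")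
  case True
  then obtain m where m: "n = d * m" by (auto simp: dvd_def)
  with assms show ?thesis using pos_divisors_of_nat[of m] by simp
next
  case False
  have "real n / real d \<noteq> real (k * m)" for k m
  proof
    assume "real n / real d = real (k * m)"
    then have "real n = real (k * m * d)" using assms by (simp add: field_simps)
    then have "n = k * m * d" by (simp only: of_nat_eq_iff)
    with False show False by simp
  qed
  with False show ?thesis by (simp add: pos_divisors_def)
qed

section \<open>Finitely presented groups\<close>

datatype 'g letter = Pos 'g | Neg 'g

fun letter_inv :: "'g letter \<Rightarrow> 'g letter" where
  "letter_inv (Pos g) = Neg g"
| "letter_inv (Neg g) = Pos g"

text \<open>\<open>word_eq R\<close> is the congruence on the free monoid of words generated by the
  cancellations \<open>a a\<^sup>-\<^sup>1 = 1\<close> and the relations \<open>u = v\<close> for \<open>(u, v) \<in> R\<close>.\<close>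

inductive word_eq :: "('g letter list \<times> 'g letter list) set \<Rightarrow> 'g letter list \<Rightarrow> 'g letter list \<Rightarrow> bool"
  for R where
  relator: "(u, v) \<in> R \<Longrightarrow> word_eq R u v"
| cancel: "word_eq R [a, letter_inv a] []"
| refl: "word_eq R u u"
| sym: "word_eq R u v \<Longrightarrow> word_eq R v u"
| trans: "word_eq R u v \<Longrightarrow> word_eq R v w \<Longrightarrow> word_eq R u w"
| append: "word_eq R u u' \<Longrightarrow> word_eq R v v' \<Longrightarrow> word_eq R (u @ v) (u' @ v')"

definition word_class :: "('g letter list \<times> 'g letter list) set \<Rightarrow> 'g letter list \<Rightarrow> 'g letter list set" where
  "word_class R u = {v. word_eq R u v}"

definition presented_group :: "('g letter list \<times> 'g letter list) set \<Rightarrow> 'g letter list set monoid" where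
  "presented_group R =
    \<lparr>carrier = range (word_class R),
     mult = (\<lambda>A B. {w. \<exists>u\<in>A. \<exists>v\<in>B. word_eq R (u @ v) w}),
     one = word_class R []\<rparr>"

lemma word_class_eq_iff: "word_class R u = word_class R v \<longleftrightarrow> word_eq R u v"
proof
  assume "word_class R u = word_class R v"
  moreover have "v \<in> word_class R v" by (simp add: word_class_def word_eq.refl)
  ultimately show "word_eq R u v" by (metis word_class_def mem_Collect_eq)
next
  assume uv: "word_eq R u v"
  show "word_class R u = word_class R v"
    unfolding word_class_def using word_eq.trans[OF uv] word_eq.trans[OF word_eq.sym[OF uv]] by blast
qed

lemma presented_group_mult:
  "word_class R u \<otimes>\<^bsub>presented_group R\<^esub> word_class R v = word_class R (u @ v)"
proof -
  have "(\<exists>u'. word_eq R u u' \<and> (\<exists>v'. word_eq R v v' \<and> word_eq R (u' @ v') w)) \<longleftrightarrow> word_eq R (u @ v) w" for w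
    by (meson word_eq.trans word_eq.append word_eq.refl)
  then show ?thesis by (simp add: presented_group_def word_class_def Bex_def)
qed

lemma letter_inv_inv [simp]: "letter_inv (letter_inv a) = a"
  by (cases a) auto

lemma word_eq_inverse: "word_eq R (rev (map letter_inv u) @ u) []"
proof (induction u)
  case (Cons a u)
  have "word_eq R [letter_inv a, a] []" using word_eq.cancel[of R "letter_inv a"] by simp
  then have "word_eq R (rev (map letter_inv u) @ [letter_inv a, a] @ u) (rev (map letter_inv u) @ [] @ u)"
    by (intro word_eq.append word_eq.refl)
  then have "word_eq R (rev (map letter_inv (a # u)) @ a # u) (rev (map letter_inv u) @ u)" by simp
  then show ?case using Cons.IH by (rule word_eq.trans)
qed (simp add: word_eq.refl)

lemma group_presented_group: "group (presented_group R)"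
proof (rule groupI)
  note [simp] = presented_group_mult
  have car: "carrier (presented_group R) = range (word_class R)"
    and one: "\<one>\<^bsub>presented_group R\<^esub> = word_class R []" by (auto simp: presented_group_def)
  show "\<one>\<^bsub>presented_group R\<^esub> \<in> carrier (presented_group R)" by (auto simp: car one)
  fix x assume "x \<in> carrier (presented_group R)"
  then obtain u where u: "x = word_class R u" by (auto simp: car)
  show "\<one>\<^bsub>presented_group R\<^esub> \<otimes>\<^bsub>presented_group R\<^esub> x = x" by (simp add: u one)
  show "\<exists>y\<in>carrier (presented_group R). y \<otimes>\<^bsub>presented_group R\<^esub> x = \<one>\<^bsub>presented_group R\<^esub>"
    unfolding u one car
    by (rule bexI[of _ "word_class R (rev (map letter_inv u))"])
      (auto simp: word_class_eq_iff intro: word_eq_inverse)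
  fix y assume "y \<in> carrier (presented_group R)"
  then obtain v where v: "y = word_class R v" by (auto simp: car)
  show "x \<otimes>\<^bsub>presented_group R\<^esub> y \<in> carrier (presented_group R)" by (auto simp: u v car)
  fix z assume "z \<in> carrier (presented_group R)"
  then obtain w where w: "z = word_class R w" by (auto simp: car)
  show "x \<otimes>\<^bsub>presented_group R\<^esub> y \<otimes>\<^bsub>presented_group R\<^esub> z
      = x \<otimes>\<^bsub>presented_group R\<^esub> (y \<otimes>\<^bsub>presented_group R\<^esub> z)" by (simp add: u v w)
qed

datatype gen = GX | GY | GZ

definition pi1_G1 :: "(int \<times> int \<times> int) monoid" where
  "pi1_G1 = integer_group \<times>\<times> (integer_group \<times>\<times> integer_group)"

definition pi1_G2 :: "gen letter list set monoid" where
  "pi1_G2 = presented_group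
    {([Pos GX, Pos GY, Neg GX, Neg GY], []),
     ([Pos GZ, Pos GX, Neg GZ], [Neg GX]),
     ([Pos GZ, Pos GY, Neg GZ], [Neg GY])}"

definition pi1_G4 :: "gen letter list set monoid" where
  "pi1_G4 = presented_group
    {([Pos GX, Pos GY, Neg GX, Neg GY], []),
     ([Pos GZ, Pos GX, Neg GZ], [Pos GY]),
     ([Pos GZ, Pos GY, Neg GZ], [Neg GX])}"

section \<open>Conjugacy classes of subgroups\<close>

definition subgroups_iso :: "('b, 'c) monoid_scheme \<Rightarrow> ('a, 'd) monoid_scheme \<Rightarrow> nat \<Rightarrow> 'a set set" where
  "subgroups_iso H G n =
    {K. subgroup K G \<and> finite (rcosets\<^bsub>G\<^esub> K) \<and> card (rcosets\<^bsub>G\<^esub> K) = n \<and>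
        G\<lparr>carrier := K\<rparr> \<cong> H}"

definition conj_class :: "('a, 'd) monoid_scheme \<Rightarrow> 'a set \<Rightarrow> 'a set set" where
  "conj_class G K = (\<lambda>g. g <#\<^bsub>G\<^esub> K #>\<^bsub>G\<^esub> inv\<^bsub>G\<^esub> g) ` carrier G"

definition subgroup_classes :: "('b, 'c) monoid_scheme \<Rightarrow> ('a, 'd) monoid_scheme \<Rightarrow> nat \<Rightarrow> 'a set set set" where
  "subgroup_classes H G n = conj_class G ` subgroups_iso H G n"

definition c_sub :: "('b, 'c) monoid_scheme \<Rightarrow> ('a, 'd) monoid_scheme \<Rightarrow> nat \<Rightarrow> nat" where
  "c_sub H G n = card (subgroup_classes H G n)"

section \<open>Coverings\<close>

text \<open>The counterpart of \<^const>\<open>covering_space\<close> for abstract topologies.\<close>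

definition covering_map :: "'a topology \<Rightarrow> ('a \<Rightarrow> 'b) \<Rightarrow> 'b topology \<Rightarrow> bool" where
  "covering_map N p M \<longleftrightarrow>
     continuous_map N M p \<and> p ` topspace N = topspace M \<and>
     (\<forall>y\<in>topspace M. \<exists>U. y \<in> U \<and> openin M U \<and>
        (\<exists>\<V>. \<Union>\<V> = {x \<in> topspace N. p x \<in> U} \<and>
             (\<forall>V\<in>\<V>. openin N V) \<and> pairwise disjnt \<V> \<and>
             (\<forall>V\<in>\<V>. homeomorphic_map (subtopology N V) (subtopology M U) p)))"

definition nfold_covering :: "nat \<Rightarrow> 'a topology \<Rightarrow> ('a \<Rightarrow> 'b) \<Rightarrow> 'b topology \<Rightarrow> bool" where
  "nfold_covering n N p M \<longleftrightarrow>
     connected_space N \<and> covering_map N p M \<and>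
     (\<forall>y\<in>topspace M. finite {x \<in> topspace N. p x = y} \<and> card {x \<in> topspace N. p x = y} = n)"

definition covering_equiv ::
    "'a topology \<Rightarrow> ('a \<Rightarrow> 'c) \<Rightarrow> 'b topology \<Rightarrow> ('b \<Rightarrow> 'c) \<Rightarrow> bool" where
  "covering_equiv N1 p1 N2 p2 \<longleftrightarrow>
     (\<exists>h. homeomorphic_map N1 N2 h \<and> (\<forall>x\<in>topspace N1. p1 x = p2 (h x)))"

text \<open>To count coverings up to equivalence, the points of the total spaces have to be taken from a
  fixed type. For finite-fold coverings of a space over \<open>'b\<close> the type \<open>'b \<times> nat\<close> is large enough:
  enumerating the fibres shows that every such covering, with points in whatever type, is equivalent
  to one of this kind (lemma \<open>nfold_covering_representative\<close>).\<close>

definition coverings :: "'a topology \<Rightarrow> 'b topology \<Rightarrow> nat \<Rightarrow> (('b \<times> nat) topology \<times> ('b \<times> nat \<Rightarrow> 'b)) set" where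
  "coverings F M n = {(N, p). nfold_covering n N p M \<and> N homeomorphic_space F}"

definition covering_rel :: "((('a topology \<times> ('a \<Rightarrow> 'b)) \<times> ('a topology \<times> ('a \<Rightarrow> 'b)))) set" where
  "covering_rel = {((N1, p1), (N2, p2)). covering_equiv N1 p1 N2 p2}"

text \<open>Equivalence classes of \<open>n\<close>-fold coverings of \<open>M\<close> with total space homeomorphic to \<open>F\<close>.\<close>

definition covering_classes ::
    "'a topology \<Rightarrow> 'b topology \<Rightarrow> nat \<Rightarrow> (('b \<times> nat) topology \<times> ('b \<times> nat \<Rightarrow> 'b)) set set" where
  "covering_classes F M n = coverings F M n // covering_rel"

lemma equiv_covering_rel:
  "equiv UNIV (covering_rel :: (('a topology \<times> ('a \<Rightarrow> 'b)) \<times> ('a topology \<times> ('a \<Rightarrow> 'b))) set)"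
proof (rule equivI)
  show "refl (covering_rel :: (('a topology \<times> ('a \<Rightarrow> 'b)) \<times> _) set)"
  proof (rule refl_onI)
    fix z :: "'a topology \<times> ('a \<Rightarrow> 'b)"
    obtain N p where z: "z = (N, p)" by force
    have "homeomorphic_map N N (\<lambda>x. x)"
      using homeomorphic_map_id[of N N] by (simp add: id_def)
    then show "(z, z) \<in> covering_rel"
      unfolding z covering_rel_def covering_equiv_def by auto
  qed
  show "sym (covering_rel :: (('a topology \<times> ('a \<Rightarrow> 'b)) \<times> _) set)"
  proof (rule symI)
    fix z w :: "'a topology \<times> ('a \<Rightarrow> 'b)" assume zw: "(z, w) \<in> covering_rel"
    obtain N p N' p' where e: "z = (N, p)" "w = (N', p')" by force
    with zw obtain h where h: "homeomorphic_map N N' h" "\<forall>x\<in>topspace N. p x = p' (h x)"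
      by (auto simp: covering_rel_def covering_equiv_def)
    then obtain g where g: "homeomorphic_maps N N' h g"
      by (auto simp: homeomorphic_map_maps)
    then have "homeomorphic_map N' N g"
      using homeomorphic_maps_map homeomorphic_maps_sym by blast
    moreover have "p' x = p (g x)" if "x \<in> topspace N'" for x
    proof -
      have "g x \<in> topspace N" "h (g x) = x"
        using g that unfolding homeomorphic_maps_def continuous_map_def by blast+
      with h(2) show ?thesis by metis
    qed
    ultimately show "(w, z) \<in> covering_rel"
      unfolding e covering_rel_def covering_equiv_def by auto
  qed
  show "trans (covering_rel :: (('a topology \<times> ('a \<Rightarrow> 'b)) \<times> _) set)"
  proof (rule transI)
    fix u z w :: "'a topology \<times> ('a \<Rightarrow> 'b)"
    assume A: "(u, z) \<in> covering_rel" "(z, w) \<in> covering_rel"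
    obtain N p N' p' N'' p'' where e: "u = (N, p)" "z = (N', p')" "w = (N'', p'')"
      by (metis surj_pair)
    with A obtain h k where h: "homeomorphic_map N N' h" "\<forall>x\<in>topspace N. p x = p' (h x)"
      and k: "homeomorphic_map N' N'' k" "\<forall>x\<in>topspace N'. p' x = p'' (k x)"
      by (auto simp: covering_rel_def covering_equiv_def)
    have "homeomorphic_map N N'' (k \<circ> h)" using h(1) k(1) by (rule homeomorphic_map_compose)
    moreover have "p x = p'' ((k \<circ> h) x)" if "x \<in> topspace N" for x
    proof -
      have "h x \<in> topspace N'" using homeomorphic_imp_surjective_map[OF h(1)] that by blast
      with h(2) k(2) that show ?thesis by simp
    qed
    ultimately show "(u, w) \<in> covering_rel"
      unfolding e covering_rel_def covering_equiv_def by blast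
  qed
qed auto

lemma covering_map_homeomorphic:
  assumes f: "homeomorphic_maps N' N f g" and c: "covering_map N p M"
  shows "covering_map N' (p \<circ> f) M"
  unfolding covering_map_def
proof (intro conjI ballI)
  have hf: "homeomorphic_map N' N f"
    using f by (simp add: homeomorphic_maps_map)
  have cf: "continuous_map N' N f"
    using f by (simp add: homeomorphic_maps_def)
  have surj: "f ` topspace N' = topspace N" using hf by (rule homeomorphic_imp_surjective_map)
  show "continuous_map N' M (p \<circ> f)"
    using c by (intro continuous_map_compose[OF cf]) (simp add: covering_map_def)
  show "(p \<circ> f) ` topspace N' = topspace M"
    using c by (simp only: covering_map_def image_comp[symmetric] surj)
  fix y assume "y \<in> topspace M"
  with c obtain U \<V> where U: "y \<in> U" "openin M U"
    and V: "\<Union>\<V> = {x \<in> topspace N. p x \<in> U}" "\<forall>V\<in>\<V>. openin N V" "pairwise disjnt \<V>"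
      "\<forall>V\<in>\<V>. homeomorphic_map (subtopology N V) (subtopology M U) p"
    unfolding covering_map_def by (elim conjE) (drule (1) bspec, elim exE conjE, blast)
  let ?pre = "\<lambda>V. {x \<in> topspace N'. f x \<in> V}"
  have "\<Union>(?pre ` \<V>) = {x \<in> topspace N'. (p \<circ> f) x \<in> U}"
    using V(1) surj by (auto simp: set_eq_iff)
  moreover have "\<forall>V\<in>?pre ` \<V>. openin N' V"
    using V(2) cf by (auto simp: continuous_map_def)
  moreover have "pairwise disjnt (?pre ` \<V>)"
    using V(3) by (auto simp: pairwise_def disjnt_iff)
  moreover have "homeomorphic_map (subtopology N' (?pre V)) (subtopology M U) (p \<circ> f)"
    if "V \<in> \<V>" for V
  proof -
    have "f ` (topspace N' \<inter> ?pre V) = f ` topspace N' \<inter> V" by auto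
    then have "f ` (topspace N' \<inter> ?pre V) = topspace N \<inter> V" by (simp only: surj)
    then have "homeomorphic_map (subtopology N' (?pre V)) (subtopology N V) f"
      using hf by (rule homeomorphic_map_subtopologies[rotated])
    moreover have "homeomorphic_map (subtopology N V) (subtopology M U) p" using V(4) that by blast
    ultimately show ?thesis by (rule homeomorphic_map_compose)
  qed
  ultimately show "\<exists>U. y \<in> U \<and> openin M U \<and>
        (\<exists>\<V>. \<Union>\<V> = {x \<in> topspace N'. (p \<circ> f) x \<in> U} \<and>
             (\<forall>V\<in>\<V>. openin N' V) \<and> pairwise disjnt \<V> \<and>
             (\<forall>V\<in>\<V>. homeomorphic_map (subtopology N' V) (subtopology M U) (p \<circ> f)))"
    using U by (intro exI[of _ U] conjI exI[of _ "?pre ` \<V>"]) auto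
qed

lemma nfold_covering_representative:
  fixes N :: "'a topology" and M :: "'b topology"
  assumes c: "nfold_covering n N p M"
  obtains N' :: "('b \<times> nat) topology" and p'
  where "nfold_covering n N' p' M" "N' homeomorphic_space N" "covering_equiv N p N' p'"
proof -
  have fib: "finite {x \<in> topspace N. p x = y}" if "y \<in> topspace M" for y
    using c that unfolding nfold_covering_def by blast
  have pM: "p x \<in> topspace M" if "x \<in> topspace N" for x
    using c that unfolding nfold_covering_def covering_map_def by blast
  have "\<exists>e::'a \<Rightarrow> nat. inj_on e {x \<in> topspace N. p x = y}" if "y \<in> topspace M" for y
    using finite_imp_inj_to_nat_seg[OF fib[OF that]] by blast
  then obtain e :: "'b \<Rightarrow> 'a \<Rightarrow> nat"
    where e: "\<And>y. y \<in> topspace M \<Longrightarrow> inj_on (e y) {x \<in> topspace N. p x = y}" by metis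
  define h where "h x = (p x, e (p x) x)" for x
  have inj: "inj_on h (topspace N)"
  proof (rule inj_onI)
    fix x y assume xy: "x \<in> topspace N" "y \<in> topspace N" "h x = h y"
    then have "p x = p y" "e (p y) x = e (p y) y" by (auto simp: h_def)
    with inj_onD[OF e[OF pM[OF xy(2)]], of x y] xy show "x = y" by auto
  qed
  define g where "g = inv_into (topspace N) h"
  have gh: "g (h x) = x" if "x \<in> topspace N" for x
    using that inj by (simp add: g_def)
  define N' where "N' = pullback_topology (h ` topspace N) g N"
  have gin: "g y \<in> topspace N" and hg: "h (g y) = y" if "y \<in> h ` topspace N" for y
    using that by (auto simp: gh)
  have top: "topspace N' = h ` topspace N"
    unfolding N'_def topspace_pullback_topology using gin by auto
  have "continuous_map N' N g"
    unfolding N'_def using continuous_map_pullback[OF continuous_map_id] by (metis id_comp)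
  moreover have "continuous_map N N' h"
    unfolding N'_def
    by (rule continuous_map_pullback')
      (auto intro: continuous_map_eq[OF continuous_map_id] simp: gh)
  ultimately have hm: "homeomorphic_maps N' N g h"
    unfolding homeomorphic_maps_def using gh top hg by auto
  have hs: "N' homeomorphic_space N" using hm unfolding homeomorphic_space_def by blast
  have cov: "covering_map N' (p \<circ> g) M"
    using covering_map_homeomorphic[OF hm] c unfolding nfold_covering_def by blast
  have con: "connected_space N'"
    using c homeomorphic_connected_space[OF hs] unfolding nfold_covering_def by blast
  have f': "{x \<in> topspace N'. (p \<circ> g) x = y} = h ` {x \<in> topspace N. p x = y}" for y
    using top gh by force
  have "inj_on h {x \<in> topspace N. p x = y}" for y
    using inj by (rule inj_on_subset) auto
  then have nf: "nfold_covering n N' (p \<circ> g) M"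
    using c con cov unfolding nfold_covering_def f' by (simp add: card_image)
  have "homeomorphic_map N N' h"
    using hm homeomorphic_maps_map homeomorphic_maps_sym by blast
  then have "covering_equiv N p N' (p \<circ> g)"
    unfolding covering_equiv_def using gh by auto
  with nf hs that show ?thesis by blast
qed

section \<open>The flat manifolds\<close>

text \<open>The subgroup of the permutation group of \<open>\<real>\<^sup>3\<close> generated by \<open>S\<close>, and the orbit
  space with its quotient topology; the points of the orbit space are the orbits themselves.\<close>

definition motion_group :: "(real^3 \<Rightarrow> real^3) set \<Rightarrow> (real^3 \<Rightarrow> real^3) set" where
  "motion_group S = generate (BijGroup UNIV) S"

definition motion_orbit :: "(real^3 \<Rightarrow> real^3) set \<Rightarrow> real^3 \<Rightarrow> (real^3) set" where
  "motion_orbit \<Gamma> v = (\<lambda>\<gamma>. \<gamma> v) ` \<Gamma>"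

definition orbit_space :: "(real^3 \<Rightarrow> real^3) set \<Rightarrow> (real^3) set topology" where
  "orbit_space \<Gamma> = topology (\<lambda>U. U \<subseteq> range (motion_orbit \<Gamma>) \<and> open (motion_orbit \<Gamma> -` U))"

lemma openin_orbit_space:
  "openin (orbit_space \<Gamma>) U \<longleftrightarrow> U \<subseteq> range (motion_orbit \<Gamma>) \<and> open (motion_orbit \<Gamma> -` U)"
proof -
  have "istopology (\<lambda>U. U \<subseteq> range (motion_orbit \<Gamma>) \<and> open (motion_orbit \<Gamma> -` U))"
    unfolding istopology_def by (auto simp: vimage_Union)
  then show ?thesis by (simp add: orbit_space_def)
qed

lemma topspace_orbit_space: "topspace (orbit_space \<Gamma>) = range (motion_orbit \<Gamma>)"
proof -
  have "openin (orbit_space \<Gamma>) (range (motion_orbit \<Gamma>))"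
    by (simp add: openin_orbit_space vimage_def)
  then show ?thesis
    using openin_subset openin_topspace openin_orbit_space by (metis subset_antisym)
qed

lemma quotient_map_orbit_space: "quotient_map euclidean (orbit_space \<Gamma>) (motion_orbit \<Gamma>)"
  unfolding quotient_map_def topspace_orbit_space openin_orbit_space
  by (auto simp: vimage_def)

definition transl_x :: "real^3 \<Rightarrow> real^3" where
  "transl_x v = vector [v$1 + 1, v$2, v$3]"

definition transl_y :: "real^3 \<Rightarrow> real^3" where
  "transl_y v = vector [v$1, v$2 + 1, v$3]"

definition transl_z :: "real^3 \<Rightarrow> real^3" where
  "transl_z v = vector [v$1, v$2, v$3 + 1]"

text \<open>Screw motions along the third axis, by a half turn and by a quarter turn.\<close>

definition screw2 :: "real^3 \<Rightarrow> real^3" where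
  "screw2 v = vector [- (v$1), - (v$2), v$3 + 1]"

definition screw4 :: "real^3 \<Rightarrow> real^3" where
  "screw4 v = vector [- (v$2), v$1, v$3 + 1]"

definition manifold_G1 :: "(real^3) set topology" where
  "manifold_G1 = orbit_space (motion_group {transl_x, transl_y, transl_z})"

definition manifold_G2 :: "(real^3) set topology" where
  "manifold_G2 = orbit_space (motion_group {transl_x, transl_y, screw2})"

definition manifold_G4 :: "(real^3) set topology" where
  "manifold_G4 = orbit_space (motion_group {transl_x, transl_y, screw4})"

text \<open>The defining relations of \<^const>\<open>pi1_G2\<close> and \<^const>\<open>pi1_G4\<close> hold for the motions, with
  \<open>GX\<close>, \<open>GY\<close> acting as the translations and \<open>GZ\<close> as the screw motion. The three motion groups
  act freely and properly discontinuously on \<open>\<real>\<^sup>3\<close>, with compact quotient, so they are the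
  fundamental groups of the orbit spaces.\<close>

lemma motion_relations:
  "transl_x \<circ> transl_y = transl_y \<circ> transl_x"
  "transl_x \<circ> screw2 \<circ> transl_x = screw2" "transl_y \<circ> screw2 \<circ> transl_y = screw2"
  "screw4 \<circ> transl_x = transl_y \<circ> screw4" "transl_x \<circ> screw4 \<circ> transl_y = screw4"
  by (auto simp: fun_eq_iff vec_eq_iff forall_3 transl_x_def transl_y_def screw2_def screw4_def)

lemma motions_in_BijGroup:
  "{transl_x, transl_y, transl_z, screw2, screw4} \<subseteq> carrier (BijGroup UNIV)"
proof -
  have "bij transl_x"
    by (rule o_bij[of "\<lambda>v. vector [v$1 - 1, v$2, v$3]"])
      (auto simp: fun_eq_iff vec_eq_iff forall_3 transl_x_def)
  moreover have "bij transl_y"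
    by (rule o_bij[of "\<lambda>v. vector [v$1, v$2 - 1, v$3]"])
      (auto simp: fun_eq_iff vec_eq_iff forall_3 transl_y_def)
  moreover have "bij transl_z"
    by (rule o_bij[of "\<lambda>v. vector [v$1, v$2, v$3 - 1]"])
      (auto simp: fun_eq_iff vec_eq_iff forall_3 transl_z_def)
  moreover have "bij screw2"
    by (rule o_bij[of "\<lambda>v. vector [- (v$1), - (v$2), v$3 - 1]"])
      (auto simp: fun_eq_iff vec_eq_iff forall_3 screw2_def)
  moreover have "bij screw4"
    by (rule o_bij[of "\<lambda>v. vector [v$2, - (v$1), v$3 - 1]"])
      (auto simp: fun_eq_iff vec_eq_iff forall_3 screw4_def)
  ultimately show ?thesis by (simp add: BijGroup_def Bij_def)
qed

end

theory Submission
  imports Defs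
begin

text \<open>
  The three manifolds are orbit spaces of \<open>\<real>\<^sup>3\<close>. Let \<open>e\<close> be 1, 2 or 4. The motions generated by two
  horizontal unit translations and the screw motion that raises the height by 1 and turns by \<open>e\<close>
  quarter turns form a group isomorphic to the semidirect product \<open>Tw e\<close> of \<open>\<int>\<^sup>2\<close> with \<open>\<int>\<close>, in which the
  generator of \<open>\<int>\<close> acts by \<open>e\<close> quarter turns. The presentations define the same three groups
  (\<open>pi1_G4_iso\<close>, \<open>pi1_G2_iso\<close>, \<open>pi1_G1_iso\<close>), and these are pairwise not isomorphic.

  Maps from Euclidean space lift through every covering (\<open>covering_lift_exists\<close>). Lifting the
  projection to orbits shows that every connected covering of the orbit space of \<open>\<Gamma>\<close> is the orbit
  space of a subgroup (\<open>covering_uniformized\<close>), with equivalence of coverings corresponding to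
  conjugacy (\<open>covering_equiv_iff_conj\<close>). Lifting homeomorphisms shows that homeomorphic orbit spaces
  have isomorphic groups (\<open>homeomorphic_orbit_spaces_iso\<close>). So coverings and subgroups are counted by
  the same classes in \<open>Tw 1\<close>.

  A subgroup of index \<open>n\<close> in \<open>Tw 1\<close> meets \<open>\<int>\<^sup>2\<close> in a lattice \<open>L\<close> of some index \<open>k\<close> and projects onto the
  multiples of some \<open>m\<close>, the height, with \<open>m k = n\<close>. An affine map of space conjugates it to the
  standard group of \<open>Tw e\<close>, where \<open>e\<close> is 1 for odd \<open>m\<close>, 4 if \<open>4\<close> divides \<open>m\<close>, and 2 otherwise
  (\<open>subs_geometry\<close>). This determines the covering space, and it is the reason for the three cases of
  the parity of \<open>n\<close>.

  Conjugation by \<open>\<int>\<^sup>2\<close> leaves of a subgroup exactly the pair of \<open>L\<close>, which is invariant under \<open>m\<close>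
  quarter turns, and a coset of \<open>L + (1 - i\<^sup>m) \<int>\<^sup>2\<close>; here \<open>i\<close> is the quarter turn. The remaining conjugations turn
  these pairs by quarter turns (\<open>subs_conj_iff\<close>). By Burnside's lemma for a cyclic group of order four
  (\<open>card_orbits_period_4\<close>) it suffices to count the pairs, those fixed by a half turn, and those fixed
  by a quarter turn. The lattices of index \<open>k\<close> number \<open>\<sigma>\<^sub>1(k)\<close>. Those fixed by a quarter turn are
  ideals of the Gaussian integers, which are principal; there are \<open>\<tau>(k)\<close> of them (\<open>card_ideals\<close>).
  Each of them has one or two fixed cosets according to the parity of \<open>k\<close>. For even \<open>m\<close>, a half turn
  fixes as many cosets as \<open>\<int>\<^sup>2 / L\<close> has elements of order at most two, and \<open>two_torsion_sum_eq\<close> sums these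
  numbers over all \<open>L\<close>.
  The results are \<open>class_count_odd\<close>, \<open>class_count_half\<close> and \<open>class_count_full\<close>; summing them over the
  divisors \<open>m\<close> of \<open>n\<close> with the given \<open>e\<close>, and using \<open>\<tau>(2 k) = \<tau>(k)\<close>, gives the formulas.
\<close>

section \<open>Lifting maps from Euclidean space through coverings\<close>

text \<open>The sheet of \<open>x\<close> over an evenly covered neighbourhood serves as \<open>V\<close>: the covering is
  injective on it, and the other points of the fibre lie in sheets disjoint from it. Injectivity
  makes the set where two lifts agree open, disjointness makes its complement open.\<close>

lemma covering_map_separated:
  assumes c: "covering_map N p M" and x: "x \<in> topspace N"
  shows "\<exists>V. openin N V \<and> x \<in> V \<and> inj_on p V \<and>
    (\<forall>x'\<in>topspace N. p x' = p x \<and> x' \<noteq> x \<longrightarrow> (\<exists>V'. openin N V' \<and> x' \<in> V' \<and> V \<inter> V' = {}))"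
proof -
  have "p x \<in> topspace M" using c x unfolding covering_map_def by blast
  then obtain U \<V> where U: "p x \<in> U" "openin M U"
    and V: "\<Union>\<V> = {x \<in> topspace N. p x \<in> U}" "\<forall>V\<in>\<V>. openin N V" "pairwise disjnt \<V>"
      "\<forall>V\<in>\<V>. homeomorphic_map (subtopology N V) (subtopology M U) p"
    using c unfolding covering_map_def by (elim conjE) (drule (1) bspec, elim exE conjE, blast)
  obtain V where V': "V \<in> \<V>" "x \<in> V" using V(1) U(1) x by blast
  have inj: "inj_on p W" if "W \<in> \<V>" for W
  proof -
    have "inj_on p (topspace (subtopology N W))"
      using V(4) that homeomorphic_imp_injective_map by blast
    moreover have "topspace (subtopology N W) = W" using V(2) that openin_subset by fastforce
    ultimately show ?thesis by simp
  qed
  have "\<exists>V'. openin N V' \<and> x' \<in> V' \<and> V \<inter> V' = {}"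
    if x': "x' \<in> topspace N" "p x' = p x" "x' \<noteq> x" for x'
  proof -
    obtain V2 where V2: "V2 \<in> \<V>" "x' \<in> V2" using V(1) U(1) x' by (metis (mono_tags, lifting) Union_iff mem_Collect_eq)
    have "V2 \<noteq> V" using inj_onD[OF inj[OF V'(1)] x'(2)] V' V2 x'(3) by blast
    then have "V \<inter> V2 = {}" using V(3) V' V2 by (auto simp: pairwise_def disjnt_def)
    then show ?thesis using V2 V(2) by blast
  qed
  then show ?thesis using V' V(2) inj by blast
qed

text \<open>The set where the lifts agree and the set where they differ are both open, so one of them is
  empty by connectedness.\<close>

lemma covering_lift_unique:
  assumes c: "covering_map N p M" and Y: "connected_space Y"
    and f: "continuous_map Y N f" and g: "continuous_map Y N g"
    and pfg: "\<And>x. x \<in> topspace Y \<Longrightarrow> p (f x) = p (g x)"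
    and a: "a \<in> topspace Y" "f a = g a" and x: "x \<in> topspace Y"
  shows "f x = g x"
proof -
  let ?E = "{x \<in> topspace Y. f x = g x}" and ?D = "{x \<in> topspace Y. f x \<noteq> g x}"
  have pre: "openin Y ({x \<in> topspace Y. f x \<in> V} \<inter> {x \<in> topspace Y. g x \<in> W})"
    if "openin N V" "openin N W" for V W
    using that f g by (intro openin_Int) (auto simp: continuous_map_def)
  have top: "f y \<in> topspace N" "g y \<in> topspace N" if "y \<in> topspace Y" for y
    using f g that by (auto simp: continuous_map_def)
  have "openin Y ?E"
  proof (subst openin_subopen, intro ballI)
    fix y assume y: "y \<in> ?E"
    obtain V where V: "openin N V" "f y \<in> V" "inj_on p V"
      using covering_map_separated[OF c top(1)] y by blast
    have "{x \<in> topspace Y. f x \<in> V} \<inter> {x \<in> topspace Y. g x \<in> V} \<subseteq> ?E"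
      using V(3) pfg by (auto dest: inj_onD)
    then show "\<exists>T. openin Y T \<and> y \<in> T \<and> T \<subseteq> ?E"
      using pre[OF V(1) V(1)] V(2) y by (intro exI conjI) auto
  qed
  moreover have "openin Y ?D"
  proof (subst openin_subopen, intro ballI)
    fix y assume y: "y \<in> ?D"
    obtain V V' where V: "openin N V" "f y \<in> V" "openin N V'" "g y \<in> V'" "V \<inter> V' = {}"
    proof -
      obtain V where V: "openin N V" "f y \<in> V" 
        "\<forall>x'\<in>topspace N. p x' = p (f y) \<and> x' \<noteq> f y \<longrightarrow> (\<exists>V'. openin N V' \<and> x' \<in> V' \<and> V \<inter> V' = {})"
        using covering_map_separated[OF c top(1)[of y]] y by blast
      have "\<exists>V'. openin N V' \<and> g y \<in> V' \<and> V \<inter> V' = {}"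
        using V(3) top(2)[of y] pfg[of y] y by auto
      then show ?thesis using that V by blast
    qed
    have "{x \<in> topspace Y. f x \<in> V} \<inter> {x \<in> topspace Y. g x \<in> V'} \<subseteq> ?D"
      using V(5) by auto
    then show "\<exists>T. openin Y T \<and> y \<in> T \<and> T \<subseteq> ?D"
      using pre[OF V(1) V(3)] V(2,4) y by (intro exI conjI) auto
  qed
  moreover have "?E \<union> ?D = topspace Y" "?E \<inter> ?D = {}" "?E \<noteq> {}" using a by auto
  ultimately have "?D = {}" using Y unfolding connected_space_eq by blast
  then show ?thesis using x by blast
qed

text \<open>The lift can be prescribed at any point of \<open>S\<close>, so that lifts over two overlapping sets can be
  made to agree at a common point.\<close>

definition liftable :: "'a topology \<Rightarrow> ('a \<Rightarrow> 'b) \<Rightarrow> ('e::euclidean_space \<Rightarrow> 'b) \<Rightarrow> 'e set \<Rightarrow> bool" where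
  "liftable N p q S \<longleftrightarrow> (\<forall>v\<in>S. \<forall>x\<in>topspace N. p x = q v \<longrightarrow>
     (\<exists>f. continuous_map (top_of_set S) N f \<and> (\<forall>w\<in>S. p (f w) = q w) \<and> f v = x))"

text \<open>Over an evenly covered set, a lift is \<open>q\<close> followed by the inverse of the projection of the
  sheet that contains the prescribed point.\<close>

lemma liftable_locally:
  assumes c: "covering_map N p M" and q: "continuous_map euclidean M q"
  obtains W where "open W" "v \<in> W" "\<And>S. S \<subseteq> W \<Longrightarrow> liftable N p q S"
proof -
  have "q v \<in> topspace M" using q by (auto simp: continuous_map_def)
  then obtain U \<V> where U: "q v \<in> U" "openin M U"
    and V: "\<Union>\<V> = {x \<in> topspace N. p x \<in> U}" "\<forall>V\<in>\<V>. openin N V" "pairwise disjnt \<V>"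
      "\<forall>V\<in>\<V>. homeomorphic_map (subtopology N V) (subtopology M U) p"
    using c unfolding covering_map_def by (elim conjE) (drule (1) bspec, elim exE conjE, blast)
  let ?W = "{w. q w \<in> U}"
  have "open ?W" using q U(2) by (auto simp: continuous_map_def)
  moreover have "liftable N p q S" if S: "S \<subseteq> ?W" for S
    unfolding liftable_def
  proof (intro ballI impI)
    fix u x assume u: "u \<in> S" "x \<in> topspace N" "p x = q u"
    then obtain V where V': "V \<in> \<V>" "x \<in> V" using V(1) S by (metis (mono_tags, lifting) Union_iff mem_Collect_eq subsetD)
    have tV: "topspace (subtopology N V) = V" using V(2) V' openin_subset by fastforce
    have tU: "topspace (subtopology M U) = U" using U openin_subset by fastforce
    obtain r where r: "homeomorphic_maps (subtopology N V) (subtopology M U) p r"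
      using V(4) V'(1) homeomorphic_map_maps by blast
    have cr: "continuous_map (subtopology M U) N r"
      using r by (auto simp: homeomorphic_maps_def intro: continuous_map_into_fulltopology)
    have "continuous_map (top_of_set S) M q"
      using q by (simp add: continuous_map_from_subtopology)
    then have "continuous_map (top_of_set S) (subtopology M U) q"
      using S by (auto simp: continuous_map_in_subtopology)
    then have "continuous_map (top_of_set S) N (r \<circ> q)" using cr by (rule continuous_map_compose)
    moreover have "p ((r \<circ> q) w) = q w" if "w \<in> S" for w
      using r S that tU by (auto simp: homeomorphic_maps_def)
    moreover have "(r \<circ> q) u = x"
      using r u(3)[symmetric] tV V' by (auto simp: homeomorphic_maps_def)
    ultimately show "\<exists>f. continuous_map (top_of_set S) N f \<and> (\<forall>w\<in>S. p (f w) = q w) \<and> f u = x"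
      by blast
  qed
  ultimately show ?thesis using U(1) that by blast
qed

text \<open>Lifts on the two sets that agree at one point of the intersection agree on all of it, since it
  is connected; they are then pasted along closed sets.\<close>

lemma liftable_Un:
  assumes c: "covering_map N p M"
    and ST: "closed S" "closed T" "connected (S \<inter> T)" "S \<inter> T \<noteq> {}"
    and S: "liftable N p q S" and T: "liftable N p q T"
  shows "liftable N p q (S \<union> T)"
proof -
  have step: "\<exists>f. continuous_map (top_of_set (A \<union> B)) N f \<and> (\<forall>w\<in>A \<union> B. p (f w) = q w) \<and> f v = x"
    if cl: "closed A" "closed B" "connected (A \<inter> B)" "A \<inter> B \<noteq> {}"
      and A: "liftable N p q A" and B: "liftable N p q B"
      and v: "v \<in> A" "x \<in> topspace N" "p x = q v" for A B v x
  proof -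
    obtain f where f: "continuous_map (top_of_set A) N f" "\<forall>w\<in>A. p (f w) = q w" "f v = x"
      using A v unfolding liftable_def by blast
    obtain u where u: "u \<in> A \<inter> B" using cl by blast
    have "f u \<in> topspace N" "p (f u) = q u" using f u by (auto simp: continuous_map_def)
    then obtain g where g: "continuous_map (top_of_set B) N g" "\<forall>w\<in>B. p (g w) = q w" "g u = f u"
      using B u unfolding liftable_def by blast
    have agree: "f w = g w" if "w \<in> A \<inter> B" for w
    proof (rule covering_lift_unique[OF c, where Y = "top_of_set (A \<inter> B)" and f = f and g = g and x = w and a = u])
      show "connected_space (top_of_set (A \<inter> B))" using cl(3) by (intro connected_space_subtopology) simp
      show "continuous_map (top_of_set (A \<inter> B)) N f" "continuous_map (top_of_set (A \<inter> B)) N g"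
        using f(1) g(1) by (auto intro: continuous_map_from_subtopology_mono)
    qed (use f g u that in auto)
    let ?h = "\<lambda>w. if w \<in> A then f w else g w"
    have "continuous_map (top_of_set (A \<union> B)) N ?h"
    proof (rule pasting_lemma_closed[of "{True, False}" _ "\<lambda>i. if i then A else B" _ "\<lambda>i. if i then f else g"])
      show "closedin (top_of_set (A \<union> B)) (if i then A else B)" for i
        using cl by (auto intro: closed_subset)
      show "continuous_map (subtopology (top_of_set (A \<union> B)) (if i then A else B)) N (if i then f else g)" for i
        using f g by (auto simp: subtopology_subtopology Int_absorb1 Int_commute)
    qed (use agree in auto)
    moreover have "\<forall>w\<in>A \<union> B. p (?h w) = q w" using f g by auto
    ultimately show ?thesis using f(3) v by (intro exI[of _ ?h]) auto
  qed
  show ?thesis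
    unfolding liftable_def
  proof (intro ballI impI)
    fix v x assume v: "v \<in> S \<union> T" "x \<in> topspace N" "p x = q v"
    show "\<exists>f. continuous_map (top_of_set (S \<union> T)) N f \<and> (\<forall>w\<in>S \<union> T. p (f w) = q w) \<and> f v = x"
    proof (cases "v \<in> S")
      case True
      then show ?thesis using step[OF ST S T] v by blast
    next
      case False
      then have vT: "v \<in> T" using v by blast
      have c2: "connected (T \<inter> S)" "T \<inter> S \<noteq> {}" using ST by (auto simp: Int_commute)
      show ?thesis using step[OF ST(2,1) c2 T S vT v(2,3)] by (simp add: Un_commute)
    qed
  qed
qed

text \<open>A Lebesgue number for the locally liftable sets makes every box with sides at most \<open>\<delta>\<close>
  liftable. Long sides are admitted one coordinate at a time: a box that is long in direction \<open>k\<close>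
  is cut into slabs of thickness at most \<open>\<delta>\<close>, which meet in convex faces and are glued one after
  the other.\<close>

lemma liftable_cbox:
  fixes a b :: "'e::euclidean_space"
  assumes c: "covering_map N p M" and q: "continuous_map euclidean M q"
  shows "liftable N p q (cbox a b)"
proof -
  define \<W> where "\<W> = {W. open W \<and> (\<forall>S. S \<subseteq> W \<longrightarrow> liftable N p q S)}"
  have "cbox a b \<subseteq> \<Union>\<W>"
    using liftable_locally[OF c q] unfolding \<W>_def by blast
  then obtain e where e: "e > 0" "\<And>x. x \<in> cbox a b \<Longrightarrow> \<exists>W\<in>\<W>. ball x e \<subseteq> W"
    using Heine_Borel_lemma[OF compact_cbox, of a b \<W>] unfolding \<W>_def by blast
  \<comment> \<open>The norm is at most the sum of the absolute values of the coordinates, so a box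
    with sides at most \<delta> lies in the e-ball around its lower corner.\<close>
  define \<delta> where "\<delta> = e / (2 * real DIM('e))"
  have \<delta>: "\<delta> > 0" "real DIM('e) * \<delta> < e" using e by (auto simp: \<delta>_def field_simps)
  have small: "liftable N p q (cbox c d)"
    if sub: "cbox c d \<subseteq> cbox a b" and side: "\<And>i. i \<in> Basis \<Longrightarrow> d \<bullet> i - c \<bullet> i \<le> \<delta>" for c d :: 'e
  proof (cases "cbox c d = {}")
    case True
    then show ?thesis by (simp add: liftable_def)
  next
    case False
    then have le: "c \<bullet> i \<le> d \<bullet> i" if "i \<in> Basis" for i using that by (simp add: box_ne_empty)
    then have cin: "c \<in> cbox c d" by (simp add: mem_box)
    have "cbox c d \<subseteq> ball c e"
    proof
      fix y assume y: "y \<in> cbox c d"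
      have "norm (y - c) \<le> (\<Sum>i\<in>Basis. \<bar>(y - c) \<bullet> i\<bar>)" by (rule norm_le_l1)
      also have "\<dots> \<le> (\<Sum>i\<in>(Basis::'e set). \<delta>)"
        using y side by (intro sum_mono) (fastforce simp: mem_box inner_diff_left)
      also have "\<dots> < e" using \<delta> by simp
      finally show "y \<in> ball c e" by (simp add: dist_norm norm_minus_commute)
    qed
    moreover obtain W where "W \<in> \<W>" "ball c e \<subseteq> W" using e(2)[of c] cin sub by blast
    ultimately show ?thesis unfolding \<W>_def by blast
  qed
  have "liftable N p q (cbox c d)"
    if "finite D" "D \<subseteq> Basis" "cbox c d \<subseteq> cbox a b" "\<And>i. i \<in> Basis - D \<Longrightarrow> d \<bullet> i - c \<bullet> i \<le> \<delta>"
    for D and c d :: 'e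
    using that
  proof (induction D arbitrary: c d rule: finite_induct)
    case empty
    then show ?case using small by blast
  next
    case (insert k D)
    have k: "k \<in> Basis" using insert by blast
    have "liftable N p q (cbox c d)"
      if "cbox c d \<subseteq> cbox a b" "\<And>i. i \<in> Basis - insert k D \<Longrightarrow> d \<bullet> i - c \<bullet> i \<le> \<delta>"
        "d \<bullet> k - c \<bullet> k \<le> real (Suc m) * \<delta>" for m and c d :: 'e
      using that
    proof (induction m arbitrary: c d)
      case 0
      show ?case
      proof (rule insert.IH)
        show "d \<bullet> i - c \<bullet> i \<le> \<delta>" if "i \<in> Basis - D" for i
          using 0 that by (cases "i = k") auto
      qed (use insert.prems 0 in auto)
    next
      case (Suc m)
      show ?case
      proof (cases "cbox c d = {} \<or> d \<bullet> k - c \<bullet> k \<le> \<delta>")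
        case True
        show ?thesis
        proof (cases "cbox c d = {}")
          case True
          then show ?thesis by (simp add: liftable_def)
        next
          case False
          with True have "d \<bullet> k - c \<bullet> k \<le> \<delta>" by blast
          moreover have "\<delta> \<le> real (Suc m) * \<delta>" using \<delta>(1) by (simp add: distrib_right)
          ultimately show ?thesis using Suc.IH Suc.prems(1,2) by fastforce
        qed
      next
        case False
        \<comment> \<open>The slab above t has thickness \<delta>; what remains is shorter by \<delta>.\<close>
        define t where "t = d \<bullet> k - \<delta>"
        define d' where "d' = (\<Sum>i\<in>Basis. (if i = k then min (d \<bullet> k) t else d \<bullet> i) *\<^sub>R i)"
        define c' where "c' = (\<Sum>i\<in>Basis. (if i = k then max (c \<bullet> k) t else c \<bullet> i) *\<^sub>R i)"
        have le: "c \<bullet> i \<le> d \<bullet> i" if "i \<in> Basis" for i using False that by (simp add: box_ne_empty)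
        have t: "c \<bullet> k \<le> t" "t \<le> d \<bullet> k" using False \<delta> by (auto simp: t_def)
        have L: "cbox c d \<inter> {x. x \<bullet> k \<le> t} = cbox c d'" and R: "cbox c d \<inter> {x. t \<le> x \<bullet> k} = cbox c' d"
          using interval_split(1)[OF k, of c d t] interval_split(2)[OF k, of c d t] by (simp_all add: d'_def c'_def)
        have d'i: "d' \<bullet> i = (if i = k then t else d \<bullet> i)" and c'i: "c' \<bullet> i = (if i = k then t else c \<bullet> i)"
          if "i \<in> Basis" for i
          using that t by (auto simp: d'_def c'_def)
        have "liftable N p q (cbox c d')"
        proof (rule Suc.IH)
          show "cbox c d' \<subseteq> cbox a b" using L Suc.prems(1) by blast
          show "d' \<bullet> i - c \<bullet> i \<le> \<delta>" if "i \<in> Basis - insert k D" for i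
            using that Suc.prems(2)[of i] d'i[of i] by auto
          show "d' \<bullet> k - c \<bullet> k \<le> real (Suc m) * \<delta>"
            using Suc.prems(3) d'i[OF k] by (simp add: t_def algebra_simps)
        qed
        moreover have "liftable N p q (cbox c' d)"
        proof (rule insert.IH)
          show "cbox c' d \<subseteq> cbox a b" using R Suc.prems(1) by blast
          show "d \<bullet> i - c' \<bullet> i \<le> \<delta>" if "i \<in> Basis - D" for i
            using that Suc.prems(2)[of i] c'i[of i] by (auto simp: t_def)
        qed (use insert.prems in auto)
        moreover have "cbox c d = cbox c d' \<union> cbox c' d" unfolding L[symmetric] R[symmetric] by auto
        moreover have "convex (cbox c d' \<inter> cbox c' d)" by (intro convex_Int convex_box)
        moreover have "d' \<in> cbox c d' \<inter> cbox c' d" 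
          using le t k by (auto simp: mem_box d'i c'i)
        ultimately show ?thesis
          using liftable_Un[OF c closed_cbox closed_cbox convex_connected] by (metis empty_iff)
      qed
    qed
    moreover obtain m where "d \<bullet> k - c \<bullet> k \<le> real (Suc m) * \<delta>"
    proof -
      obtain m where "(d \<bullet> k - c \<bullet> k) / \<delta> < real m" using reals_Archimedean2 by blast
      then have "d \<bullet> k - c \<bullet> k \<le> real (Suc m) * \<delta>" using \<delta>(1) by (simp add: field_simps)
      then show ?thesis using that by blast
    qed
    ultimately show ?case using insert.prems by blast
  qed
  from this[of Basis a b] show ?thesis by simp
qed

text \<open>Space is exhausted by open boxes around \<open>v\<close> whose closures are liftable. The lifts that take
  \<open>v\<close> to \<open>x\<close> agree where the boxes meet, by uniqueness, and define one map.\<close>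

theorem covering_lift_exists:
  fixes q :: "'e::euclidean_space \<Rightarrow> 'b"
  assumes c: "covering_map N p M" and q: "continuous_map euclidean M q"
    and x: "x \<in> topspace N" "p x = q v"
  obtains f where "continuous_map euclidean N f" "\<And>w. p (f w) = q w" "f v = x"
proof -
  define C where "C m = cbox (v - real (Suc m) *\<^sub>R One) (v + real (Suc m) *\<^sub>R One)" for m
  define B where "B m = box (v - real (Suc m) *\<^sub>R One) (v + real (Suc m) *\<^sub>R One)" for m
  have v: "v \<in> B m" for m by (auto simp: B_def mem_box inner_simps)
  have BC: "B m \<subseteq> C m" for m unfolding B_def C_def by (rule box_subset_cbox)
  have cover: "\<exists>m. w \<in> B m" for w
  proof -
    obtain m where m: "norm (w - v) < real m" using reals_Archimedean2 by blast
    have "\<bar>(w - v) \<bullet> i\<bar> < real (Suc m)" if "i \<in> Basis" for i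
      using Basis_le_norm[OF that, of "w - v"] m by simp
    then have "w \<in> B m" unfolding B_def mem_box by (fastforce simp: inner_simps abs_less_iff)
    then show ?thesis ..
  qed
  have "\<exists>f. continuous_map (top_of_set (C m)) N f \<and> (\<forall>w\<in>C m. p (f w) = q w) \<and> f v = x" for m
    using liftable_cbox[OF c q] x v BC unfolding C_def liftable_def by blast
  then obtain F where F: "\<And>m. continuous_map (top_of_set (C m)) N (F m)"
    "\<And>m w. w \<in> C m \<Longrightarrow> p (F m w) = q w" "\<And>m. F m v = x" by metis
  have FB: "continuous_map (top_of_set (B m)) N (F m)" for m
    using F(1) BC by (rule continuous_map_from_subtopology_mono)
  have agree: "F i w = F j w" if "w \<in> B i \<inter> B j" for i j w
  proof (rule covering_lift_unique[OF c, where Y = "top_of_set (B i \<inter> B j)" and f = "F i" and g = "F j" and x = w and a = v])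
    have "convex (B i \<inter> B j)" unfolding B_def by (intro convex_Int convex_box)
    then show "connected_space (top_of_set (B i \<inter> B j))"
      by (intro connected_space_subtopology) (simp add: convex_connected)
    show "continuous_map (top_of_set (B i \<inter> B j)) N (F i)" "continuous_map (top_of_set (B i \<inter> B j)) N (F j)"
      using FB by (auto intro: continuous_map_from_subtopology_mono)
    show "p (F i u) = p (F j u)" if "u \<in> topspace (top_of_set (B i \<inter> B j))" for u
      using that F(2)[of u] BC by (metis IntE subsetD topspace_euclidean_subtopology)
  qed (use F v that in auto)
  obtain g where g: "continuous_map euclidean N g" "\<And>w i. w \<in> B i \<Longrightarrow> g w = F i w"
  proof (rule pasting_lemma_exists[where X = euclidean and I = UNIV and T = B and Y = N and f = F])
    show "topspace euclidean \<subseteq> (\<Union>i. B i)" using cover by auto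
    show "openin euclidean (B i)" for i by (simp add: B_def open_box)
    show "continuous_map (subtopology euclidean (B i)) N (F i)" for i by (rule FB)
    show "F i w = F j w" if "w \<in> topspace euclidean \<inter> B i \<inter> B j" for i j w
      using that by (intro agree) simp
  qed (rule that; simp)
  show ?thesis
  proof (rule that[OF g(1)])
    show "p (g w) = q w" for w using cover[of w] g(2) F(2) BC by (metis subsetD)
    show "g v = x" using g(2)[OF v] F(3) by simp
  qed
qed

section \<open>Invariants, quotients and conjugacy classes\<close>

text \<open>Two invariants that classify the same objects in the same way take equally many values. Counts
  of coverings, subgroups and cosets are transferred in this way.\<close>

lemma bij_betw_images:
  assumes "\<And>a b. a \<in> A \<Longrightarrow> b \<in> A \<Longrightarrow> f a = f b \<longleftrightarrow> g a = g b"
  obtains h where "bij_betw h (f ` A) (g ` A)"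
proof -
  let ?h = "\<lambda>y. g (inv_into A f y)"
  have h: "?h (f a) = g a" if "a \<in> A" for a
  proof -
    have "f (inv_into A f (f a)) = f a" "inv_into A f (f a) \<in> A"
      using that by (auto intro: f_inv_into_f inv_into_into)
    then show ?thesis using assms that by blast
  qed
  then have "?h ` f ` A = g ` A" by (force simp: image_iff)
  moreover have "inj_on ?h (f ` A)" using h assms by (auto simp: inj_on_def)
  ultimately show ?thesis using that by (auto simp: bij_betw_def)
qed

text \<open>Each map factors through the other, and the two factors are inverse to each other.\<close>

lemma quotient_maps_same_fibres:
  assumes f: "quotient_map Z N1 f" and g: "quotient_map Z N2 g"
    and fib: "\<And>x y. x \<in> topspace Z \<Longrightarrow> y \<in> topspace Z \<Longrightarrow> f x = f y \<longleftrightarrow> g x = g y"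
  shows "\<exists>h. homeomorphic_map N1 N2 h \<and> (\<forall>x\<in>topspace Z. h (f x) = g x)"
proof -
  obtain h where h: "continuous_map N1 N2 h" "\<And>x. x \<in> topspace Z \<Longrightarrow> h (f x) = g x"
    using quotient_map_lift_exists[OF f quotient_imp_continuous_map[OF g]] fib by metis
  obtain k where k: "continuous_map N2 N1 k" "\<And>x. x \<in> topspace Z \<Longrightarrow> k (g x) = f x"
    using quotient_map_lift_exists[OF g quotient_imp_continuous_map[OF f]] fib by metis
  have "k (h y) = y" if "y \<in> topspace N1" for y
    using that h(2) k(2) quotient_imp_surjective_map[OF f] by force
  moreover have "h (k y) = y" if "y \<in> topspace N2" for y
    using that h(2) k(2) quotient_imp_surjective_map[OF g] by force
  ultimately have "homeomorphic_maps N1 N2 h k" using h k by (auto simp: homeomorphic_maps_def)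
  then have "homeomorphic_map N1 N2 h" by (rule homeomorphic_maps_imp_map)
  then show ?thesis using h(2) by blast
qed

lemma conj_class_mem:
  assumes "group G"
  shows "L \<in> conj_class G K \<longleftrightarrow> (\<exists>g\<in>carrier G. L = (\<lambda>k. g \<otimes>\<^bsub>G\<^esub> k \<otimes>\<^bsub>G\<^esub> inv\<^bsub>G\<^esub> g) ` K)"
  unfolding conj_class_def l_coset_def r_coset_def by (auto simp: image_def)

text \<open>Conjugacy classes are orbits of a group action, so they are equal as soon as one contains a
  representative of the other.\<close>

lemma conj_class_eq_iff:
  fixes G (structure)
  assumes G: "group G" and K: "K \<subseteq> carrier G" and L: "L \<subseteq> carrier G"
  shows "conj_class G K = conj_class G L \<longleftrightarrow>
    (\<exists>g\<in>carrier G. L = (\<lambda>k. g \<otimes>\<^bsub>G\<^esub> k \<otimes>\<^bsub>G\<^esub> inv\<^bsub>G\<^esub> g) ` K)"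
proof -
  interpret group G by (rule G)
  define c where "c g A = (\<lambda>k. g \<otimes> k \<otimes> inv g) ` A" for g A
  have cc: "c g (c h A) = c (g \<otimes> h) A"
    if "g \<in> carrier G" "h \<in> carrier G" "A \<subseteq> carrier G" for g h A
    using that unfolding c_def image_image
    by (intro image_cong) (auto simp: inv_mult_group m_assoc subset_iff)
  have c1: "c \<one> A = A" if "A \<subseteq> carrier G" for A
  proof -
    have "(\<lambda>k. \<one> \<otimes> k \<otimes> inv \<one>) ` A = (\<lambda>k. k) ` A"
      using that by (intro image_cong) auto
    then show ?thesis by (simp add: c_def)
  qed
  have mem: "B \<in> conj_class G A \<longleftrightarrow> (\<exists>g\<in>carrier G. B = c g A)" for A B
    using conj_class_mem[OF G] by (simp add: c_def)
  show ?thesis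
  proof
    assume "conj_class G K = conj_class G L"
    moreover have "L \<in> conj_class G L" using mem c1[OF L] by (metis one_closed)
    ultimately have "L \<in> conj_class G K" by simp
    then show "\<exists>g\<in>carrier G. L = (\<lambda>k. g \<otimes> k \<otimes> inv g) ` K" by (simp add: conj_class_mem[OF G])
  next
    assume "\<exists>g\<in>carrier G. L = (\<lambda>k. g \<otimes> k \<otimes> inv g) ` K"
    then obtain g where g: "g \<in> carrier G" "L = c g K" by (auto simp: c_def)
    have gi: "K = c (inv g) L" using g cc[of "inv g" g K] c1 K by simp
    show "conj_class G K = conj_class G L"
    proof (intro Set.set_eqI iffI)
      fix B assume "B \<in> conj_class G K"
      then have "\<exists>g\<in>carrier G. B = c g K" by (simp only: mem)
      then obtain h where h: "h \<in> carrier G" "B = c h K" by (elim bexE)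
      then have "B = c (h \<otimes> inv g) L" using cc[of h "inv g" L] h g(1) L gi by simp
      then show "B \<in> conj_class G L" using mem g h by (metis inv_closed m_closed)
    next
      fix B assume "B \<in> conj_class G L"
      then have "\<exists>g\<in>carrier G. B = c g L" by (simp only: mem)
      then obtain h where h: "h \<in> carrier G" "B = c h L" by (elim bexE)
      then have "B = c (h \<otimes> g) K" using cc[of h g K] g K by simp
      then show "B \<in> conj_class G K" using mem g h by (metis m_closed)
    qed
  qed
qed

lemma rcoset_eq_iff:
  fixes G (structure)
  assumes "group G" "subgroup H G" "x \<in> carrier G" "y \<in> carrier G"
  shows "H #>\<^bsub>G\<^esub> x = H #>\<^bsub>G\<^esub> y \<longleftrightarrow> (\<exists>h\<in>H. y = h \<otimes>\<^bsub>G\<^esub> x)"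
proof -
  interpret group G by fact
  have "H #> x = H #> y \<longleftrightarrow> y \<in> H #> x"
    using assms repr_independence repr_independenceD by metis
  then show ?thesis by (auto simp: r_coset_def)
qed

section \<open>Orbit spaces of groups of motions\<close>

abbreviation motion_grp :: "(real^3 \<Rightarrow> real^3) set \<Rightarrow> (real^3 \<Rightarrow> real^3) monoid" where
  "motion_grp \<Gamma> \<equiv> (BijGroup UNIV)\<lparr>carrier := \<Gamma>\<rparr>"

text \<open>Set-theoretic inverse; plain \<open>inv\<close> is the inverse in a group.\<close>

abbreviation finv :: "('a \<Rightarrow> 'a) \<Rightarrow> 'a \<Rightarrow> 'a" where "finv \<equiv> inv_into UNIV"

lemma carrier_BijGroup_UNIV [simp]: "carrier (BijGroup UNIV) = {f. bij f}"
  by (auto simp: BijGroup_def Bij_def)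

lemma mult_BijGroup_UNIV [simp]: "bij f \<Longrightarrow> bij g \<Longrightarrow> f \<otimes>\<^bsub>BijGroup UNIV\<^esub> g = f \<circ> g"
  by (auto simp: BijGroup_def Bij_def compose_def)

lemma one_BijGroup_UNIV [simp]: "\<one>\<^bsub>BijGroup UNIV\<^esub> = id"
  by (auto simp: BijGroup_def)

lemma inv_BijGroup_UNIV [simp]:
  assumes "bij f" shows "inv\<^bsub>BijGroup UNIV\<^esub> f = finv f"
proof (rule group.inv_equality[OF group_BijGroup])
  show "finv f \<otimes>\<^bsub>BijGroup UNIV\<^esub> f = \<one>\<^bsub>BijGroup UNIV\<^esub>"
    using assms by (simp add: bij_imp_bij_inv bij_is_inj)
qed (use assms bij_imp_bij_inv in auto)

text \<open>A covering of the orbit space of \<open>\<Gamma>\<close> that is uniformized by a subgroup \<open>H\<close>: the map \<open>f\<close> lies over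
  the projection to \<open>\<Gamma>\<close>-orbits and its fibres are the \<open>H\<close>-orbits. As \<open>f\<close> is also open, it identifies
  \<open>N\<close> with the orbit space of \<open>H\<close>.\<close>

definition orbit_cover ::
  "(real^3 \<Rightarrow> real^3) set \<Rightarrow> (real^3 \<Rightarrow> real^3) set \<Rightarrow> 'a topology \<Rightarrow> ('a \<Rightarrow> (real^3) set) \<Rightarrow> (real^3 \<Rightarrow> 'a) \<Rightarrow> bool" where
  "orbit_cover \<Gamma> H N p f \<longleftrightarrow> subgroup H (motion_grp \<Gamma>) \<and>
     continuous_map euclidean N f \<and> open_map euclidean N f \<and> range f = topspace N \<and>
     (\<forall>v w. f v = f w \<longleftrightarrow> (\<exists>h\<in>H. w = h v)) \<and> (\<forall>v. p (f v) = motion_orbit \<Gamma> v)"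

text \<open>The constant \<open>\<epsilon>\<close> bounds the displacement of the nontrivial motions from below, uniformly in the
  point. Hence a ball of radius \<open>\<epsilon> / 2\<close> is disjoint from its images under the nontrivial motions:
  the action is free and properly discontinuous.\<close>

locale motions =
  fixes \<Gamma> :: "(real^3 \<Rightarrow> real^3) set" and \<epsilon> :: real
  assumes sub: "subgroup \<Gamma> (BijGroup UNIV)"
    and cont: "\<gamma> \<in> \<Gamma> \<Longrightarrow> continuous_on UNIV \<gamma>"
    and eps: "\<epsilon> > 0"
    and free: "\<gamma> \<in> \<Gamma> \<Longrightarrow> dist (\<gamma> v) v < \<epsilon> \<Longrightarrow> \<gamma> = id"
begin

lemma bij: "\<gamma> \<in> \<Gamma> \<Longrightarrow> bij \<gamma>"
  using subgroup.subset[OF sub] by auto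

lemma id_in: "id \<in> \<Gamma>"
  using subgroup.one_closed[OF sub] by simp

lemma comp_in: "\<gamma> \<in> \<Gamma> \<Longrightarrow> \<delta> \<in> \<Gamma> \<Longrightarrow> \<gamma> \<circ> \<delta> \<in> \<Gamma>"
  using subgroup.m_closed[OF sub, of \<gamma> \<delta>] bij by simp

lemma inv_in: "\<gamma> \<in> \<Gamma> \<Longrightarrow> finv \<gamma> \<in> \<Gamma>"
  using subgroup.m_inv_closed[OF sub, of \<gamma>] bij by simp

lemma inv_cancel [simp]: "\<gamma> \<in> \<Gamma> \<Longrightarrow> finv \<gamma> (\<gamma> v) = v" "\<gamma> \<in> \<Gamma> \<Longrightarrow> \<gamma> (finv \<gamma> v) = v"
  using bij by (auto simp: bij_is_inj bij_is_surj surj_f_inv_f)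

lemma eq_if_close:
  assumes "\<gamma> \<in> \<Gamma>" "\<delta> \<in> \<Gamma>" "\<gamma> v = \<delta> w" "dist v w < \<epsilon>"
  shows "\<gamma> = \<delta>"
proof -
  have "(finv \<gamma> \<circ> \<delta>) w = v" using assms inv_cancel(1)[OF assms(1), of v] by simp
  then have "finv \<gamma> \<circ> \<delta> = id" using free[OF comp_in[OF inv_in[OF assms(1)] assms(2)], of w] assms(4) by simp
  then have "finv \<gamma> (\<delta> x) = x" for x by (metis comp_apply id_apply)
  then have "\<gamma> x = \<delta> x" for x using inv_cancel(2)[OF assms(1), of "\<delta> x"] by simp
  then show ?thesis by blast
qed

lemma eq_if_meet: "\<gamma> \<in> \<Gamma> \<Longrightarrow> \<delta> \<in> \<Gamma> \<Longrightarrow> \<gamma> v = \<delta> v \<Longrightarrow> \<gamma> = \<delta>"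
  using eq_if_close[of \<gamma> \<delta> v v] eps by simp

lemma grp: "group (motion_grp \<Gamma>)"
  by (rule subgroup.subgroup_is_group[OF sub group_BijGroup])

lemma subgroup_bij: "subgroup H (motion_grp \<Gamma>) \<Longrightarrow> subgroup H (BijGroup UNIV)"
  by (rule group.incl_subgroup[OF group_BijGroup sub])

lemma inv_grp: "\<gamma> \<in> \<Gamma> \<Longrightarrow> inv\<^bsub>motion_grp \<Gamma>\<^esub> \<gamma> = finv \<gamma>"
  using group.m_inv_consistent[OF group_BijGroup sub, of \<gamma>] bij by simp

lemma motions_subgroup:
  assumes H: "subgroup H (motion_grp \<Gamma>)"
  shows "motions H \<epsilon>"
proof -
  have "H \<subseteq> \<Gamma>" using subgroup.subset[OF H] by simp
  then show ?thesis
    unfolding motions_def using subgroup_bij[OF H] eps cont free by blast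
qed

lemma orbit_eq_iff: "motion_orbit \<Gamma> v = motion_orbit \<Gamma> w \<longleftrightarrow> (\<exists>\<gamma>\<in>\<Gamma>. w = \<gamma> v)"
proof
  assume "motion_orbit \<Gamma> v = motion_orbit \<Gamma> w"
  moreover have "w \<in> motion_orbit \<Gamma> w"
    unfolding motion_orbit_def using id_in by (intro image_eqI[of _ _ id]) auto
  ultimately show "\<exists>\<gamma>\<in>\<Gamma>. w = \<gamma> v" by (auto simp: motion_orbit_def)
next
  assume "\<exists>\<gamma>\<in>\<Gamma>. w = \<gamma> v"
  then obtain \<gamma> where g: "\<gamma> \<in> \<Gamma>" "w = \<gamma> v" by blast
  have "\<delta> v \<in> motion_orbit \<Gamma> w" if "\<delta> \<in> \<Gamma>" for \<delta>
    unfolding motion_orbit_def using g comp_in[OF that inv_in[OF g(1)]]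
    by (intro image_eqI[of _ _ "\<delta> \<circ> finv \<gamma>"]) auto
  moreover have "\<delta> w \<in> motion_orbit \<Gamma> v" if "\<delta> \<in> \<Gamma>" for \<delta>
    unfolding motion_orbit_def using g comp_in[OF that g(1)]
    by (intro image_eqI[of _ _ "\<delta> \<circ> \<gamma>"]) auto
  ultimately show "motion_orbit \<Gamma> v = motion_orbit \<Gamma> w"
    by (auto simp: motion_orbit_def[of \<Gamma> v] motion_orbit_def[of \<Gamma> w])
qed

lemma orbit_motion: "\<gamma> \<in> \<Gamma> \<Longrightarrow> motion_orbit \<Gamma> (\<gamma> v) = motion_orbit \<Gamma> v"
  using orbit_eq_iff[of v "\<gamma> v"] by auto

lemma open_image: "\<gamma> \<in> \<Gamma> \<Longrightarrow> open U \<Longrightarrow> open (\<gamma> ` U)"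
  using open_vimage[of U "finv \<gamma>"] cont[OF inv_in] bij_vimage_eq_inv_image[of "finv \<gamma>" U] bij
  by (simp add: bij_imp_bij_inv inv_inv_eq)

lemma continuous_orbit: "continuous_map euclidean (orbit_space \<Gamma>) (motion_orbit \<Gamma>)"
  by (rule quotient_imp_continuous_map[OF quotient_map_orbit_space])

lemma open_orbit: "open_map euclidean (orbit_space \<Gamma>) (motion_orbit \<Gamma>)"
  unfolding open_map_def
proof (intro allI impI)
  fix U :: "(real^3) set" assume "openin euclidean U"
  then have "open (\<Union>\<gamma>\<in>\<Gamma>. \<gamma> ` U)" using open_image by (intro open_UN) auto
  moreover have "motion_orbit \<Gamma> -` motion_orbit \<Gamma> ` U = (\<Union>\<gamma>\<in>\<Gamma>. \<gamma> ` U)"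
    by (auto simp: orbit_motion) (metis orbit_eq_iff imageI)
  ultimately show "openin (orbit_space \<Gamma>) (motion_orbit \<Gamma> ` U)"
    by (auto simp: openin_orbit_space)
qed

lemma orbit_coverD:
  assumes "orbit_cover \<Gamma> H N p f"
  shows "subgroup H (motion_grp \<Gamma>)" "H \<subseteq> \<Gamma>" "continuous_map euclidean N f" "open_map euclidean N f"
    "range f = topspace N" "f v = f w \<longleftrightarrow> (\<exists>h\<in>H. w = h v)" "p (f v) = motion_orbit \<Gamma> v"
    "quotient_map euclidean N f" "h \<in> H \<Longrightarrow> f (h v) = f v"
    "f v \<in> topspace N"
proof -
  note d = assms[unfolded orbit_cover_def]
  show *: "subgroup H (motion_grp \<Gamma>)" "continuous_map euclidean N f" "open_map euclidean N f"
    "range f = topspace N" and fib: "f v = f w \<longleftrightarrow> (\<exists>h\<in>H. w = h v)" and "p (f v) = motion_orbit \<Gamma> v" for v w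
    using d by blast+
  show "H \<subseteq> \<Gamma>" using subgroup.subset[OF *(1)] by simp
  show "f v \<in> topspace N" using *(4) by (metis rangeI)
  show "quotient_map euclidean N f" using * by (intro continuous_open_imp_quotient_map) auto
  show "h \<in> H \<Longrightarrow> f (h v) = f v" using fib[of v "h v"] by auto
qed

text \<open>The image of a ball of radius \<open>\<epsilon> / 2\<close> is evenly covered: the sheets over it are the images
  under \<open>f\<close> of the translates of the ball, and two translates whose images meet differ by an
  element of \<open>H\<close>.\<close>

lemma orbit_cover_covering_map:
  assumes c: "orbit_cover \<Gamma> H N p f"
  shows "covering_map N p (orbit_space \<Gamma>)"
  unfolding covering_map_def
proof (intro conjI ballI)
  note D = orbit_coverD[OF c]
  let ?q = "motion_orbit \<Gamma>"
  have pf: "p \<circ> f = ?q" using D(7) by auto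
  show pcont: "continuous_map N (orbit_space \<Gamma>) p"
    using continuous_compose_quotient_map[OF D(8)] continuous_orbit pf by metis
  show "p ` topspace N = topspace (orbit_space \<Gamma>)"
    by (simp add: topspace_orbit_space D(5)[symmetric] image_image D(7))
  have popen: "openin (orbit_space \<Gamma>) (p ` W)" if W: "openin N W" for W
  proof -
    have "W = f ` {v. f v \<in> W}" using openin_subset[OF W] unfolding D(5)[symmetric] by auto
    then have "p ` W = p ` f ` {v. f v \<in> W}" by (rule arg_cong)
    then have "p ` W = ?q ` {v. f v \<in> W}" by (simp only: image_image D(7))
    moreover have "open {v. f v \<in> W}" using D(3) W by (auto simp: continuous_map_def)
    ultimately show ?thesis using open_orbit by (simp add: open_map_def)
  qed
  fix y assume "y \<in> topspace (orbit_space \<Gamma>)"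
  then obtain v where v: "y = ?q v" by (auto simp: topspace_orbit_space)
  define B where "B = ball v (\<epsilon> / 2)"
  have close: "dist b b' < \<epsilon>" if "b \<in> B" "b' \<in> B" for b b'
    using that dist_triangle_half_l[of b v \<epsilon> b'] by (simp add: B_def dist_commute)
  let ?V = "\<lambda>\<gamma>. f ` \<gamma> ` B"
  have "y \<in> ?q ` B" using v eps by (auto simp: B_def)
  moreover have U: "openin (orbit_space \<Gamma>) (?q ` B)"
    using open_orbit by (simp add: open_map_def B_def)
  moreover have "\<Union>(?V ` \<Gamma>) = {x \<in> topspace N. p x \<in> ?q ` B}"
  proof (intro Set.set_eqI iffI)
    fix x assume "x \<in> \<Union>(?V ` \<Gamma>)"
    then show "x \<in> {x \<in> topspace N. p x \<in> ?q ` B}"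
      using D(7,10) orbit_motion by auto
  next
    fix x assume x: "x \<in> {x \<in> topspace N. p x \<in> ?q ` B}"
    then have "x \<in> range f" by (simp add: D(5))
    then obtain w where w: "x = f w" by blast
    then obtain b where "b \<in> B" "?q w = ?q b" using x D(7) by auto
    with w have "x = f w" "b \<in> B" "?q b = ?q w" by auto
    then show "x \<in> \<Union>(?V ` \<Gamma>)" using orbit_eq_iff[of b w] by auto
  qed
  moreover have Vopen: "openin N (?V \<gamma>)" if "\<gamma> \<in> \<Gamma>" for \<gamma>
    using D(4) open_image[OF that, of B] by (simp add: open_map_def B_def)
  moreover have "pairwise disjnt (?V ` \<Gamma>)"
  proof (clarsimp simp: pairwise_def)
    fix \<gamma> \<gamma>' assume g: "\<gamma> \<in> \<Gamma>" "\<gamma>' \<in> \<Gamma>" and ne: "?V \<gamma> \<noteq> ?V \<gamma>'"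
    show "disjnt (?V \<gamma>) (?V \<gamma>')"
    proof (rule ccontr)
      assume "\<not> ?thesis"
      then obtain b b' where b: "b \<in> B" "b' \<in> B" "f (\<gamma> b) = f (\<gamma>' b')" by (auto simp: disjnt_def)
      then obtain h where h: "h \<in> H" "\<gamma>' b' = h (\<gamma> b)" using D(6) by blast
      then have "\<gamma>' = h \<circ> \<gamma>"
        using eq_if_close[OF g(2) comp_in[of h \<gamma>], of b' b] D(2) g close b by auto
      then have "f (\<gamma>' x) = f (\<gamma> x)" for x using D(9)[OF h(1)] by simp
      then show False using ne by (simp add: image_image)
    qed
  qed
  moreover have "homeomorphic_map (subtopology N (?V \<gamma>)) (subtopology (orbit_space \<Gamma>) (?q ` B)) p"
    if g: "\<gamma> \<in> \<Gamma>" for \<gamma>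
  proof -
    have tV: "topspace (subtopology N (?V \<gamma>)) = ?V \<gamma>" using openin_subset[OF Vopen[OF g]] by auto
    have tU: "topspace (subtopology (orbit_space \<Gamma>) (?q ` B)) = ?q ` B" using openin_subset[OF U] by auto
    have im: "p ` ?V \<gamma> = ?q ` B"
      using g by (simp add: image_image D(7) orbit_motion)
    show ?thesis
    proof (rule bijective_open_imp_homeomorphic_map)
      show "continuous_map (subtopology N (?V \<gamma>)) (subtopology (orbit_space \<Gamma>) (?q ` B)) p"
        using pcont im tV
        by (simp add: continuous_map_in_subtopology continuous_map_from_subtopology image_subset_iff_funcset[symmetric])
      show "open_map (subtopology N (?V \<gamma>)) (subtopology (orbit_space \<Gamma>) (?q ` B)) p"
        unfolding open_map_def
      proof (intro allI impI)
        fix W assume "openin (subtopology N (?V \<gamma>)) W"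
        then have W: "openin N W" "W \<subseteq> ?V \<gamma>" using openin_open_subtopology[OF Vopen[OF g]] by auto
        then have "p ` W \<subseteq> ?q ` B" using im by blast
        then show "openin (subtopology (orbit_space \<Gamma>) (?q ` B)) (p ` W)"
          using openin_open_subtopology[OF U] popen[OF W(1)] by auto
      qed
      show "p ` topspace (subtopology N (?V \<gamma>)) = topspace (subtopology (orbit_space \<Gamma>) (?q ` B))"
        using tV tU im by simp
      show "inj_on p (topspace (subtopology N (?V \<gamma>)))"
        unfolding tV
      proof (rule inj_onI)
        fix x x' assume "x \<in> ?V \<gamma>" "x' \<in> ?V \<gamma>" and e: "p x = p x'"
        then obtain b b' where b: "b \<in> B" "b' \<in> B" "x = f (\<gamma> b)" "x' = f (\<gamma> b')" by auto
        then have "?q (\<gamma> b) = ?q (\<gamma> b')" using e D(7) by simp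
        then obtain \<delta> where d: "\<delta> \<in> \<Gamma>" "\<gamma> b' = \<delta> (\<gamma> b)" using orbit_eq_iff by blast
        then have "\<gamma> = \<delta> \<circ> \<gamma>"
          using eq_if_close[OF g comp_in[OF d(1) g], of b' b] close b by auto
        then have "\<gamma> b' = \<gamma> b" using d by (metis comp_apply)
        then show "x = x'" using b by simp
      qed
    qed
  qed
  ultimately show "\<exists>U. y \<in> U \<and> openin (orbit_space \<Gamma>) U \<and>
        (\<exists>\<V>. \<Union>\<V> = {x \<in> topspace N. p x \<in> U} \<and>
             (\<forall>V\<in>\<V>. openin N V) \<and> pairwise disjnt \<V> \<and>
             (\<forall>V\<in>\<V>. homeomorphic_map (subtopology N V) (subtopology (orbit_space \<Gamma>) U) p))"
    by (intro exI[of _ "?q ` B"] conjI exI[of _ "?V ` \<Gamma>"]) (assumption | blast)+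
qed

text \<open>The fibre over the orbit of \<open>v\<close> consists of the points \<open>f (\<gamma> v)\<close>, and such a point determines
  exactly the coset \<open>H \<gamma>\<close>.\<close>

lemma orbit_cover_fibre:
  assumes c: "orbit_cover \<Gamma> H N p f" and y: "y \<in> topspace (orbit_space \<Gamma>)"
  obtains b where "bij_betw b (rcosets\<^bsub>motion_grp \<Gamma>\<^esub> H) {x \<in> topspace N. p x = y}"
proof -
  note D = orbit_coverD[OF c]
  obtain v where v: "y = motion_orbit \<Gamma> v" using y by (auto simp: topspace_orbit_space)
  have eq: "H #>\<^bsub>motion_grp \<Gamma>\<^esub> \<gamma> = H #>\<^bsub>motion_grp \<Gamma>\<^esub> \<delta> \<longleftrightarrow> f (\<gamma> v) = f (\<delta> v)"
    if g: "\<gamma> \<in> \<Gamma>" "\<delta> \<in> \<Gamma>" for \<gamma> \<delta>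
  proof -
    have "H #>\<^bsub>motion_grp \<Gamma>\<^esub> \<gamma> = H #>\<^bsub>motion_grp \<Gamma>\<^esub> \<delta> \<longleftrightarrow> (\<exists>h\<in>H. \<delta> = h \<otimes>\<^bsub>motion_grp \<Gamma>\<^esub> \<gamma>)"
      using rcoset_eq_iff[OF grp D(1)] g by simp
    also have "\<dots> \<longleftrightarrow> (\<exists>h\<in>H. \<delta> = h \<circ> \<gamma>)"
      using D(2) g bij by (intro bex_cong) (auto simp: subset_iff)
    also have "\<dots> \<longleftrightarrow> (\<exists>h\<in>H. \<delta> v = h (\<gamma> v))"
      using eq_if_meet[OF g(2) comp_in[OF _ g(1)]] D(2) by (intro bex_cong) auto
    finally show ?thesis using D(6) by simp
  qed
  obtain b where "bij_betw b ((\<lambda>\<gamma>. H #>\<^bsub>motion_grp \<Gamma>\<^esub> \<gamma>) ` \<Gamma>) ((\<lambda>\<gamma>. f (\<gamma> v)) ` \<Gamma>)"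
    by (rule bij_betw_images[of \<Gamma> "\<lambda>\<gamma>. H #>\<^bsub>motion_grp \<Gamma>\<^esub> \<gamma>" "\<lambda>\<gamma>. f (\<gamma> v)", OF eq])
  moreover have "(\<lambda>\<gamma>. H #>\<^bsub>motion_grp \<Gamma>\<^esub> \<gamma>) ` \<Gamma> = rcosets\<^bsub>motion_grp \<Gamma>\<^esub> H"
    by (auto simp: RCOSETS_def)
  moreover have "(\<lambda>\<gamma>. f (\<gamma> v)) ` \<Gamma> = {x \<in> topspace N. p x = y}"
  proof (intro Set.set_eqI iffI)
    fix x assume "x \<in> {x \<in> topspace N. p x = y}"
    then have x: "x \<in> range f" "p x = y" by (simp_all add: D(5))
    then obtain w where "x = f w" by blast
    with x v have "x = f w" "motion_orbit \<Gamma> v = motion_orbit \<Gamma> w" by (simp_all add: D(7))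
    then show "x \<in> (\<lambda>\<gamma>. f (\<gamma> v)) ` \<Gamma>" using orbit_eq_iff by auto
  qed (use D(7,10) v orbit_motion in auto)
  ultimately show ?thesis using that by simp
qed

lemma orbit_cover_nfold:
  assumes c: "orbit_cover \<Gamma> H N p f"
  shows "nfold_covering n N p (orbit_space \<Gamma>) \<longleftrightarrow>
    finite (rcosets\<^bsub>motion_grp \<Gamma>\<^esub> H) \<and> card (rcosets\<^bsub>motion_grp \<Gamma>\<^esub> H) = n"
proof -
  note D = orbit_coverD[OF c]
  have "connectedin N (f ` UNIV)"
    using D(3) by (rule connectedin_continuous_map_image) (simp add: connected_UNIV)
  then have con: "connected_space N" using D(5) by (simp add: connectedin_topspace)
  have ex: "motion_orbit \<Gamma> 0 \<in> topspace (orbit_space \<Gamma>)" by (simp add: topspace_orbit_space)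
  have "(finite {x \<in> topspace N. p x = y} \<and> card {x \<in> topspace N. p x = y} = n) \<longleftrightarrow>
    (finite (rcosets\<^bsub>motion_grp \<Gamma>\<^esub> H) \<and> card (rcosets\<^bsub>motion_grp \<Gamma>\<^esub> H) = n)"
    if y: "y \<in> topspace (orbit_space \<Gamma>)" for y
  proof -
    obtain b where "bij_betw b (rcosets\<^bsub>motion_grp \<Gamma>\<^esub> H) {x \<in> topspace N. p x = y}"
      by (rule orbit_cover_fibre[OF c y])
    then show ?thesis using bij_betw_finite[of b] bij_betw_same_card[of b] by simp
  qed
  then show ?thesis
    unfolding nfold_covering_def using con orbit_cover_covering_map[OF c] ex by blast
qed

lemma orbit_cover_trivial: "orbit_cover \<Gamma> {id} euclidean (motion_orbit \<Gamma>) id"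
proof -
  have "subgroup {\<one>\<^bsub>motion_grp \<Gamma>\<^esub>} (motion_grp \<Gamma>)" by (rule group.triv_subgroup[OF grp])
  then have "subgroup {id} (motion_grp \<Gamma>)" by simp
  then show ?thesis unfolding orbit_cover_def by (auto simp: open_map_def)
qed

text \<open>Takes an orbit of a subgroup to the orbit of \<open>\<Gamma>\<close> that contains it; the union avoids the choice
  of a point.\<close>

definition coarsen :: "(real^3) set \<Rightarrow> (real^3) set" where
  "coarsen c = (\<Union>v\<in>c. motion_orbit \<Gamma> v)"

lemma orbit_cover_subgroup:
  assumes H: "subgroup H (motion_grp \<Gamma>)"
  shows "orbit_cover \<Gamma> H (orbit_space H) coarsen (motion_orbit H)"
proof -
  interpret H: motions H \<epsilon> using motions_subgroup[OF H] .
  have sub: "H \<subseteq> \<Gamma>" using subgroup.subset[OF H] by simp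
  have "coarsen (motion_orbit H v) = motion_orbit \<Gamma> v" for v
  proof -
    have "coarsen (motion_orbit H v) = (\<Union>h\<in>H. motion_orbit \<Gamma> (h v))"
      by (simp add: coarsen_def motion_orbit_def[of H])
    also have "\<dots> = (\<Union>h\<in>H. motion_orbit \<Gamma> v)" using sub orbit_motion by (intro SUP_cong) auto
    finally show ?thesis using H.id_in by auto
  qed
  then show ?thesis
    unfolding orbit_cover_def using H H.continuous_orbit H.open_orbit H.orbit_eq_iff
    by (auto simp: topspace_orbit_space)
qed

lemma orbit_cover_homeomorphic:
  assumes c: "orbit_cover \<Gamma> H N p f"
  shows "N homeomorphic_space orbit_space H"
proof -
  note D = orbit_coverD[OF c]
  note E = orbit_coverD[OF orbit_cover_subgroup[OF D(1)]]
  have "f v = f w \<longleftrightarrow> motion_orbit H v = motion_orbit H w" for v w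
    using D(6)[of v w] E(6)[of v w] by argo
  then obtain h where "homeomorphic_map N (orbit_space H) h"
    using quotient_maps_same_fibres[OF D(8) E(8)] by blast
  then show ?thesis by (rule homeomorphic_map_imp_homeomorphic_space)
qed

end

section \<open>Coverings of an orbit space and conjugacy of subgroups\<close>

context motions
begin

lemma lift_unique:
  assumes "covering_map N p (orbit_space \<Gamma>)" "continuous_map euclidean N f" "continuous_map euclidean N g"
    and "\<And>v. p (f v) = p (g v)" and "f (a :: real^3) = g a"
  shows "f = g"
proof
  fix v
  have "connected_space (euclidean :: (real^3) topology)"
    by (simp add: connectedin_topspace[symmetric] connected_UNIV)
  then show "f v = g v"
    using covering_lift_unique[OF assms(1) _ assms(2,3), where a = a and x = v] assms(4,5) by simp
qed

lemma lift_motion: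
  assumes "continuous_map euclidean N f" "\<And>v. p (f v) = motion_orbit \<Gamma> v" "\<gamma> \<in> \<Gamma>"
  shows "continuous_map euclidean N (f \<circ> \<gamma>)" "p ((f \<circ> \<gamma>) v) = motion_orbit \<Gamma> v"
proof -
  have "continuous_map euclidean euclidean \<gamma>" using cont[OF assms(3)] by simp
  then show "continuous_map euclidean N (f \<circ> \<gamma>)" using assms(1) by (rule continuous_map_compose)
  show "p ((f \<circ> \<gamma>) v) = motion_orbit \<Gamma> v" using assms orbit_motion by simp
qed

text \<open>Locally a lift is the projection to orbits, which is open, followed by the inverse of the
  projection of a sheet.\<close>

lemma lift_open:
  assumes cov: "covering_map N p (orbit_space \<Gamma>)"
    and f: "continuous_map euclidean N f" "\<And>v. p (f v) = motion_orbit \<Gamma> v"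
  shows "open_map euclidean N f"
  unfolding open_map_def
proof (intro allI impI)
  fix W :: "(real^3) set" assume "openin euclidean W"
  then have W: "open W" by simp
  show "openin N (f ` W)"
  proof (subst openin_subopen, intro ballI)
    fix x assume "x \<in> f ` W"
    then obtain v where v: "v \<in> W" "x = f v" by blast
    have xN: "x \<in> topspace N" using f(1) v(2) by (auto simp: continuous_map_def)
    obtain V where V: "openin N V" "x \<in> V" "inj_on p V"
      using covering_map_separated[OF cov xN] by blast
    have "open {w. f w \<in> V}" using f(1) V(1) by (auto simp: continuous_map_def)
    then have "open (W \<inter> {w. f w \<in> V})" using W by blast
    then have O: "openin (orbit_space \<Gamma>) (motion_orbit \<Gamma> ` (W \<inter> {w. f w \<in> V}))"
      using open_orbit by (simp add: open_map_def)
    have "continuous_map N (orbit_space \<Gamma>) p" using cov by (simp add: covering_map_def)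
    then have "openin N (V \<inter> {y \<in> topspace N. p y \<in> motion_orbit \<Gamma> ` (W \<inter> {w. f w \<in> V})})"
      using O V(1) by (intro openin_Int) (auto simp: continuous_map_def)
    moreover have "y \<in> f ` W"
      if y: "y \<in> V" "p y \<in> motion_orbit \<Gamma> ` (W \<inter> {w. f w \<in> V})" for y
    proof -
      obtain w where w: "w \<in> W" "f w \<in> V" "p y = motion_orbit \<Gamma> w" using y(2) by blast
      then have "y = f w" using inj_onD[OF V(3) _ y(1) w(2)] f(2) by simp
      then show ?thesis using w(1) by blast
    qed
    ultimately show "\<exists>T. openin N T \<and> x \<in> T \<and> T \<subseteq> f ` W"
      using V(2) v xN f(2)
      by (intro exI[of _ "V \<inter> {y \<in> topspace N. p y \<in> motion_orbit \<Gamma> ` (W \<inter> {w. f w \<in> V})}"]) auto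
  qed
qed

text \<open>Lift the projection to orbits to a map \<open>f\<close> into \<open>N\<close>, and let \<open>H\<close> consist of the motions that
  preserve \<open>f\<close>. If \<open>f v = f w\<close>, a motion takes \<open>v\<close> to \<open>w\<close>, and it preserves \<open>f\<close> by uniqueness of
  lifts. Lifts have open images, and every point of \<open>N\<close> outside the image of \<open>f\<close> lies in the image
  of a lift that avoids the image of \<open>f\<close>; so \<open>f\<close> is onto by connectedness.\<close>

lemma covering_uniformized:
  assumes cov: "covering_map N p (orbit_space \<Gamma>)" and con: "connected_space N"
  obtains H f where "orbit_cover \<Gamma> H N p f"
proof -
  let ?q = "motion_orbit \<Gamma>"
  have pN: "p ` topspace N = range ?q" using cov by (simp add: covering_map_def topspace_orbit_space)
  have lift: "\<exists>f. continuous_map euclidean N f \<and> (\<forall>v. p (f v) = ?q v) \<and> f v = x"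
    if "x \<in> topspace N" "p x = ?q v" for x v
    using covering_lift_exists[OF cov continuous_orbit that] by metis
  obtain x0 where x0: "x0 \<in> topspace N" "p x0 = ?q 0" using pN by (metis imageE rangeI)
  then obtain f where f: "continuous_map euclidean N f" "\<And>v. p (f v) = ?q v" using lift by blast
  have fN: "f v \<in> topspace N" for v using f(1) by (auto simp: continuous_map_def)
  define H where "H = {\<gamma> \<in> \<Gamma>. f \<circ> \<gamma> = f}"
  have fib: "f v = f w \<longleftrightarrow> (\<exists>h\<in>H. w = h v)" for v w
  proof
    assume e: "f v = f w"
    then have "?q v = ?q w" using f(2) by metis
    then obtain \<gamma> where g: "\<gamma> \<in> \<Gamma>" "w = \<gamma> v" using orbit_eq_iff by blast
    have "f \<circ> \<gamma> = f"
      by (rule lift_unique[OF cov lift_motion(1)[where p = p] f(1), where a = v])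
        (use f g e orbit_motion in auto)
    then show "\<exists>h\<in>H. w = h v" using g H_def by blast
  next
    assume "\<exists>h\<in>H. w = h v"
    then show "f v = f w" unfolding H_def by (metis (mono_tags, lifting) comp_apply mem_Collect_eq)
  qed
  have "subgroup H (motion_grp \<Gamma>)"
  proof (rule group.subgroupI[OF grp])
    show "H \<subseteq> carrier (motion_grp \<Gamma>)" by (auto simp: H_def)
    show "H \<noteq> {}" using id_in by (auto simp: H_def)
    show "inv\<^bsub>motion_grp \<Gamma>\<^esub> \<gamma> \<in> H" if "\<gamma> \<in> H" for \<gamma>
    proof -
      have g: "\<gamma> \<in> \<Gamma>" "f \<circ> \<gamma> = f" using that by (auto simp: H_def)
      have "f (finv \<gamma> v) = f v" for v using inv_cancel(2)[OF g(1), of v] g(2) by (metis comp_apply)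
      then show ?thesis using inv_in[OF g(1)] inv_grp[OF g(1)] by (auto simp: H_def)
    qed
    show "\<gamma> \<otimes>\<^bsub>motion_grp \<Gamma>\<^esub> \<delta> \<in> H" if "\<gamma> \<in> H" "\<delta> \<in> H" for \<gamma> \<delta>
    proof -
      have g: "\<gamma> \<in> \<Gamma>" "f \<circ> \<gamma> = f" "\<delta> \<in> \<Gamma>" "f \<circ> \<delta> = f" using that by (auto simp: H_def)
      then have "f \<circ> (\<gamma> \<circ> \<delta>) = f" by (simp add: comp_assoc[symmetric])
      then show ?thesis using comp_in[OF g(1,3)] bij g by (simp add: H_def)
    qed
  qed
  moreover have "range f = topspace N"
  proof -
    have "openin N (range g)" if "continuous_map euclidean N g" "\<forall>v. p (g v) = ?q v" for g
      using lift_open[OF cov that(1)] that(2) by (simp add: open_map_def)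
    note op = this
    have "openin N (topspace N - range f)"
    proof (subst openin_subopen, intro ballI)
      fix x assume x: "x \<in> topspace N - range f"
      then have "p x \<in> range ?q" using pN by blast
      then obtain v where "p x = ?q v" by blast
      then obtain g where g: "continuous_map euclidean N g" "\<forall>v. p (g v) = ?q v" "g v = x"
        using lift x by blast
      have disj: "g u \<noteq> f w" for u w
      proof
        assume that: "g u = f w"
        have "?q u = ?q w" using f(2) g(2) that by metis
        then obtain \<gamma> where d: "\<gamma> \<in> \<Gamma>" "w = \<gamma> u" using orbit_eq_iff by blast
        have "f \<circ> \<gamma> = g"
          by (rule lift_unique[OF cov lift_motion(1)[where p = p] g(1), where a = u])
            (use f g d that orbit_motion in auto)
        then have "x = f (\<gamma> v)" using g(3) by (metis comp_apply)
        then show False using x by blast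
      qed
      have "range g \<subseteq> topspace N" using g(1) by (auto simp: continuous_map_def)
      then have "range g \<subseteq> topspace N - range f" using disj by auto
      then show "\<exists>T. openin N T \<and> x \<in> T \<and> T \<subseteq> topspace N - range f"
        using op[OF g(1,2)] g(3) by blast
    qed
    moreover have "openin N (range f)" using op f by blast
    moreover have "range f \<union> (topspace N - range f) = topspace N" using fN by blast
    ultimately have "topspace N - range f = {}"
      using con unfolding connected_space_eq by (metis Diff_disjoint UNIV_I empty_iff image_eqI)
    then show ?thesis using fN by blast
  qed
  ultimately have "orbit_cover \<Gamma> H N p f"
    unfolding orbit_cover_def using f fib lift_open[OF cov f] by blast
  then show ?thesis by (rule that)
qed

lemma conj_class_motion_eq_iff:
  assumes "H1 \<subseteq> \<Gamma>" "H2 \<subseteq> \<Gamma>"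
  shows "conj_class (motion_grp \<Gamma>) H1 = conj_class (motion_grp \<Gamma>) H2 \<longleftrightarrow>
    (\<exists>\<gamma>\<in>\<Gamma>. H2 = (\<lambda>h. \<gamma> \<circ> h \<circ> finv \<gamma>) ` H1)"
proof -
  have "(\<lambda>h. \<gamma> \<otimes>\<^bsub>motion_grp \<Gamma>\<^esub> h \<otimes>\<^bsub>motion_grp \<Gamma>\<^esub> inv\<^bsub>motion_grp \<Gamma>\<^esub> \<gamma>) ` H1 = (\<lambda>h. \<gamma> \<circ> h \<circ> finv \<gamma>) ` H1"
    if g: "\<gamma> \<in> \<Gamma>" for \<gamma>
  proof (rule image_cong[OF HOL.refl])
    fix h assume "h \<in> H1"
    then have "bij h" using assms bij by blast
    then show "\<gamma> \<otimes>\<^bsub>motion_grp \<Gamma>\<^esub> h \<otimes>\<^bsub>motion_grp \<Gamma>\<^esub> inv\<^bsub>motion_grp \<Gamma>\<^esub> \<gamma> = \<gamma> \<circ> h \<circ> finv \<gamma>"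
      unfolding inv_grp[OF g] using bij[OF g] bij_imp_bij_inv[OF bij[OF g]] by (simp add: bij_comp)
  qed
  then show ?thesis using conj_class_eq_iff[OF grp, of H1 H2] assms by simp
qed

text \<open>An equivalence \<open>h\<close> turns the lift \<open>f1\<close> into a lift through \<open>p2\<close>, which is \<open>f2 \<circ> \<gamma>\<close> for a
  motion \<open>\<gamma>\<close> by uniqueness; comparing fibres shows that \<open>\<gamma>\<close> conjugates \<open>H1\<close> to \<open>H2\<close>. Conversely, if
  \<open>\<gamma>\<close> does this, then \<open>f1\<close> and \<open>f2 \<circ> \<gamma>\<close> are quotient maps with the same fibres.\<close>

lemma covering_equiv_iff_conj:
  assumes c1: "orbit_cover \<Gamma> H1 N1 p1 f1" and c2: "orbit_cover \<Gamma> H2 N2 p2 f2"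
  shows "covering_equiv N1 p1 N2 p2 \<longleftrightarrow> conj_class (motion_grp \<Gamma>) H1 = conj_class (motion_grp \<Gamma>) H2"
proof -
  note D = orbit_coverD[OF c1] and E = orbit_coverD[OF c2]
  have "covering_equiv N1 p1 N2 p2 \<longleftrightarrow> (\<exists>\<gamma>\<in>\<Gamma>. H2 = (\<lambda>h. \<gamma> \<circ> h \<circ> finv \<gamma>) ` H1)"
  proof
    assume "covering_equiv N1 p1 N2 p2"
    then obtain h where h: "homeomorphic_map N1 N2 h" "\<forall>x\<in>topspace N1. p1 x = p2 (h x)"
      by (auto simp: covering_equiv_def)
    have inj: "h x = h y \<longleftrightarrow> x = y" if "x \<in> topspace N1" "y \<in> topspace N1" for x y
      using homeomorphic_imp_injective_map[OF h(1)] that by (auto simp: inj_on_def)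
    have p2h: "p2 (h (f1 v)) = motion_orbit \<Gamma> v" for v using h(2) D(7,10) by metis
    have chf: "continuous_map euclidean N2 (h \<circ> f1)"
      using D(3) homeomorphic_imp_continuous_map[OF h(1)] by (rule continuous_map_compose)
    have "h (f1 0) \<in> topspace N2" using homeomorphic_imp_surjective_map[OF h(1)] D(10) by blast
    then have "h (f1 0) \<in> range f2" by (simp add: E(5))
    then obtain w where w: "h (f1 0) = f2 w" by blast
    then have "motion_orbit \<Gamma> 0 = motion_orbit \<Gamma> w" using p2h[of 0] E(7) by simp
    then obtain \<gamma> where g: "\<gamma> \<in> \<Gamma>" "w = \<gamma> 0" using orbit_eq_iff by blast
    have e: "h \<circ> f1 = f2 \<circ> \<gamma>"
      by (rule lift_unique[OF orbit_cover_covering_map[OF c2] chf lift_motion(1)[where p = p2], where a = 0])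
        (use E(3,7) g w p2h orbit_motion in auto)
    have iff: "\<delta> \<in> H1 \<longleftrightarrow> \<gamma> \<circ> \<delta> \<circ> finv \<gamma> \<in> H2" if d: "\<delta> \<in> \<Gamma>" for \<delta>
    proof -
      have "\<delta> \<in> H1 \<longleftrightarrow> f1 0 = f1 (\<delta> 0)"
        using D(6)[of 0 "\<delta> 0"] D(2) eq_if_meet[OF d, of _ 0] by auto
      also have "\<dots> \<longleftrightarrow> h (f1 0) = h (f1 (\<delta> 0))" using inj D(10) by simp
      also have "\<dots> \<longleftrightarrow> f2 (\<gamma> 0) = f2 (\<gamma> (\<delta> 0))" using e by (metis comp_apply)
      also have "\<dots> \<longleftrightarrow> (\<exists>k\<in>H2. \<gamma> (\<delta> 0) = k (\<gamma> 0))" by (rule E(6))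
      also have "\<dots> \<longleftrightarrow> \<gamma> \<circ> \<delta> \<circ> finv \<gamma> \<in> H2"
      proof
        assume "\<exists>k\<in>H2. \<gamma> (\<delta> 0) = k (\<gamma> 0)"
        then obtain k where k: "k \<in> H2" "\<gamma> (\<delta> 0) = k (\<gamma> 0)" by blast
        have "\<gamma> \<circ> \<delta> \<circ> finv \<gamma> = k"
          by (rule eq_if_meet[of _ _ "\<gamma> 0"]) (use k E(2) g d comp_in inv_in in auto)
        then show "\<gamma> \<circ> \<delta> \<circ> finv \<gamma> \<in> H2" using k by simp
      next
        assume k: "\<gamma> \<circ> \<delta> \<circ> finv \<gamma> \<in> H2"
        show "\<exists>k\<in>H2. \<gamma> (\<delta> 0) = k (\<gamma> 0)" using g(1) by (intro bexI[OF _ k]) simp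
      qed
      finally show ?thesis .
    qed
    have "H2 = (\<lambda>h. \<gamma> \<circ> h \<circ> finv \<gamma>) ` H1"
    proof (intro equalityI subsetI)
      fix k assume k: "k \<in> H2"
      have kk: "\<gamma> \<circ> (finv \<gamma> \<circ> k \<circ> \<gamma>) \<circ> finv \<gamma> = k" using g by auto
      have "finv \<gamma> \<circ> k \<circ> \<gamma> \<in> \<Gamma>" by (intro comp_in inv_in g(1) subsetD[OF E(2) k])
      then have "finv \<gamma> \<circ> k \<circ> \<gamma> \<in> H1" using iff kk k by simp
      then show "k \<in> (\<lambda>h. \<gamma> \<circ> h \<circ> finv \<gamma>) ` H1" using kk by (metis image_eqI)
    qed (use iff D(2) in auto)
    then show "\<exists>\<gamma>\<in>\<Gamma>. H2 = (\<lambda>h. \<gamma> \<circ> h \<circ> finv \<gamma>) ` H1" using g(1) by blast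
  next
    assume "\<exists>\<gamma>\<in>\<Gamma>. H2 = (\<lambda>h. \<gamma> \<circ> h \<circ> finv \<gamma>) ` H1"
    then obtain \<gamma> where g: "\<gamma> \<in> \<Gamma>" "H2 = (\<lambda>h. \<gamma> \<circ> h \<circ> finv \<gamma>) ` H1" by blast
    have gg: "\<gamma> x = \<gamma> y \<longleftrightarrow> x = y" for x y using inv_cancel(1)[OF g(1)] by metis
    have "f1 v = f1 w \<longleftrightarrow> (f2 \<circ> \<gamma>) v = (f2 \<circ> \<gamma>) w" for v w
      using D(6)[of v w] E(6)[of "\<gamma> v" "\<gamma> w"] g(1) by (simp add: g(2) gg)
    moreover have "quotient_map euclidean N2 (f2 \<circ> \<gamma>)"
    proof (rule continuous_open_imp_quotient_map)
      show "continuous_map euclidean N2 (f2 \<circ> \<gamma>)" using lift_motion(1) E(3,7) g(1) by blast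
      show "open_map euclidean N2 (f2 \<circ> \<gamma>)"
        using E(4) open_image[OF g(1)] unfolding open_map_def image_comp[symmetric] by simp
      have "range (f2 \<circ> \<gamma>) = range f2"
        unfolding image_comp[symmetric] using bij[OF g(1)] by (simp add: bij_is_surj)
      then show "(f2 \<circ> \<gamma>) ` topspace euclidean = topspace N2" using E(5) by simp
    qed
    ultimately obtain h where h: "homeomorphic_map N1 N2 h" "\<And>v. h (f1 v) = (f2 \<circ> \<gamma>) v"
      using quotient_maps_same_fibres[OF D(8), of N2 "f2 \<circ> \<gamma>"] by auto
    have "p1 x = p2 (h x)" if "x \<in> topspace N1" for x
    proof -
      have "x \<in> range f1" using that by (simp add: D(5))
      then obtain v where "x = f1 v" by (rule rangeE)
      then show ?thesis using h(2) D(7) E(7) orbit_motion[OF g(1)] by simp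
    qed
    then show "covering_equiv N1 p1 N2 p2" using h(1) by (auto simp: covering_equiv_def)
  qed
  then show ?thesis using conj_class_motion_eq_iff D(2) E(2) by simp
qed

text \<open>Coverings are classified by the subgroups that uniformize them, up to conjugacy. The coverings
  counted by \<^const>\<open>covering_classes\<close> live on one carrier type; the orbit space of a subgroup is moved
  there by \<open>nfold_covering_representative\<close>.\<close>

theorem covering_classes_bij:
  fixes F :: "'f topology" and n :: nat
  defines "\<S> \<equiv> {H. subgroup H (motion_grp \<Gamma>) \<and> finite (rcosets\<^bsub>motion_grp \<Gamma>\<^esub> H) \<and>
    card (rcosets\<^bsub>motion_grp \<Gamma>\<^esub> H) = n \<and> orbit_space H homeomorphic_space F}"
  obtains b where "bij_betw b (covering_classes F (orbit_space \<Gamma>) n) (conj_class (motion_grp \<Gamma>) ` \<S>)"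
proof -
  let ?A = "coverings F (orbit_space \<Gamma>) n"
  have "\<exists>H f. orbit_cover \<Gamma> H N p f" if "(N, p) \<in> ?A" for N p
  proof -
    have "covering_map N p (orbit_space \<Gamma>)" "connected_space N"
      using that by (auto simp: coverings_def nfold_covering_def)
    then show ?thesis by (rule covering_uniformized) blast
  qed
  then have "\<forall>N p. \<exists>H. (N, p) \<in> ?A \<longrightarrow> (\<exists>f. orbit_cover \<Gamma> H N p f)" by blast
  then obtain H where "\<forall>N p. (N, p) \<in> ?A \<longrightarrow> (\<exists>f. orbit_cover \<Gamma> (H N p) N p f)" by metis
  then have "\<forall>N p. \<exists>f. (N, p) \<in> ?A \<longrightarrow> orbit_cover \<Gamma> (H N p) N p f" by blast
  then obtain f where Hf: "\<And>N p. (N, p) \<in> ?A \<Longrightarrow> orbit_cover \<Gamma> (H N p) N p (f N p)" by metis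
  let ?c = "\<lambda>(N, p). covering_rel `` {(N, p)}" and ?g = "\<lambda>(N, p). conj_class (motion_grp \<Gamma>) (H N p)"
  have "?c a = ?c b \<longleftrightarrow> ?g a = ?g b" if ab: "a \<in> ?A" "b \<in> ?A" for a b
  proof -
    obtain N p N' p' where e: "a = (N, p)" "b = (N', p')" by force
    have "?c a = ?c b \<longleftrightarrow> covering_equiv N p N' p'"
      using eq_equiv_class_iff[OF equiv_covering_rel, of a b] by (simp add: e covering_rel_def)
    also have "\<dots> \<longleftrightarrow> ?g a = ?g b"
      using covering_equiv_iff_conj[OF Hf Hf] ab e by simp
    finally show ?thesis .
  qed
  then obtain b where "bij_betw b (?c ` ?A) (?g ` ?A)" by (rule bij_betw_images)
  moreover have "?c ` ?A = covering_classes F (orbit_space \<Gamma>) n"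
    by (auto simp: covering_classes_def quotient_def)
  moreover have "?g ` ?A = conj_class (motion_grp \<Gamma>) ` \<S>"
  proof (intro equalityI subsetI)
    fix C assume "C \<in> ?g ` ?A"
    then obtain N p where Np: "(N, p) \<in> ?A" "C = conj_class (motion_grp \<Gamma>) (H N p)" by auto
    note c = Hf[OF Np(1)]
    have "orbit_space (H N p) homeomorphic_space F"
      using orbit_cover_homeomorphic[OF c] Np(1) homeomorphic_space_trans homeomorphic_space_sym
      unfolding coverings_def by blast
    then have "H N p \<in> \<S>"
      using orbit_coverD(1)[OF c] orbit_cover_nfold[OF c] Np(1) by (simp add: \<S>_def coverings_def)
    then show "C \<in> conj_class (motion_grp \<Gamma>) ` \<S>" using Np(2) by blast
  next
    fix C assume "C \<in> conj_class (motion_grp \<Gamma>) ` \<S>"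
    then obtain K where K: "K \<in> \<S>" "C = conj_class (motion_grp \<Gamma>) K" by blast
    have c: "orbit_cover \<Gamma> K (orbit_space K) coarsen (motion_orbit K)"
      using K(1) orbit_cover_subgroup by (simp add: \<S>_def)
    have "nfold_covering n (orbit_space K) coarsen (orbit_space \<Gamma>)"
      using orbit_cover_nfold[OF c] K(1) by (simp add: \<S>_def)
    then obtain N' :: "((real^3) set \<times> nat) topology" and p' where N: "nfold_covering n N' p' (orbit_space \<Gamma>)"
      "N' homeomorphic_space orbit_space K" "covering_equiv (orbit_space K) coarsen N' p'"
      by (rule nfold_covering_representative)
    have A: "(N', p') \<in> ?A"
      using N(1,2) K(1) homeomorphic_space_trans by (auto simp: coverings_def \<S>_def)
    have "C = ?g (N', p')" using covering_equiv_iff_conj[OF c Hf[OF A]] N(3) K(2) by simp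
    then show "C \<in> ?g ` ?A" using A by (rule image_eqI)
  qed
  ultimately show ?thesis using that by simp
qed

end

section \<open>Orbit spaces and isomorphism of the groups\<close>

lemma motion_grp_conj_iso:
  assumes F: "bij F" and G: "\<Gamma> \<subseteq> {f. bij f}" and G': "\<Gamma>' = (\<lambda>\<gamma>. F \<circ> \<gamma> \<circ> finv F) ` \<Gamma>"
  shows "motion_grp \<Gamma> \<cong> motion_grp \<Gamma>'"
proof -
  let ?t = "\<lambda>\<gamma>. F \<circ> \<gamma> \<circ> finv F"
  have FF: "finv F (F x) = x" "F (finv F x) = x" for x
    using F by (auto simp: bij_is_inj bij_is_surj surj_f_inv_f)
  have b: "bij (?t \<gamma>)" if "\<gamma> \<in> \<Gamma>" for \<gamma> using that F G bij_imp_bij_inv by (auto intro!: bij_comp)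
  have "?t \<in> hom (motion_grp \<Gamma>) (motion_grp \<Gamma>')"
  proof (rule homI)
    fix x y assume "x \<in> carrier (motion_grp \<Gamma>)" "y \<in> carrier (motion_grp \<Gamma>)"
    then have xy: "x \<in> \<Gamma>" "y \<in> \<Gamma>" by auto
    have "?t x \<otimes>\<^bsub>motion_grp \<Gamma>'\<^esub> ?t y = ?t x \<circ> ?t y" using b xy by simp
    moreover have "x \<otimes>\<^bsub>motion_grp \<Gamma>\<^esub> y = x \<circ> y" using G xy by (simp add: subset_iff)
    ultimately show "?t (x \<otimes>\<^bsub>motion_grp \<Gamma>\<^esub> y) = ?t x \<otimes>\<^bsub>motion_grp \<Gamma>'\<^esub> ?t y"
      by (auto simp: FF)
  qed (use G' in auto)
  moreover have "inj_on ?t \<Gamma>"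
  proof (rule inj_onI)
    fix x y assume "?t x = ?t y"
    then have "finv F (?t x (F v)) = finv F (?t y (F v))" for v by simp
    then show "x = y" by (auto simp: FF)
  qed
  ultimately have "?t \<in> iso (motion_grp \<Gamma>) (motion_grp \<Gamma>')"
    using G' by (simp add: iso_def bij_betw_def)
  then show ?thesis by (rule is_isoI)
qed

text \<open>The map \<open>F\<close> takes the orbits of \<open>\<Gamma>\<close> to those of \<open>\<Gamma>'\<close>.\<close>

lemma orbit_space_conj_homeomorphic:
  assumes "motions \<Gamma> \<epsilon>" "motions \<Gamma>' \<epsilon>'" and F: "homeomorphic_map euclidean euclidean F"
    and G': "\<Gamma>' = (\<lambda>\<gamma>. F \<circ> \<gamma> \<circ> finv F) ` \<Gamma>"
  shows "orbit_space \<Gamma> homeomorphic_space orbit_space \<Gamma>'"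
proof -
  interpret G: motions \<Gamma> \<epsilon> by fact
  interpret G': motions \<Gamma>' \<epsilon>' by fact
  have "bij F" using F by (auto simp: homeomorphic_eq_everything_map bij_def)
  then have FF: "finv F (F x) = x" "F x = F y \<longleftrightarrow> x = y" for x y
    by (auto simp: bij_is_inj inj_eq)
  have "quotient_map euclidean (orbit_space \<Gamma>') (motion_orbit \<Gamma>' \<circ> F)"
    by (rule quotient_map_compose[OF _ quotient_map_orbit_space]) (use F in \<open>simp add: homeomorphic_map_def\<close>)
  moreover have "motion_orbit \<Gamma> v = motion_orbit \<Gamma> w \<longleftrightarrow> (motion_orbit \<Gamma>' \<circ> F) v = (motion_orbit \<Gamma>' \<circ> F) w" for v w
    unfolding G.orbit_eq_iff comp_apply G'.orbit_eq_iff by (simp add: G' FF)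
  ultimately obtain h where "homeomorphic_map (orbit_space \<Gamma>) (orbit_space \<Gamma>') h"
    using quotient_maps_same_fibres[OF quotient_map_orbit_space] by blast
  then show ?thesis by (rule homeomorphic_map_imp_homeomorphic_space)
qed

text \<open>A homeomorphism of the orbit spaces and its inverse lift to maps \<open>F\<close> and \<open>G\<close> of space. By
  uniqueness of lifts \<open>F\<close> and \<open>G\<close> are inverse to each other, and \<open>F\<close> conjugates \<open>\<Gamma>\<close> to \<open>\<Gamma>'\<close>.\<close>

theorem homeomorphic_orbit_spaces_iso:
  assumes "motions \<Gamma> \<epsilon>" "motions \<Gamma>' \<epsilon>'" and hom: "orbit_space \<Gamma> homeomorphic_space orbit_space \<Gamma>'"
  shows "motion_grp \<Gamma> \<cong> motion_grp \<Gamma>'"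
proof -
  interpret G: motions \<Gamma> \<epsilon> by fact
  interpret G': motions \<Gamma>' \<epsilon>' by fact
  let ?q = "motion_orbit \<Gamma>" and ?q' = "motion_orbit \<Gamma>'"
  obtain k k' where k: "homeomorphic_maps (orbit_space \<Gamma>) (orbit_space \<Gamma>') k k'"
    using hom by (auto simp: homeomorphic_space_def)
  then have kk: "k' (k (?q v)) = ?q v" "k (k' (?q' v)) = ?q' v" for v
    by (auto simp: homeomorphic_maps_def topspace_orbit_space)
  have ck: "continuous_map euclidean (orbit_space \<Gamma>') (k \<circ> ?q)"
    using k G.continuous_orbit by (auto simp: homeomorphic_maps_def intro: continuous_map_compose)
  have ck': "continuous_map euclidean (orbit_space \<Gamma>) (k' \<circ> ?q')"
    using k G'.continuous_orbit by (auto simp: homeomorphic_maps_def intro: continuous_map_compose)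
  note cov = G.orbit_cover_covering_map[OF G.orbit_cover_trivial]
    and cov' = G'.orbit_cover_covering_map[OF G'.orbit_cover_trivial]
  have "(k \<circ> ?q) \<in> UNIV \<rightarrow> range ?q'"
    using ck by (simp add: continuous_map_def topspace_orbit_space)
  then have "(k \<circ> ?q) 0 \<in> range ?q'" by (rule funcset_mem) (rule UNIV_I)
  then have "k (?q 0) \<in> range ?q'" by (simp only: comp_apply)
  then obtain w where w: "k (?q 0) = ?q' w" by (rule rangeE)
  obtain F where F: "continuous_map euclidean euclidean F" "\<And>v. ?q' (F v) = k (?q v)" "F 0 = w"
    using covering_lift_exists[OF cov' ck, of w 0] w by (metis UNIV_I comp_apply topspace_euclidean)
  obtain G where G: "continuous_map euclidean euclidean G" "\<And>v. ?q (G v) = k' (?q' v)" "G w = 0"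
    using covering_lift_exists[OF cov ck', of 0 w] w kk(1) by (metis UNIV_I comp_apply topspace_euclidean)
  have "G \<circ> F = id"
    by (rule G.lift_unique[OF cov continuous_map_compose[OF F(1) G(1)], where a = 0])
      (use F G kk in auto)
  moreover have "F \<circ> G = id"
    by (rule G'.lift_unique[OF cov' continuous_map_compose[OF G(1) F(1)], where a = w])
      (use F G kk in auto)
  ultimately have FG: "G (F v) = v" "F (G v) = v" for v by (metis comp_apply id_apply)+
  then have bF: "bij F" by (intro o_bij[of G]) auto
  have iF: "finv F = G"
    by (rule inv_unique_comp) (use FG in auto)
  have "F \<circ> \<gamma> \<circ> G \<in> \<Gamma>'" if g: "\<gamma> \<in> \<Gamma>" for \<gamma>
  proof -
    have q: "?q' (F (\<gamma> v)) = ?q' (F v)" for v using F(2) G.orbit_motion[OF g] by simp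
    obtain \<gamma>' where g': "\<gamma>' \<in> \<Gamma>'" "F (\<gamma> 0) = \<gamma>' (F 0)" using q G'.orbit_eq_iff by metis
    have "F \<circ> \<gamma> = \<gamma>' \<circ> F"
    proof (rule G'.lift_unique[OF cov', where a = 0])
      show "continuous_map euclidean euclidean (F \<circ> \<gamma>)"
        by (rule continuous_map_compose[OF _ F(1)]) (use G.cont[OF g] in simp)
      show "continuous_map euclidean euclidean (\<gamma>' \<circ> F)"
        by (rule continuous_map_compose[OF F(1)]) (use G'.cont[OF g'(1)] in simp)
    qed (simp_all add: q g'(2) G'.orbit_motion[OF g'(1)])
    then have "F \<circ> \<gamma> \<circ> G = \<gamma>'" using FG by (auto simp: fun_eq_iff)
    then show ?thesis using g' by simp
  qed
  moreover have "\<gamma>' \<in> (\<lambda>\<gamma>. F \<circ> \<gamma> \<circ> G) ` \<Gamma>" if g': "\<gamma>' \<in> \<Gamma>'" for \<gamma>'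
  proof -
    have q: "?q (G (\<gamma>' v)) = ?q (G v)" for v using G(2) G'.orbit_motion[OF g'] by simp
    obtain \<gamma> where g: "\<gamma> \<in> \<Gamma>" "G (\<gamma>' w) = \<gamma> (G w)" using q G.orbit_eq_iff by metis
    have "G \<circ> \<gamma>' = \<gamma> \<circ> G"
    proof (rule G.lift_unique[OF cov, where a = w])
      show "continuous_map euclidean euclidean (G \<circ> \<gamma>')"
        by (rule continuous_map_compose[OF _ G(1)]) (use G'.cont[OF g'] in simp)
      show "continuous_map euclidean euclidean (\<gamma> \<circ> G)"
        by (rule continuous_map_compose[OF G(1)]) (use G.cont[OF g(1)] in simp)
    qed (simp_all add: q g(2) G.orbit_motion[OF g(1)])
    then have "F (\<gamma> (G v)) = \<gamma>' v" for v using FG(2) by (metis comp_apply)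
    then have "\<gamma>' = F \<circ> \<gamma> \<circ> G" by auto
    then show ?thesis using g by blast
  qed
  ultimately have "\<Gamma>' = (\<lambda>\<gamma>. F \<circ> \<gamma> \<circ> finv F) ` \<Gamma>" unfolding iF by blast
  then show ?thesis using motion_grp_conj_iso[OF bF] G.bij by blast
qed

section \<open>Quarter turns and twisted products\<close>

text \<open>The rotation of the plane by \<open>k\<close> quarter turns, for integral and for real vectors.\<close>

definition rot :: "int \<Rightarrow> 'a::group_add \<times> 'a \<Rightarrow> 'a \<times> 'a" where
  "rot k v = (if k mod 4 = 0 then v else if k mod 4 = 1 then (- snd v, fst v)
     else if k mod 4 = 2 then (- fst v, - snd v) else (snd v, - fst v))"

lemma mod4_cases: "(k::int) mod 4 = 0 \<or> k mod 4 = 1 \<or> k mod 4 = 2 \<or> k mod 4 = 3"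
  by presburger

lemma rot_add: "rot (j + k) v = rot j (rot k v)"
proof -
  have e: "(j + k) mod 4 = (j mod 4 + k mod 4) mod 4" by (simp add: mod_add_eq)
  show ?thesis
    unfolding rot_def e using mod4_cases[of j] mod4_cases[of k]
    by (elim disjE) (simp_all del: mod_add_eq mod_add_left_eq mod_add_right_eq)
qed

lemma rot_0 [simp]: "rot 0 v = v" by (simp add: rot_def)

lemma rot_id: "k mod 4 = 0 \<Longrightarrow> rot k v = v" by (simp add: rot_def)

lemma rot_cancel [simp]: "rot (- k) (rot k v) = v" "rot k (rot (- k) v) = v"
  by (simp_all add: rot_add[symmetric])

lemma rot_commute: "rot j (rot k v) = rot k (rot j v)"
  by (simp add: rot_add[symmetric] add.commute)

lemma rot_plus [simp]: "rot k (v + w) = rot k v + rot k (w :: 'a::ab_group_add \<times> 'a)"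
  by (auto simp: rot_def prod_eq_iff)

lemma rot_zero [simp]: "rot k 0 = 0"
  by (auto simp: rot_def prod_eq_iff)

lemma rot_minus [simp]: "rot k (- v) = - rot k (v :: 'a::ab_group_add \<times> 'a)"
  by (auto simp: rot_def prod_eq_iff)

lemma rot_diff [simp]: "rot k (v - w) = rot k v - rot k (w :: 'a::ab_group_add \<times> 'a)"
  using rot_plus[of k v "- w"] by simp

lemma rot_eq_iff [simp]: "rot k v = rot k w \<longleftrightarrow> v = w"
  using rot_cancel(1) by metis

text \<open>The semidirect product of \<open>\<int>\<^sup>2\<close> with \<open>\<int>\<close> in which the generator of \<open>\<int>\<close> acts by \<open>e\<close> quarter turns.
  The values 1, 2 and 4 of \<open>e\<close> give the fundamental groups of \<^const>\<open>manifold_G4\<close>,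
  \<^const>\<open>manifold_G2\<close> and \<^const>\<open>manifold_G1\<close>.\<close>

definition Tw :: "int \<Rightarrow> ((int \<times> int) \<times> int) monoid" where
  "Tw e = \<lparr>carrier = UNIV, mult = (\<lambda>(v, j) (w, k). (v + rot (e * j) w, j + k)), one = (0, 0)\<rparr>"

lemma carrier_Tw [simp]: "carrier (Tw e) = UNIV" by (simp add: Tw_def)

lemma mult_Tw [simp]: "(v, j) \<otimes>\<^bsub>Tw e\<^esub> (w, k) = (v + rot (e * j) w, j + k)" by (simp add: Tw_def)

lemma one_Tw [simp]: "\<one>\<^bsub>Tw e\<^esub> = (0, 0)" by (simp add: Tw_def)

lemma group_Tw: "group (Tw e)"
proof (rule groupI)
  fix x y z assume "x \<in> carrier (Tw e)"
  show "x \<otimes>\<^bsub>Tw e\<^esub> y \<otimes>\<^bsub>Tw e\<^esub> z = x \<otimes>\<^bsub>Tw e\<^esub> (y \<otimes>\<^bsub>Tw e\<^esub> z)"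
    by (cases x; cases y; cases z) (simp add: rot_add algebra_simps)
  show "\<one>\<^bsub>Tw e\<^esub> \<otimes>\<^bsub>Tw e\<^esub> x = x" by (cases x) simp
  show "\<exists>y\<in>carrier (Tw e). y \<otimes>\<^bsub>Tw e\<^esub> x = \<one>\<^bsub>Tw e\<^esub>"
    by (rule bexI[of _ "(- rot (- (e * snd x)) (fst x), - snd x)"]; cases x) simp_all
qed auto

lemma inv_Tw [simp]: "inv\<^bsub>Tw e\<^esub> (v, j) = (- rot (- (e * j)) v, - j)"
  by (rule group.inv_equality[OF group_Tw]) auto

definition smul :: "int \<Rightarrow> int \<times> int \<Rightarrow> int \<times> int" where
  "smul c v = (c * fst v, c * snd v)"

lemma smul_simps [simp]: "smul 0 v = 0" "smul 1 v = v" "smul c (x, y) = (c * x, c * y)"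
  by (auto simp: smul_def prod_eq_iff)

lemma smul_add: "smul (c + d) v = smul c v + smul d v" "smul (c - d) v = smul c v - smul d v"
  by (auto simp: smul_def prod_eq_iff algebra_simps)

lemma subgroup_Tw_smul:
  assumes H: "subgroup H (Tw e)" and w: "(w, 0) \<in> H"
  shows "(smul c w, 0) \<in> H"
proof (induction c rule: int_induct[where k = 0])
  case base
  show ?case using subgroup.one_closed[OF H] by simp
next
  case (step1 c)
  then show ?case using subgroup.m_closed[OF H _ w, of "(smul c w, 0)"] by (simp add: smul_add)
next
  case (step2 c)
  then show ?case using subgroup.m_closed[OF H _ subgroup.m_inv_closed[OF H w], of "(smul c w, 0)"]
    by (simp add: smul_add)
qed

lemma subgroup_Tw_pow:
  assumes H: "subgroup H (Tw e)" and w: "(u, m) \<in> H"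
  obtains v where "(v, m * c) \<in> H"
proof -
  have "\<exists>v. (v, m * c) \<in> H"
  proof (induction c rule: int_induct[where k = 0])
    case base
    show ?case using subgroup.one_closed[OF H] by (intro exI[of _ 0]) simp
  next
    case (step1 c)
    then obtain v where v: "(v, m * c) \<in> H" by blast
    have "(v + rot (e * (m * c)) u, m * c + m) \<in> H" using subgroup.m_closed[OF H v w] by simp
    then show ?case by (intro exI) (simp only: distrib_left mult_1_right)
  next
    case (step2 c)
    then obtain v where v: "(v, m * c) \<in> H" by blast
    have "(v - rot (e * (m * c)) (rot (- (e * m)) u), m * c - m) \<in> H"
      using subgroup.m_closed[OF H v subgroup.m_inv_closed[OF H w]] by simp
    then show ?case by (intro exI) (simp only: right_diff_distrib mult_1_right)
  qed
  then show ?thesis using that by blast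
qed

text \<open>The two unit vectors generate the plane part, and powers of \<open>(0, 1)\<close> reach every height.\<close>

lemma subgroup_Tw_eq_UNIV:
  assumes H: "subgroup H (Tw e)" and g: "((1, 0), 0) \<in> H" "((0, 1), 0) \<in> H" "(0, 1) \<in> H"
  shows "H = UNIV"
proof -
  have xy: "((a, b), 0) \<in> H" for a b
    using subgroup.m_closed[OF H subgroup_Tw_smul[OF H g(1), of a] subgroup_Tw_smul[OF H g(2), of b]] by simp
  have "(v, k) \<in> H" for v k
  proof -
    obtain w where w: "(w, 1 * k) \<in> H" by (rule subgroup_Tw_pow[OF H g(3)])
    show ?thesis
      using subgroup.m_closed[OF H xy[of "fst (v - w)" "snd (v - w)"] w] by (cases v; cases w) simp
  qed
  then show ?thesis by auto
qed

lemma generate_Tw: "generate (Tw e) {((1, 0), 0), ((0, 1), 0), (0, 1)} = UNIV"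
proof (rule subgroup_Tw_eq_UNIV)
  show "subgroup (generate (Tw e) {((1, 0), 0), ((0, 1), 0), (0, 1)}) (Tw e)"
    by (rule group.generate_is_subgroup[OF group_Tw]) simp
qed (auto intro: generate.incl)

section \<open>The motions of space\<close>

definition xy :: "real^3 \<Rightarrow> real \<times> real" where "xy v = (v$1, v$2)"

definition real_pair :: "int \<times> int \<Rightarrow> real \<times> real" where
  "real_pair v = (of_int (fst v), of_int (snd v))"

lemma real_pair_simps [simp]: "real_pair (v + w) = real_pair v + real_pair w" "real_pair 0 = 0"
  "real_pair (rot k v) = rot k (real_pair v)" "real_pair v = real_pair w \<longleftrightarrow> v = w"
  by (auto simp: real_pair_def rot_def prod_eq_iff)

lemma vec3_eqI: "xy v = xy w \<Longrightarrow> v$3 = w$3 \<Longrightarrow> v = w"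
  by (simp add: vec_eq_iff forall_3 xy_def)

text \<open>The motion that realizes an element of \<^term>\<open>Tw e\<close>: its second component \<open>j\<close> turns the horizontal
  plane by \<open>e * j\<close> quarter turns and raises the height by \<open>j\<close>, its first component is a horizontal
  translation.\<close>

definition move :: "int \<Rightarrow> (int \<times> int) \<times> int \<Rightarrow> real^3 \<Rightarrow> real^3" where
  "move e g v = (let w = rot (e * snd g) (xy v) + real_pair (fst g)
     in vector [fst w, snd w, v$3 + of_int (snd g)])"

lemma xy_move [simp]: "xy (move e g v) = rot (e * snd g) (xy v) + real_pair (fst g)"
  and move_3 [simp]: "move e g v $ 3 = v$3 + of_int (snd g)"
  by (simp_all add: move_def Let_def xy_def prod_eq_iff)

lemma xy_0 [simp]: "xy 0 = 0" by (simp add: xy_def prod_eq_iff)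

lemma move_mult: "move e (g \<otimes>\<^bsub>Tw e\<^esub> h) = move e g \<circ> move e h"
proof
  fix v show "move e (g \<otimes>\<^bsub>Tw e\<^esub> h) v = (move e g \<circ> move e h) v"
    by (rule vec3_eqI; cases g; cases h) (simp_all add: algebra_simps rot_add)
qed

lemma move_one: "move e (0, 0) = id"
  by (rule ext, rule vec3_eqI) simp_all

lemma move_inj: "move e g = move e h \<Longrightarrow> g = h"
proof -
  assume a: "move e g = move e h"
  have "xy (move e g 0) = xy (move e h 0)" "move e g 0 $ 3 = move e h 0 $ 3" using a by simp_all
  then have "fst g = fst h" "snd g = snd h" by simp_all
  then show "g = h" by (simp add: prod_eq_iff)
qed

lemma move_bij: "bij (move e g)"
proof (rule o_bij[of "move e (inv\<^bsub>Tw e\<^esub> g)"])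
  interpret group "Tw e" by (rule group_Tw)
  show "move e (inv\<^bsub>Tw e\<^esub> g) \<circ> move e g = id" "move e g \<circ> move e (inv\<^bsub>Tw e\<^esub> g) = id"
    unfolding move_mult[symmetric] using l_inv[of g] r_inv[of g] move_one by simp_all
qed

lemma move_hom: "move e \<in> hom (Tw e) (BijGroup UNIV)"
  by (rule homI) (simp_all add: move_bij move_mult)

lemma group_hom_move: "group_hom (Tw e) (BijGroup UNIV) (move e)"
  by (simp add: group_hom_def group_hom_axioms_def group_Tw group_BijGroup move_hom)

lemma move_continuous: "continuous_on UNIV (move e g)"
proof -
  have eq: "move e g v = (\<chi> i. if i = 1 then fst (rot (e * snd g) (xy v)) + of_int (fst (fst g))
      else if i = 2 then snd (rot (e * snd g) (xy v)) + of_int (snd (fst g)) else v$3 + of_int (snd g))" for v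
    by (simp add: vec_eq_iff forall_3 move_def Let_def real_pair_def)
  have "continuous_on UNIV (\<lambda>v. fst (rot k (xy v)))" "continuous_on UNIV (\<lambda>v. snd (rot k (xy v)))" for k
    unfolding rot_def xy_def using mod4_cases[of k]
    by (auto intro!: continuous_intros)
  note c = this
  show ?thesis
    unfolding eq
  proof (rule continuous_on_vec_lambda)
    fix i :: 3
    show "continuous_on UNIV (\<lambda>v. if i = 1 then fst (rot (e * snd g) (xy v)) + of_int (fst (fst g))
      else if i = 2 then snd (rot (e * snd g) (xy v)) + of_int (snd (fst g)) else v$3 + of_int (snd g))"
      by (cases "i = 1"; cases "i = 2") (simp_all add: c continuous_intros)
  qed
qed

text \<open>A displacement shorter than 1 forces the integral change of height to vanish; the motion is then
  a translation by an integral vector shorter than 1.\<close>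

lemma move_free:
  assumes d: "dist (move e g v) v < 1"
  shows "move e g = id"
proof -
  have small: "\<bar>(move e g v - v) $ i\<bar> < 1" for i
    using component_le_norm_cart[of "move e g v - v" i] d by (simp add: dist_norm)
  have "snd g = 0" using small[of 3] by simp
  moreover from this have "xy (move e g v) = xy v + real_pair (fst g)" by simp
  then have "fst (fst g) = 0" "snd (fst g) = 0"
    using small[of 1] small[of 2] by (simp_all add: xy_def real_pair_def prod_eq_iff)
  ultimately have "g = (0, 0)" by (simp add: prod_eq_iff)
  then show ?thesis by (simp add: move_one)
qed

lemma motions_move: "motions (range (move e)) 1"
proof -
  have "subgroup (move e ` carrier (Tw e)) (BijGroup UNIV)"
    by (rule group_hom.img_is_subgroup[OF group_hom_move])
  then show ?thesis
    unfolding motions_def using move_continuous move_free by auto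
qed

lemma move_iso: "move e \<in> iso (Tw e) (motion_grp (range (move e)))"
proof -
  have "move e \<in> hom (Tw e) (motion_grp (range (move e)))"
    by (rule homI) (simp_all add: move_mult move_bij)
  moreover have "inj (move e)" using move_inj by (rule injI)
  ultimately show ?thesis by (simp add: iso_def bij_betw_def)
qed

lemma motion_group_move: "motion_group (move e ` {((1, 0), 0), ((0, 1), 0), (0, 1)}) = range (move e)"
  unfolding motion_group_def
  using group_hom.generate_img[OF group_hom_move[of e], of "{((1, 0), 0), ((0, 1), 0), (0, 1)}"] generate_Tw[of e]
  by simp

lemma move_generators:
  "move e ((1, 0), 0) = transl_x" "move e ((0, 1), 0) = transl_y"
  "move 4 (0, 1) = transl_z" "move 2 (0, 1) = screw2" "move 1 (0, 1) = screw4"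
  by (simp_all add: fun_eq_iff vec_eq_iff forall_3 move_def Let_def xy_def transl_x_def transl_y_def
      transl_z_def screw2_def screw4_def rot_def real_pair_def)

lemma manifold_orbit_spaces:
  "manifold_G1 = orbit_space (range (move 4))"
  "manifold_G2 = orbit_space (range (move 2))"
  "manifold_G4 = orbit_space (range (move 1))"
  unfolding manifold_G1_def manifold_G2_def manifold_G4_def
  using motion_group_move[of 4] motion_group_move[of 2] motion_group_move[of 1]
  by (simp_all add: move_generators)

section \<open>The presented groups\<close>

fun letter_val :: "gen letter \<Rightarrow> (int \<times> int) \<times> int" where
  "letter_val (Pos GX) = ((1, 0), 0)"
| "letter_val (Neg GX) = ((-1, 0), 0)"
| "letter_val (Pos GY) = ((0, 1), 0)"
| "letter_val (Neg GY) = ((0, -1), 0)"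
| "letter_val (Pos GZ) = (0, 1)"
| "letter_val (Neg GZ) = (0, -1)"

fun word_val :: "int \<Rightarrow> gen letter list \<Rightarrow> (int \<times> int) \<times> int" where
  "word_val e [] = (0, 0)"
| "word_val e (l # u) = letter_val l \<otimes>\<^bsub>Tw e\<^esub> word_val e u"

lemma word_val_append: "word_val e (u @ v) = word_val e u \<otimes>\<^bsub>Tw e\<^esub> word_val e v"
proof -
  interpret group "Tw e" by (rule group_Tw)
  show ?thesis
  proof (induction u)
    case Nil
    show ?case using l_one[of "word_val e v"] by simp
  next
    case (Cons l u)
    then show ?case using m_assoc by simp
  qed
qed

lemma word_eq_word_val:
  assumes R: "\<And>u v. (u, v) \<in> R \<Longrightarrow> word_val e u = word_val e v" and "word_eq R u v"
  shows "word_val e u = word_val e v"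
  using assms(2)
proof induction
  case (cancel a)
  have "letter_val a \<otimes>\<^bsub>Tw e\<^esub> letter_val (letter_inv a) = (0, 0)"
  proof (cases a)
    case (Pos g) then show ?thesis by (cases g) (auto simp: prod_eq_iff)
  next
    case (Neg g) then show ?thesis by (cases g) (auto simp: prod_eq_iff)
  qed
  moreover have "letter_val (letter_inv a) \<otimes>\<^bsub>Tw e\<^esub> (0, 0) = letter_val (letter_inv a)"
    by (cases "letter_val (letter_inv a)") simp
  ultimately show ?case by simp
qed (auto simp: R word_val_append)

lemma (in group) int_pow_intertwine:
  assumes "g \<in> carrier G" "p \<in> carrier G" "q \<in> carrier G" "g \<otimes> p = q \<otimes> g"
  shows "g \<otimes> p [^] (k :: int) = q [^] k \<otimes> g"
proof (induction k rule: int_induct[where k = 0])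
  case base
  then show ?case using assms by simp
next
  case (step1 k)
  have "g \<otimes> p [^] (k + 1) = g \<otimes> p [^] k \<otimes> p" using assms by (simp add: int_pow_mult m_assoc)
  also have "\<dots> = q [^] k \<otimes> (q \<otimes> g)" using step1 assms by (simp add: m_assoc)
  finally show ?case using assms by (simp add: int_pow_mult m_assoc)
next
  case (step2 k)
  have "inv q \<otimes> (g \<otimes> p) \<otimes> inv p = inv q \<otimes> g" using assms(1-3) by (simp add: m_assoc)
  moreover have "inv q \<otimes> (q \<otimes> g) \<otimes> inv p = g \<otimes> inv p"
    using assms(1-3) by (simp add: m_assoc[symmetric])
  ultimately have *: "g \<otimes> inv p = inv q \<otimes> g" using assms(4) by simp
  have "g \<otimes> p [^] (k - 1) = g \<otimes> p [^] k \<otimes> inv p" using assms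
    by (simp add: int_pow_diff m_assoc)
  also have "\<dots> = q [^] k \<otimes> (g \<otimes> inv p)" using step2 assms by (simp add: m_assoc)
  also have "\<dots> = q [^] (k - 1) \<otimes> g" using assms * by (simp add: int_pow_diff m_assoc)
  finally show ?case .
qed

text \<open>The relations hold in \<^term>\<open>Tw e\<close>, so words can be evaluated there. Conversely \<open>comm\<close> and \<open>tw\<close>, the
  rules of computation in \<^term>\<open>Tw e\<close>, bring every word to the normal form \<open>x\<^sup>a y\<^sup>b z\<^sup>k\<close>, whose
  exponents are the value of the word; hence evaluation is injective.\<close>

lemma presented_group_iso_Tw:
  fixes R :: "(gen letter list \<times> gen letter list) set"
  defines "G \<equiv> presented_group R"
  defines "x \<equiv> word_class R [Pos GX]" and "y \<equiv> word_class R [Pos GY]" and "z \<equiv> word_class R [Pos GZ]"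
  assumes R: "\<And>u v. (u, v) \<in> R \<Longrightarrow> word_val e u = word_val e v"
    and comm: "x \<otimes>\<^bsub>G\<^esub> y = y \<otimes>\<^bsub>G\<^esub> x"
    and tw: "\<And>(a :: int) (b :: int) (s :: int). s \<in> {1, -1} \<Longrightarrow> z [^]\<^bsub>G\<^esub> s \<otimes>\<^bsub>G\<^esub> (x [^]\<^bsub>G\<^esub> a \<otimes>\<^bsub>G\<^esub> y [^]\<^bsub>G\<^esub> b) =
      x [^]\<^bsub>G\<^esub> fst (rot (e * s) (a, b)) \<otimes>\<^bsub>G\<^esub> y [^]\<^bsub>G\<^esub> snd (rot (e * s) (a, b)) \<otimes>\<^bsub>G\<^esub> z [^]\<^bsub>G\<^esub> s"
  shows "G \<cong> Tw e"
proof -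
  interpret group G unfolding G_def by (rule group_presented_group)
  have car: "carrier G = range (word_class R)" and one: "\<one>\<^bsub>G\<^esub> = word_class R []"
    by (auto simp: G_def presented_group_def)
  have mult: "word_class R u \<otimes>\<^bsub>G\<^esub> word_class R v = word_class R (u @ v)" for u v
    unfolding G_def by (rule presented_group_mult)
  have c: "x \<in> carrier G" "y \<in> carrier G" "z \<in> carrier G" by (auto simp: car x_def y_def z_def)
  have neg: "word_class R [Neg g] = word_class R [Pos g] [^]\<^bsub>G\<^esub> (-1 :: int)" for g
  proof -
    have "word_eq R [Neg g, Pos g] []" using word_eq.cancel[of R "Neg g"] by simp
    then have "word_class R [Neg g] \<otimes>\<^bsub>G\<^esub> word_class R [Pos g] = \<one>\<^bsub>G\<^esub>"
      by (simp add: mult one word_class_eq_iff)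
    then have "inv\<^bsub>G\<^esub> (word_class R [Pos g]) = word_class R [Neg g]"
      by (rule inv_equality) (auto simp: car)
    then show ?thesis by (simp add: int_pow_neg car)
  qed
  define \<phi> where "\<phi> g = (case g of ((a, b), k) \<Rightarrow> x [^]\<^bsub>G\<^esub> a \<otimes>\<^bsub>G\<^esub> y [^]\<^bsub>G\<^esub> b \<otimes>\<^bsub>G\<^esub> z [^]\<^bsub>G\<^esub> k)"
    for g :: "(int \<times> int) \<times> int"
  have \<phi>x: "x [^]\<^bsub>G\<^esub> s \<otimes>\<^bsub>G\<^esub> \<phi> g = \<phi> (((s, 0), 0) \<otimes>\<^bsub>Tw e\<^esub> g)" for s :: int and g
  proof -
    obtain a b k where g: "g = ((a, b), k)" by (metis surj_pair)
    show ?thesis using c by (simp add: g \<phi>_def m_assoc[symmetric] int_pow_mult[symmetric])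
  qed
  have \<phi>y: "y [^]\<^bsub>G\<^esub> s \<otimes>\<^bsub>G\<^esub> \<phi> g = \<phi> (((0, s), 0) \<otimes>\<^bsub>Tw e\<^esub> g)" for s :: int and g
  proof -
    obtain a b k where g: "g = ((a, b), k)" by (metis surj_pair)
    have "x \<otimes>\<^bsub>G\<^esub> y [^]\<^bsub>G\<^esub> s = y [^]\<^bsub>G\<^esub> s \<otimes>\<^bsub>G\<^esub> x" by (rule int_pow_intertwine) (use c comm in auto)
    then have "y [^]\<^bsub>G\<^esub> s \<otimes>\<^bsub>G\<^esub> x [^]\<^bsub>G\<^esub> a = x [^]\<^bsub>G\<^esub> a \<otimes>\<^bsub>G\<^esub> y [^]\<^bsub>G\<^esub> s"
      using c by (intro int_pow_intertwine) auto
    then have "y [^]\<^bsub>G\<^esub> s \<otimes>\<^bsub>G\<^esub> (x [^]\<^bsub>G\<^esub> a \<otimes>\<^bsub>G\<^esub> (y [^]\<^bsub>G\<^esub> b \<otimes>\<^bsub>G\<^esub> z [^]\<^bsub>G\<^esub> k)) =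
        x [^]\<^bsub>G\<^esub> a \<otimes>\<^bsub>G\<^esub> (y [^]\<^bsub>G\<^esub> s \<otimes>\<^bsub>G\<^esub> (y [^]\<^bsub>G\<^esub> b \<otimes>\<^bsub>G\<^esub> z [^]\<^bsub>G\<^esub> k))"
      using c by (simp add: m_assoc[symmetric])
    also have "y [^]\<^bsub>G\<^esub> s \<otimes>\<^bsub>G\<^esub> (y [^]\<^bsub>G\<^esub> b \<otimes>\<^bsub>G\<^esub> z [^]\<^bsub>G\<^esub> k) = y [^]\<^bsub>G\<^esub> (s + b) \<otimes>\<^bsub>G\<^esub> z [^]\<^bsub>G\<^esub> k"
      using c by (simp add: m_assoc[symmetric] int_pow_mult)
    finally show ?thesis using c by (simp add: g \<phi>_def m_assoc)
  qed
  have \<phi>z: "z [^]\<^bsub>G\<^esub> s \<otimes>\<^bsub>G\<^esub> \<phi> g = \<phi> ((0, s) \<otimes>\<^bsub>Tw e\<^esub> g)" if "s \<in> {1, -1}" for s :: int and g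
  proof -
    obtain a b k where g: "g = ((a, b), k)" by (metis surj_pair)
    obtain a' b' where r: "rot (e * s) (a, b) = (a', b')" by force
    have "z [^]\<^bsub>G\<^esub> s \<otimes>\<^bsub>G\<^esub> \<phi> g = z [^]\<^bsub>G\<^esub> s \<otimes>\<^bsub>G\<^esub> (x [^]\<^bsub>G\<^esub> a \<otimes>\<^bsub>G\<^esub> y [^]\<^bsub>G\<^esub> b) \<otimes>\<^bsub>G\<^esub> z [^]\<^bsub>G\<^esub> k"
      using c by (simp add: g \<phi>_def m_assoc)
    also have "\<dots> = x [^]\<^bsub>G\<^esub> a' \<otimes>\<^bsub>G\<^esub> y [^]\<^bsub>G\<^esub> b' \<otimes>\<^bsub>G\<^esub> z [^]\<^bsub>G\<^esub> s \<otimes>\<^bsub>G\<^esub> z [^]\<^bsub>G\<^esub> k"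
      using tw[OF that, of a b] r by simp
    also have "\<dots> = x [^]\<^bsub>G\<^esub> a' \<otimes>\<^bsub>G\<^esub> y [^]\<^bsub>G\<^esub> b' \<otimes>\<^bsub>G\<^esub> z [^]\<^bsub>G\<^esub> (s + k)"
      using c by (simp add: m_assoc int_pow_mult)
    finally show ?thesis using r by (simp add: g \<phi>_def)
  qed
  have letter: "word_class R [l] \<otimes>\<^bsub>G\<^esub> \<phi> g = \<phi> (letter_val l \<otimes>\<^bsub>Tw e\<^esub> g)" for l g
  proof (cases l)
    case (Pos h)
    have "word_class R [Pos h] [^]\<^bsub>G\<^esub> (1::int) = word_class R [Pos h]" by (simp add: car)
    then show ?thesis using Pos \<phi>x[of 1 g] \<phi>y[of 1 g] \<phi>z[of 1 g] by (cases h) (simp_all add: x_def y_def z_def)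
  next
    case (Neg h)
    then show ?thesis
      using \<phi>x[of "-1" g] \<phi>y[of "-1" g] \<phi>z[of "-1" g] by (cases h) (simp_all add: neg x_def y_def z_def)
  qed
  have norm: "word_class R u = \<phi> (word_val e u)" for u
  proof (induction u)
    case Nil
    have "\<phi> (0, 0) = \<one>\<^bsub>G\<^esub>" by (simp add: \<phi>_def zero_prod_def)
    then show ?case by (simp add: one)
  next
    case (Cons l u)
    then show ?case using mult[of "[l]" u] letter[of l "word_val e u"] by simp
  qed
  define f where "f A = word_val e (SOME u. A = word_class R u)" for A
  have f: "f (word_class R u) = word_val e u" for u
  proof -
    have "word_class R u = word_class R (SOME v. word_class R u = word_class R v)" by (rule someI) (rule HOL.refl)
    then have "word_eq R u (SOME v. word_class R u = word_class R v)" by (simp only: word_class_eq_iff)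
    then show ?thesis unfolding f_def using word_eq_word_val[OF R] by metis
  qed
  have fhom: "f \<in> hom G (Tw e)"
    by (rule homI) (auto simp: car mult f word_val_append)
  then have "group_hom G (Tw e) f" by (simp add: group_hom_def group_hom_axioms_def group_Tw is_group)
  then have "subgroup (f ` carrier G) (Tw e)" by (rule group_hom.img_is_subgroup)
  moreover have "letter_val l \<in> f ` carrier G" for l
  proof -
    have "letter_val l = f (word_class R [l])" by (cases "letter_val l") (simp add: f)
    then show ?thesis by (simp add: car)
  qed
  from this[of "Pos GX"] this[of "Pos GY"] this[of "Pos GZ"]
  have "((1, 0), 0) \<in> f ` carrier G" "((0, 1), 0) \<in> f ` carrier G" "(0, 1) \<in> f ` carrier G"
    by simp_all
  ultimately have "f ` carrier G = UNIV" by (rule subgroup_Tw_eq_UNIV)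
  moreover have "inj_on f (carrier G)"
    using norm f by (auto simp: inj_on_def car)
  ultimately have "f \<in> iso G (Tw e)" using fhom by (simp add: iso_def bij_betw_def)
  then show ?thesis by (rule is_isoI)
qed

lemma (in group) intertwine_inv:
  assumes "g \<in> carrier G" "p \<in> carrier G" "q \<in> carrier G" "g \<otimes> p = q \<otimes> g"
  shows "inv g \<otimes> q = p \<otimes> inv g"
proof -
  have "inv g \<otimes> q = inv g \<otimes> (q \<otimes> g) \<otimes> inv g" using assms(1-3) by (simp add: m_assoc)
  also have "\<dots> = inv g \<otimes> (g \<otimes> p) \<otimes> inv g" using assms(4) by simp
  also have "\<dots> = p \<otimes> inv g" using assms(1-3) by (simp add: m_assoc[symmetric])
  finally show ?thesis .
qed

lemma (in group) int_pow_of_inv: "x \<in> carrier G \<Longrightarrow> inv x [^] (k :: int) = x [^] (- k)"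
  by (simp add: int_pow_inv int_pow_neg)

lemma (in group) int_pow_commute:
  assumes "x \<in> carrier G" "y \<in> carrier G" "x \<otimes> y = y \<otimes> x"
  shows "y [^] (b :: int) \<otimes> x [^] (a :: int) = x [^] a \<otimes> y [^] b"
  using assms by (intro int_pow_intertwine int_pow_intertwine[symmetric]) auto

lemma (in group) intertwine_word:
  assumes c: "g \<in> carrier G" "x \<in> carrier G" "y \<in> carrier G" "p \<in> carrier G" "q \<in> carrier G"
    and "g \<otimes> x = p \<otimes> g" "g \<otimes> y = q \<otimes> g"
  shows "g \<otimes> (x [^] (a :: int) \<otimes> y [^] (b :: int)) = p [^] a \<otimes> q [^] b \<otimes> g"
proof -
  have "g \<otimes> (x [^] a \<otimes> y [^] b) = p [^] a \<otimes> g \<otimes> y [^] b"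
    using int_pow_intertwine[of g x p a] assms by (simp add: m_assoc[symmetric])
  also have "\<dots> = p [^] a \<otimes> q [^] b \<otimes> g"
    using int_pow_intertwine[of g y q b] assms by (simp add: m_assoc)
  finally show ?thesis .
qed

text \<open>These are the rules that \<open>presented_group_iso_Tw\<close> asks for with \<open>e = 1\<close>.\<close>

lemma (in group) twist_quarter:
  assumes c: "x \<in> carrier G" "y \<in> carrier G" "z \<in> carrier G" and xy: "x \<otimes> y = y \<otimes> x"
    and zx: "z \<otimes> x = y \<otimes> z" and zy: "z \<otimes> y = inv x \<otimes> z" and s: "s \<in> {1, -1 :: int}"
  shows "z [^] s \<otimes> (x [^] (a :: int) \<otimes> y [^] (b :: int)) =
    x [^] fst (rot (1 * s) (a, b)) \<otimes> y [^] snd (rot (1 * s) (a, b)) \<otimes> z [^] s"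
proof -
  have i1: "inv z \<otimes> y = x \<otimes> inv z" by (rule intertwine_inv) (use c zx in auto)
  have "inv z \<otimes> inv x = y \<otimes> inv z" by (rule intertwine_inv) (use c zy in auto)
  then have "inv z \<otimes> inv x [^] (-1 :: int) = y [^] (-1 :: int) \<otimes> inv z" using c by (intro int_pow_intertwine) auto
  then have i2: "inv z \<otimes> x = inv y \<otimes> inv z" using c by (simp add: int_pow_neg)
  have "z \<otimes> (x [^] a \<otimes> y [^] b) = y [^] a \<otimes> inv x [^] b \<otimes> z" by (rule intertwine_word) (use c zx zy in auto)
  then have p: "z \<otimes> (x [^] a \<otimes> y [^] b) = x [^] (- b) \<otimes> y [^] a \<otimes> z"
    using int_pow_commute[OF c(1,2) xy] c by (simp add: int_pow_of_inv)
  have "inv z \<otimes> (x [^] a \<otimes> y [^] b) = inv y [^] a \<otimes> x [^] b \<otimes> inv z"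
    by (rule intertwine_word) (use c i1 i2 in auto)
  then have m: "inv z \<otimes> (x [^] a \<otimes> y [^] b) = x [^] b \<otimes> y [^] (- a) \<otimes> inv z"
    using int_pow_commute[OF c(1,2) xy] c by (simp add: int_pow_of_inv)
  show ?thesis using s c p m by (auto simp: rot_def int_pow_neg)
qed

text \<open>These are the rules that \<open>presented_group_iso_Tw\<close> asks for with \<open>e = 2\<close>.\<close>

lemma (in group) twist_half:
  assumes c: "x \<in> carrier G" "y \<in> carrier G" "z \<in> carrier G"
    and zx: "z \<otimes> x = inv x \<otimes> z" and zy: "z \<otimes> y = inv y \<otimes> z" and s: "s \<in> {1, -1 :: int}"
  shows "z [^] s \<otimes> (x [^] (a :: int) \<otimes> y [^] (b :: int)) =
    x [^] fst (rot (2 * s) (a, b)) \<otimes> y [^] snd (rot (2 * s) (a, b)) \<otimes> z [^] s"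
proof -
  have i: "inv z \<otimes> w = inv w \<otimes> inv z" if w: "w \<in> carrier G" "z \<otimes> w = inv w \<otimes> z" for w
  proof -
    have "inv z \<otimes> inv w = w \<otimes> inv z" by (rule intertwine_inv) (use c w in auto)
    then have "inv z \<otimes> inv w [^] (-1 :: int) = w [^] (-1 :: int) \<otimes> inv z" using c w by (intro int_pow_intertwine) auto
    then show ?thesis using c w by (simp add: int_pow_neg)
  qed
  have p: "z \<otimes> (x [^] a \<otimes> y [^] b) = inv x [^] a \<otimes> inv y [^] b \<otimes> z"
    by (rule intertwine_word) (use c zx zy in auto)
  have m: "inv z \<otimes> (x [^] a \<otimes> y [^] b) = inv x [^] a \<otimes> inv y [^] b \<otimes> inv z"
    by (rule intertwine_word) (use c zx zy i in auto)
  show ?thesis using s c p m by (auto simp: rot_def int_pow_neg int_pow_of_inv)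
qed

lemma word_eq_conj:
  assumes "word_eq R [a, b, letter_inv a] v"
  shows "word_eq R [a, b] (v @ [a])"
proof -
  have "word_eq R ([a, b] @ [letter_inv a, a]) ([a, b] @ [])"
    using word_eq.cancel[of R "letter_inv a"] by (intro word_eq.append word_eq.refl) simp
  moreover have "word_eq R ([a, b, letter_inv a] @ [a]) (v @ [a])"
    using assms by (intro word_eq.append word_eq.refl)
  ultimately show ?thesis by simp (metis word_eq.sym word_eq.trans)
qed

lemma word_eq_commutator:
  assumes "word_eq R [a, b, letter_inv a, letter_inv b] []"
  shows "word_eq R [a, b] [b, a]"
proof -
  have "word_eq R ([a, b, letter_inv a] @ [letter_inv b, b]) ([a, b, letter_inv a] @ [])"
    using word_eq.cancel[of R "letter_inv b"] by (intro word_eq.append word_eq.refl) simp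
  moreover have "word_eq R ([a, b, letter_inv a, letter_inv b] @ [b]) ([] @ [b])"
    using assms by (intro word_eq.append word_eq.refl)
  ultimately have "word_eq R [a, b, letter_inv a] [b]" by simp (metis word_eq.sym word_eq.trans)
  then show ?thesis using word_eq_conj by fastforce
qed

lemma word_class_Neg:
  "inv\<^bsub>presented_group R\<^esub> (word_class R [Pos g]) = word_class R [Neg g]"
proof (rule group.inv_equality[OF group_presented_group])
  have "word_eq R [Neg g, Pos g] []" using word_eq.cancel[of R "Neg g"] by simp
  then show "word_class R [Neg g] \<otimes>\<^bsub>presented_group R\<^esub> word_class R [Pos g] = \<one>\<^bsub>presented_group R\<^esub>"
    by (simp add: presented_group_mult word_class_eq_iff) (simp add: presented_group_def word_class_eq_iff)
qed (auto simp: presented_group_def)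

lemma pi1_G4_iso: "pi1_G4 \<cong> Tw 1"
proof -
  define R where "R = {([Pos GX, Pos GY, Neg GX, Neg GY], []),
     ([Pos GZ, Pos GX, Neg GZ], [Pos GY]), ([Pos GZ, Pos GY, Neg GZ], [Neg GX])}"
  note rel = word_eq.relator[of _ _ R]
  have car: "word_class R u \<in> carrier (presented_group R)" for u by (simp add: presented_group_def)
  have "word_eq R [Pos GX, Pos GY] [Pos GY, Pos GX]"
    by (rule word_eq_commutator, rule rel) (simp add: R_def)
  moreover have "word_eq R [Pos GZ, Pos GX] ([Pos GY] @ [Pos GZ])"
    by (rule word_eq_conj, rule rel) (simp add: R_def)
  moreover have "word_eq R [Pos GZ, Pos GY] ([Neg GX] @ [Pos GZ])"
    by (rule word_eq_conj, rule rel) (simp add: R_def)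
  ultimately have rels:
    "word_class R [Pos GX] \<otimes>\<^bsub>presented_group R\<^esub> word_class R [Pos GY] =
      word_class R [Pos GY] \<otimes>\<^bsub>presented_group R\<^esub> word_class R [Pos GX]"
    "word_class R [Pos GZ] \<otimes>\<^bsub>presented_group R\<^esub> word_class R [Pos GX] =
      word_class R [Pos GY] \<otimes>\<^bsub>presented_group R\<^esub> word_class R [Pos GZ]"
    "word_class R [Pos GZ] \<otimes>\<^bsub>presented_group R\<^esub> word_class R [Pos GY] =
      word_class R [Neg GX] \<otimes>\<^bsub>presented_group R\<^esub> word_class R [Pos GZ]"
    by (simp_all add: presented_group_mult word_class_eq_iff)
  have val: "word_val 1 u = word_val 1 v" if "(u, v) \<in> R" for u v
    using that by (auto simp: R_def rot_def prod_eq_iff)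
  have "presented_group R \<cong> Tw 1"
    using presented_group_iso_Tw[OF val rels(1)]
      group.twist_quarter[OF group_presented_group car car car rels(1), OF rels(2,3)[folded word_class_Neg]]
    by blast
  then show ?thesis by (simp add: pi1_G4_def R_def)
qed

lemma pi1_G2_iso: "pi1_G2 \<cong> Tw 2"
proof -
  define R where "R = {([Pos GX, Pos GY, Neg GX, Neg GY], []),
     ([Pos GZ, Pos GX, Neg GZ], [Neg GX]), ([Pos GZ, Pos GY, Neg GZ], [Neg GY])}"
  note rel = word_eq.relator[of _ _ R]
  have car: "word_class R u \<in> carrier (presented_group R)" for u by (simp add: presented_group_def)
  have "word_eq R [Pos GX, Pos GY] [Pos GY, Pos GX]"
    by (rule word_eq_commutator, rule rel) (simp add: R_def)
  moreover have "word_eq R [Pos GZ, Pos GX] ([Neg GX] @ [Pos GZ])"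
    by (rule word_eq_conj, rule rel) (simp add: R_def)
  moreover have "word_eq R [Pos GZ, Pos GY] ([Neg GY] @ [Pos GZ])"
    by (rule word_eq_conj, rule rel) (simp add: R_def)
  ultimately have rels:
    "word_class R [Pos GX] \<otimes>\<^bsub>presented_group R\<^esub> word_class R [Pos GY] =
      word_class R [Pos GY] \<otimes>\<^bsub>presented_group R\<^esub> word_class R [Pos GX]"
    "word_class R [Pos GZ] \<otimes>\<^bsub>presented_group R\<^esub> word_class R [Pos GX] =
      word_class R [Neg GX] \<otimes>\<^bsub>presented_group R\<^esub> word_class R [Pos GZ]"
    "word_class R [Pos GZ] \<otimes>\<^bsub>presented_group R\<^esub> word_class R [Pos GY] =
      word_class R [Neg GY] \<otimes>\<^bsub>presented_group R\<^esub> word_class R [Pos GZ]"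
    by (simp_all add: presented_group_mult word_class_eq_iff)
  have val: "word_val 2 u = word_val 2 v" if "(u, v) \<in> R" for u v
    using that by (auto simp: R_def rot_def prod_eq_iff)
  have "presented_group R \<cong> Tw 2"
    using presented_group_iso_Tw[OF val rels(1)]
      group.twist_half[OF group_presented_group car car car, OF rels(2,3)[folded word_class_Neg]]
    by blast
  then show ?thesis by (simp add: pi1_G2_def R_def)
qed

lemma pi1_G1_iso: "pi1_G1 \<cong> Tw 4"
proof -
  let ?f = "\<lambda>(a, b, c). ((a, b), c) :: (int \<times> int) \<times> int"
  have "?f \<in> hom pi1_G1 (Tw 4)"
    by (rule homI) (auto simp: pi1_G1_def DirProd_def integer_group_def rot_id)
  moreover have "bij_betw ?f (carrier pi1_G1) (carrier (Tw 4))"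
    by (rule bij_betw_byWitness[of _ "\<lambda>((a, b), c). (a, b, c)"])
      (auto simp: pi1_G1_def DirProd_def integer_group_def)
  ultimately have "?f \<in> iso pi1_G1 (Tw 4)" by (simp add: iso_def)
  then show ?thesis by (rule is_isoI)
qed

section \<open>Distinguishing the three groups\<close>

lemma iso_squares_commute:
  assumes "G \<cong> H" and "\<And>x y. x \<in> carrier G \<Longrightarrow> y \<in> carrier G \<Longrightarrow>
      x \<otimes>\<^bsub>G\<^esub> x \<otimes>\<^bsub>G\<^esub> (y \<otimes>\<^bsub>G\<^esub> y) = y \<otimes>\<^bsub>G\<^esub> y \<otimes>\<^bsub>G\<^esub> (x \<otimes>\<^bsub>G\<^esub> x)"
    and G: "group G" and uv: "u \<in> carrier H" "v \<in> carrier H"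
  shows "u \<otimes>\<^bsub>H\<^esub> u \<otimes>\<^bsub>H\<^esub> (v \<otimes>\<^bsub>H\<^esub> v) = v \<otimes>\<^bsub>H\<^esub> v \<otimes>\<^bsub>H\<^esub> (u \<otimes>\<^bsub>H\<^esub> u)"
proof -
  interpret group G by fact
  obtain f where f: "f \<in> hom G H" "bij_betw f (carrier G) (carrier H)"
    using assms(1) by (auto simp: is_iso_def iso_def)
  obtain x y where xy: "x \<in> carrier G" "y \<in> carrier G" "u = f x" "v = f y"
    using uv bij_betw_imp_surj_on[OF f(2)] by blast
  have "f (x \<otimes>\<^bsub>G\<^esub> x \<otimes>\<^bsub>G\<^esub> (y \<otimes>\<^bsub>G\<^esub> y)) = f (y \<otimes>\<^bsub>G\<^esub> y \<otimes>\<^bsub>G\<^esub> (x \<otimes>\<^bsub>G\<^esub> x))" using assms(2) xy by simp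
  then show ?thesis using xy by (simp add: hom_mult[OF f(1)])
qed

lemma iso_commute:
  assumes "G \<cong> H" and "\<And>x y. x \<in> carrier G \<Longrightarrow> y \<in> carrier G \<Longrightarrow> x \<otimes>\<^bsub>G\<^esub> y = y \<otimes>\<^bsub>G\<^esub> x"
    and uv: "u \<in> carrier H" "v \<in> carrier H"
  shows "u \<otimes>\<^bsub>H\<^esub> v = v \<otimes>\<^bsub>H\<^esub> u"
proof -
  obtain f where f: "f \<in> hom G H" "bij_betw f (carrier G) (carrier H)"
    using assms(1) by (auto simp: is_iso_def iso_def)
  obtain x y where xy: "x \<in> carrier G" "y \<in> carrier G" "u = f x" "v = f y"
    using uv bij_betw_imp_surj_on[OF f(2)] by blast
  then show ?thesis using hom_mult[OF f(1)] assms(2) by metis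
qed

lemma Tw_4_commute: "x \<otimes>\<^bsub>Tw 4\<^esub> y = y \<otimes>\<^bsub>Tw 4\<^esub> x"
  by (cases x; cases y) (simp add: rot_id add.commute)

lemma Tw_2_squares_commute: "x \<otimes>\<^bsub>Tw 2\<^esub> x \<otimes>\<^bsub>Tw 2\<^esub> (y \<otimes>\<^bsub>Tw 2\<^esub> y) = y \<otimes>\<^bsub>Tw 2\<^esub> y \<otimes>\<^bsub>Tw 2\<^esub> (x \<otimes>\<^bsub>Tw 2\<^esub> x)"
proof -
  have "rot (2 * (j + j)) v = v" for j and v :: "int \<times> int" by (rule rot_id) presburger
  then show ?thesis by (cases x; cases y) (simp add: add.commute)
qed

text \<open>\<^term>\<open>Tw 4\<close> is commutative. \<^term>\<open>Tw 2\<close> is not, but its squares commute, because a half turn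
  applied twice is trivial. In \<^term>\<open>Tw 1\<close> the squares of \<open>(0, 1)\<close> and of a unit vector do not commute.\<close>

lemma Tw_not_iso:
  "\<not> Tw 4 \<cong> Tw 2" "\<not> Tw 4 \<cong> Tw 1" "\<not> Tw 2 \<cong> Tw 1"
proof -
  show "\<not> Tw 4 \<cong> Tw 2"
    using iso_commute[of "Tw 4" "Tw 2" "(0, 1)" "((1, 0), 0)"] Tw_4_commute by (auto simp: rot_def prod_eq_iff)
  show "\<not> Tw 4 \<cong> Tw 1"
    using iso_commute[of "Tw 4" "Tw 1" "(0, 1)" "((1, 0), 0)"] Tw_4_commute by (auto simp: rot_def prod_eq_iff)
  show "\<not> Tw 2 \<cong> Tw 1"
    using iso_squares_commute[of "Tw 2" "Tw 1" "(0, 1)" "((1, 0), 0)"] Tw_2_squares_commute group_Tw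
    by (auto simp: rot_def prod_eq_iff)
qed

section \<open>Lattices in the plane\<close>

definition add_subgroup :: "(int \<times> int) set \<Rightarrow> bool" where
  "add_subgroup L \<longleftrightarrow> 0 \<in> L \<and> (\<forall>v\<in>L. \<forall>w\<in>L. v - w \<in> L)"

lemma add_subgroup_diff: "add_subgroup L \<Longrightarrow> v \<in> L \<Longrightarrow> w \<in> L \<Longrightarrow> v - w \<in> L"
  by (simp add: add_subgroup_def)

lemma add_subgroup_0: "add_subgroup L \<Longrightarrow> 0 \<in> L"
  by (simp add: add_subgroup_def)

lemma add_subgroup_minus: "add_subgroup L \<Longrightarrow> v \<in> L \<Longrightarrow> - v \<in> L"
  using add_subgroup_diff[of L 0 v] add_subgroup_0[of L] by simp

lemma add_subgroup_add: "add_subgroup L \<Longrightarrow> v \<in> L \<Longrightarrow> w \<in> L \<Longrightarrow> v + w \<in> L"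
  using add_subgroup_diff[of L v "- w"] add_subgroup_minus[of L w] by simp

lemma add_subgroup_smul:
  assumes L: "add_subgroup L" and v: "v \<in> L"
  shows "smul c v \<in> L"
proof (induction c rule: int_induct[where k = 0])
  case base
  show ?case using add_subgroup_0[OF L] by simp
next
  case (step1 c)
  then show ?case using add_subgroup_add[OF L _ v] by (simp add: smul_add)
next
  case (step2 c)
  then show ?case using add_subgroup_diff[OF L _ v] by (simp add: smul_add)
qed

text \<open>The least positive element divides all others, by division with remainder.\<close>

lemma int_subgroup_multiples:
  fixes S :: "int set"
  assumes d: "\<And>x y. x \<in> S \<Longrightarrow> y \<in> S \<Longrightarrow> x - y \<in> S" and N: "N \<in> S" "N > 0"
  obtains a where "a > 0" "\<And>x. x \<in> S \<longleftrightarrow> a dvd x"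
proof -
  define n where "n = (LEAST n. n > 0 \<and> int n \<in> S)"
  have ex: "nat N > 0 \<and> int (nat N) \<in> S" using N by simp
  then have n: "n > 0" "int n \<in> S" unfolding n_def by (metis (mono_tags, lifting) LeastI)+
  have least: "n \<le> k" if "k > 0" "int k \<in> S" for k
    unfolding n_def using that by (intro Least_le) simp
  have 0: "0 \<in> S" using d[OF N(1) N(1)] by simp
  have mult: "int n * c \<in> S" for c
  proof (induction c rule: int_induct[where k = 0])
    case base
    show ?case using 0 by simp
  next
    case (step1 c)
    have "- int n \<in> S" using d[OF 0 n(2)] by simp
    then show ?case using d[OF step1(2), of "- int n"] by (simp add: algebra_simps)
  next
    case (step2 c)
    then show ?case using d[OF step2(2) n(2)] by (simp add: algebra_simps)
  qed
  have "x \<in> S \<longleftrightarrow> int n dvd x" for x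
  proof
    assume x: "x \<in> S"
    have "x mod int n \<in> S" using d[OF x mult[of "x div int n"]] by (simp add: minus_mult_div_eq_mod)
    moreover have "0 \<le> x mod int n" "x mod int n < int n" using n by simp_all
    ultimately have "x mod int n = 0" using least[of "nat (x mod int n)"] by force
    then show "int n dvd x" by (simp add: dvd_eq_mod_eq_0)
  qed (use mult in \<open>auto simp: dvd_def\<close>)
  then show ?thesis using that[of "int n"] n by simp
qed

text \<open>The lattice spanned by \<open>(a, 0)\<close> and \<open>(b, d)\<close>, as \<open>lat_span\<close> shows.\<close>

definition lat :: "int \<Rightarrow> int \<Rightarrow> int \<Rightarrow> (int \<times> int) set" where
  "lat a b d = {v. \<exists>j. snd v = d * j \<and> a dvd fst v - b * j}"

text \<open>The lattices of index \<open>k\<close> in the plane, by their bases in Hermite normal form.\<close>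

definition lattices :: "nat \<Rightarrow> (int \<times> int) set set" where
  "lattices k = {lat a b d | a b d. 0 < a \<and> 0 < d \<and> 0 \<le> b \<and> b < a \<and> a * d = int k}"

lemma lat_mem: "(x, y) \<in> lat a b d \<longleftrightarrow> (\<exists>j. y = d * j \<and> a dvd x - b * j)"
  by (simp add: lat_def)

lemma add_subgroup_lat: "add_subgroup (lat a b d)"
  unfolding add_subgroup_def
proof (intro conjI ballI)
  show "0 \<in> lat a b d" by (auto simp: lat_def)
  fix v w assume "v \<in> lat a b d" "w \<in> lat a b d"
  then obtain i j where "snd v = d * i" "a dvd fst v - b * i" "snd w = d * j" "a dvd fst w - b * j"
    by (auto simp: lat_def)
  then have "snd (v - w) = d * (i - j)" "a dvd fst (v - w) - b * (i - j)"
    using dvd_diff[of a "fst v - b * i" "fst w - b * j"] by (simp_all add: algebra_simps)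
  then show "v - w \<in> lat a b d" by (auto simp: lat_def)
qed

lemma lat_basis: "(a, 0) \<in> lat a b d" "(b, d) \<in> lat a b d"
proof -
  show "(a, 0) \<in> lat a b d" unfolding lat_mem by (rule exI[of _ 0]) simp
  show "(b, d) \<in> lat a b d" unfolding lat_mem by (rule exI[of _ 1]) simp
qed

lemma lat_mem_0: "0 < d \<Longrightarrow> (x, 0) \<in> lat a b d \<longleftrightarrow> a dvd x"
  by (auto simp: lat_mem)

lemma lat_mem_basis: "0 < d \<Longrightarrow> (x, d) \<in> lat a b d \<longleftrightarrow> a dvd x - b"
  by (auto simp: lat_mem)

lemma lat_span: "lat a b d = {smul i (a, 0) + smul j (b, d) | i j. True}"
proof (intro equalityI subsetI)
  fix v assume "v \<in> lat a b d"
  then obtain i j where "snd v = d * j" "fst v - b * j = a * i" by (auto simp: lat_def dvd_def)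
  then have "v = smul i (a, 0) + smul j (b, d)" by (auto simp: prod_eq_iff algebra_simps)
  then show "v \<in> {smul i (a, 0) + smul j (b, d) | i j. True}" by blast
qed (auto intro!: add_subgroup_add[OF add_subgroup_lat] add_subgroup_smul[OF add_subgroup_lat] lat_basis simp del: smul_simps)

lemma lat_inject:
  assumes "0 < a" "0 < d" "0 \<le> b" "b < a" "0 < a'" "0 < d'" "0 \<le> b'" "b' < a'" and e: "lat a b d = lat a' b' d'"
  shows "a = a' \<and> b = b' \<and> d = d'"
proof -
  have "(a, 0) \<in> lat a' b' d'" "(a', 0) \<in> lat a b d" "(b, d) \<in> lat a' b' d'" "(b', d') \<in> lat a b d"
    using lat_basis(1)[of a b d] lat_basis(2)[of b d a] lat_basis(1)[of a' b' d'] lat_basis(2)[of b' d' a']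
    by (simp_all only: e)
  note m = this
  have "a' dvd a" "a dvd a'" using m(1,2) lat_mem_0 assms(2,6) by blast+
  moreover have "d' dvd d" "d dvd d'" using m(3,4) unfolding lat_mem dvd_def by blast+
  ultimately have *: "a = a'" "d = d'" using assms by (auto intro: zdvd_antisym_nonneg)
  have "(b, d) \<in> lat a b' d" using lat_basis(2)[of b d a] e * by simp
  then have "a dvd b - b'" using lat_mem_basis[OF assms(2)] by simp
  moreover have "\<bar>b - b'\<bar> < a" using assms * by auto
  ultimately have "b = b'" using zdvd_imp_le[of a "\<bar>b - b'\<bar>"] by fastforce
  with * show ?thesis by simp
qed

lemma lattices_disjoint: "L \<in> lattices k \<Longrightarrow> L \<in> lattices k' \<Longrightarrow> k = k'"
proof -
  assume "L \<in> lattices k" "L \<in> lattices k'"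
  then obtain a b d a' b' d' where L: "L = lat a b d" "0 < a" "0 < d" "0 \<le> b" "b < a" "a * d = int k"
    and L': "L = lat a' b' d'" "0 < a'" "0 < d'" "0 \<le> b'" "b' < a'" "a' * d' = int k'"
    unfolding lattices_def by blast
  then have "a = a' \<and> b = b' \<and> d = d'" by (intro lat_inject) auto
  then show ?thesis using L L' by simp
qed

lemma lattices_add_subgroup: "L \<in> lattices k \<Longrightarrow> add_subgroup L"
  by (auto simp: lattices_def add_subgroup_lat)

lemma lattices_pos: "L \<in> lattices k \<Longrightarrow> 0 < k"
proof -
  assume "L \<in> lattices k"
  then obtain a d where "0 < a" "0 < d" "a * d = int k" by (auto simp: lattices_def)
  then show ?thesis by (metis of_nat_0_less_iff zero_less_mult_iff)
qed

text \<open>The vectors of \<open>L\<close> on the first axis are the multiples of some \<open>(a, 0)\<close>, and the second coordinates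
  of vectors of \<open>L\<close> are the multiples of some \<open>d\<close>. A vector of \<open>L\<close> with second coordinate \<open>d\<close>, reduced
  modulo \<open>(a, 0)\<close>, completes the normal form.\<close>

lemma add_subgroup_lattice:
  assumes L: "add_subgroup L" and "(N, 0) \<in> L" "N > 0" "(0, M) \<in> L" "M > 0"
  obtains k where "L \<in> lattices k"
proof -
  obtain a where a: "a > 0" "\<And>x. (x, 0) \<in> L \<longleftrightarrow> a dvd x"
  proof (rule int_subgroup_multiples[of "{x. (x, 0) \<in> L}" N])
    show "x - y \<in> {x. (x, 0) \<in> L}" if "x \<in> {x. (x, 0) \<in> L}" "y \<in> {x. (x, 0) \<in> L}" for x y
      using add_subgroup_diff[OF L, of "(x, 0)" "(y, 0)"] that by simp
  qed (use assms in auto)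
  obtain d where d: "d > 0" "\<And>y. (\<exists>x. (x, y) \<in> L) \<longleftrightarrow> d dvd y"
  proof (rule int_subgroup_multiples[of "{y. \<exists>x. (x, y) \<in> L}" M])
    show "y - z \<in> {y. \<exists>x. (x, y) \<in> L}" if yz: "y \<in> {y. \<exists>x. (x, y) \<in> L}" "z \<in> {y. \<exists>x. (x, y) \<in> L}" for y z
    proof -
      obtain p q where "(p, y) \<in> L" "(q, z) \<in> L" using yz by blast
      then have "(p - q, y - z) \<in> L" using add_subgroup_diff[OF L, of "(p, y)" "(q, z)"] by simp
      then show ?thesis by blast
    qed
  qed (use assms in auto)
  obtain b0 where b0: "(b0, d) \<in> L" using d(2)[of d] by auto
  define b where "b = b0 mod a"
  have b: "0 \<le> b" "b < a" using a(1) by (simp_all add: b_def)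
  have "(b0 - b, 0) \<in> L" using a(2) by (simp add: b_def)
  then have bd: "(b, d) \<in> L" using add_subgroup_diff[OF L b0, of "(b0 - b, 0)"] by simp
  have "v \<in> L \<longleftrightarrow> v \<in> lat a b d" for v
  proof -
    obtain x y where v: "v = (x, y)" by force
    have "(x, d * j) \<in> L \<longleftrightarrow> a dvd x - b * j" for j
    proof -
      have j: "(b * j, d * j) \<in> L" using add_subgroup_smul[OF L bd, of j] by (simp add: mult.commute)
      have "(x, d * j) \<in> L \<longleftrightarrow> (x - b * j, 0) \<in> L"
        using add_subgroup_diff[OF L _ j, of "(x, d * j)"] add_subgroup_add[OF L _ j, of "(x - b * j, 0)"] by auto
      then show ?thesis using a(2) by simp
    qed
    moreover have "\<exists>j. y = d * j" if "(x, y) \<in> L" using d(2)[of y] that by (auto simp: dvd_def)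
    ultimately show ?thesis unfolding v lat_mem by blast
  qed
  then have "L = lat a b d" by blast
  then have "L \<in> lattices (nat (a * d))" using a(1) d(1) b
    unfolding lattices_def mem_Collect_eq by (intro exI[of _ a] exI[of _ b] exI[of _ d]) simp
  then show ?thesis by (rule that)
qed

section \<open>Ideals of Gaussian integers\<close>

text \<open>A pair \<open>(x, y)\<close> is read as the Gaussian integer \<open>x + i y\<close>, so that \<^term>\<open>rot 1\<close> is multiplication
  by \<open>i\<close>. The following are the norm, the product and the principal ideals.\<close>

definition gauss_norm :: "int \<times> int \<Rightarrow> int" where "gauss_norm v = (fst v)\<^sup>2 + (snd v)\<^sup>2"

definition gauss_mul :: "int \<times> int \<Rightarrow> int \<times> int \<Rightarrow> int \<times> int" where
  "gauss_mul q v = smul (fst q) v + smul (snd q) (rot 1 v)"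

lemma gauss_mul_simp: "gauss_mul (x, y) (s, t) = (x * s - y * t, x * t + y * s)"
  by (simp add: gauss_mul_def rot_def)

lemma gauss_norm_gauss_mul: "gauss_norm (gauss_mul q v) = gauss_norm q * gauss_norm v"
  by (cases q; cases v) (simp add: gauss_mul_simp gauss_norm_def power2_eq_square algebra_simps)

lemma gauss_norm_nonneg: "0 \<le> gauss_norm v" by (simp add: gauss_norm_def)

lemma gauss_norm_eq_0: "gauss_norm v = 0 \<longleftrightarrow> v = 0"
  by (auto simp: gauss_norm_def prod_eq_iff sum_power2_eq_zero_iff)

definition gauss_ideal :: "int \<times> int \<Rightarrow> (int \<times> int) set" where
  "gauss_ideal v = range (\<lambda>q. gauss_mul q v)"

lemma gauss_mul_add: "gauss_mul (p + q) v = gauss_mul p v + gauss_mul q v" "gauss_mul (p - q) v = gauss_mul p v - gauss_mul q v"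
  by (simp_all add: gauss_mul_def smul_add)

lemma gauss_mul_assoc: "gauss_mul p (gauss_mul q v) = gauss_mul (gauss_mul p q) v"
  by (cases p; cases q; cases v) (simp add: gauss_mul_simp algebra_simps)

lemma gauss_mul_rot: "rot 1 (gauss_mul q v) = gauss_mul (rot 1 q) v"
  by (cases q; cases v) (simp add: gauss_mul_simp rot_def algebra_simps)

lemma gauss_mul_1 [simp]: "gauss_mul (1, 0) v = v" by (simp add: gauss_mul_def)

lemma gauss_ideal_add_subgroup: "add_subgroup (gauss_ideal v)"
proof -
  have "gauss_mul 0 v = 0" by (simp add: gauss_mul_def)
  then have "0 \<in> gauss_ideal v" unfolding gauss_ideal_def by (intro image_eqI[of _ _ 0]) auto
  moreover have "gauss_mul p v - gauss_mul q v \<in> gauss_ideal v" for p q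
    unfolding gauss_mul_add(2)[symmetric] by (simp add: gauss_ideal_def)
  ultimately show ?thesis by (auto simp: add_subgroup_def gauss_ideal_def)
qed

lemma gauss_ideal_self: "v \<in> gauss_ideal v"
  using rangeI[of "\<lambda>q. gauss_mul q v" "(1, 0)"] by (simp add: gauss_ideal_def)

lemma gauss_ideal_rot: "w \<in> gauss_ideal v \<Longrightarrow> rot 1 w \<in> gauss_ideal v"
  by (auto simp: gauss_ideal_def gauss_mul_rot)

text \<open>The vectors \<open>v\<close> and \<open>i v\<close> and the basis in normal form are integral combinations of each other, so
  their determinants \<^term>\<open>gauss_norm v\<close> and \<open>a * d\<close> divide each other.\<close>

lemma gauss_ideal_lattice:
  assumes v: "v \<noteq> 0"
  shows "gauss_ideal v \<in> lattices (nat (gauss_norm v))"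
proof -
  obtain s t where st: "v = (s, t)" by force
  have pos: "gauss_norm v > 0" using v gauss_norm_eq_0[of v] gauss_norm_nonneg[of v] by linarith
  have "(gauss_norm v, 0) = gauss_mul (s, - t) v" by (simp add: st gauss_mul_simp gauss_norm_def power2_eq_square)
  then have 1: "(gauss_norm v, 0) \<in> gauss_ideal v" by (auto simp: gauss_ideal_def)
  have "(0, gauss_norm v) = gauss_mul (t, s) v" by (simp add: st gauss_mul_simp gauss_norm_def power2_eq_square)
  then have 2: "(0, gauss_norm v) \<in> gauss_ideal v" by (auto simp: gauss_ideal_def)
  obtain k where k: "gauss_ideal v \<in> lattices k" using add_subgroup_lattice[OF gauss_ideal_add_subgroup 1 pos 2 pos] by blast
  then obtain a b d where L: "gauss_ideal v = lat a b d" "0 < a" "0 < d" "a * d = int k" by (auto simp: lattices_def)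
  have "(a, 0) \<in> gauss_ideal v" "(b, d) \<in> gauss_ideal v" using lat_basis L(1) by auto
  then obtain x y x' y' where "(a, 0) = gauss_mul (x, y) v" "(b, d) = gauss_mul (x', y') v"
    by (auto simp: gauss_ideal_def)
  then have "a = x * s - y * t" "0 = x * t + y * s" "d = x' * t + y' * s" "b = x' * s - y' * t"
    by (auto simp: st gauss_mul_simp)
  then have "a * d = (x * s - y * t) * (x' * t + y' * s) - (x * t + y * s) * (x' * s - y' * t)" by simp
  also have "\<dots> = (x * y' - x' * y) * gauss_norm v"
    by (simp add: st gauss_norm_def power2_eq_square algebra_simps)
  finally have d1: "gauss_norm v dvd a * d" by simp
  have "v \<in> lat a b d" "rot 1 v \<in> lat a b d" using L(1) gauss_ideal_self gauss_ideal_rot by blast+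
  then obtain p q p' q' where "v = smul p (a, 0) + smul q (b, d)" "rot 1 v = smul p' (a, 0) + smul q' (b, d)"
    unfolding lat_span by blast
  then have "s = p * a + q * b" "t = q * d" "- t = p' * a + q' * b" "s = q' * d"
    by (auto simp: st rot_def)
  then have "s * s - (- t) * t = (p * a + q * b) * (q' * d) - (p' * a + q' * b) * (q * d)" by simp
  then have "gauss_norm v = (p * q' - p' * q) * (a * d)"
    by (simp add: st gauss_norm_def power2_eq_square algebra_simps)
  then have "a * d dvd gauss_norm v" by simp
  then have "a * d = gauss_norm v" using d1 L pos by (intro zdvd_antisym_nonneg) auto
  then have "nat (gauss_norm v) = k" using L(4) by simp
  then show ?thesis using k by simp
qed

text \<open>The exact quotient of \<open>w\<close> by \<open>v\<close> is \<open>(A + i B) / n\<close>. Rounding both parts to integers leaves an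
  error of norm at most \<open>1 / 2\<close>.\<close>

lemma gauss_division:
  assumes v: "v \<noteq> 0"
  shows "\<exists>q. gauss_norm (w - gauss_mul q v) < gauss_norm v"
proof -
  obtain s t where st: "v = (s, t)" by force
  obtain b c where bc: "w = (b, c)" by force
  define n where "n = gauss_norm v"
  have n: "n > 0" using v gauss_norm_eq_0[of v] gauss_norm_nonneg[of v] unfolding n_def by linarith
  define A where "A = b * s + c * t"
  define B where "B = c * s - b * t"
  have round: "\<exists>x. \<bar>2 * (A - x * n)\<bar> \<le> n" for A
  proof
    define x where "x = (2 * A + n) div (2 * n)"
    define r where "r = (2 * A + n) mod (2 * n)"
    have "2 * A + n = 2 * n * x + r" by (simp add: x_def r_def)
    moreover have "0 \<le> r" "r < 2 * n" using n by (simp_all add: r_def)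
    ultimately show "\<bar>2 * (A - x * n)\<bar> \<le> n" by (simp add: algebra_simps abs_le_iff)
  qed
  obtain x y where x: "\<bar>2 * (A - x * n)\<bar> \<le> n" and y: "\<bar>2 * (B - y * n)\<bar> \<le> n" using round by metis
  have sq: "4 * (z * z) \<le> n * n" if "\<bar>2 * z\<bar> \<le> n" for z :: int
  proof -
    have "\<bar>2 * z\<bar> * \<bar>2 * z\<bar> \<le> n * n" using that n by (intro mult_mono) auto
    then show ?thesis by (simp add: abs_mult_self_eq)
  qed
  have "n * gauss_norm (w - gauss_mul (x, y) v) = (A - x * n) * (A - x * n) + (B - y * n) * (B - y * n)"
    unfolding A_def B_def n_def st bc by (simp add: gauss_mul_simp gauss_norm_def power2_eq_square algebra_simps)
  then have "4 * (n * gauss_norm (w - gauss_mul (x, y) v)) \<le> 2 * (n * n)" using sq[OF x] sq[OF y] by linarith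
  also have "\<dots> < 4 * (n * n)" using n by simp
  finally have "gauss_norm (w - gauss_mul (x, y) v) < n" using n by simp
  then show ?thesis unfolding n_def by blast
qed

text \<open>A nonzero element of least norm generates, by division with remainder.\<close>

lemma ideal_principal:
  assumes L: "L \<in> lattices k" and r: "\<And>v. v \<in> L \<Longrightarrow> rot 1 v \<in> L"
  obtains v where "v \<noteq> 0" "L = gauss_ideal v"
proof -
  have A: "add_subgroup L" using L by (rule lattices_add_subgroup)
  obtain a b d where ab: "L = lat a b d" "0 < a" using L by (auto simp: lattices_def)
  have "(a, 0) \<in> L" "(a, 0) \<noteq> 0" using lat_basis ab by (auto simp: zero_prod_def)
  then obtain v where v: "v \<in> L \<and> v \<noteq> 0"
    and m: "\<forall>w. w \<in> L \<and> w \<noteq> 0 \<longrightarrow> nat (gauss_norm v) \<le> nat (gauss_norm w)"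
    using ex_has_least_nat[of "\<lambda>v. v \<in> L \<and> v \<noteq> 0" "(a, 0)" "\<lambda>v. nat (gauss_norm v)"] by blast
  then have v: "v \<in> L" "v \<noteq> 0" by auto
  have least: "gauss_norm v \<le> gauss_norm w" if "w \<in> L" "w \<noteq> 0" for w
  proof -
    have "nat (gauss_norm v) \<le> nat (gauss_norm w)" using m that by blast
    then show ?thesis using gauss_norm_nonneg[of w] by (simp add: nat_le_eq_zle)
  qed
  have sub: "gauss_mul q v \<in> L" for q
    unfolding gauss_mul_def using v(1) r by (intro add_subgroup_add[OF A] add_subgroup_smul[OF A]) auto
  have "w \<in> gauss_ideal v" if w: "w \<in> L" for w
  proof -
    obtain q where q: "gauss_norm (w - gauss_mul q v) < gauss_norm v" using gauss_division[OF v(2)] by blast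
    have "w - gauss_mul q v \<in> L" using add_subgroup_diff[OF A w sub] .
    then have "w = gauss_mul q v" using least q by fastforce
    then show ?thesis by (simp add: gauss_ideal_def)
  qed
  then have "L = gauss_ideal v" using sub by (auto simp: gauss_ideal_def)
  then show ?thesis using that v by blast
qed

section \<open>Subgroups of finite index\<close>

definition slice :: "((int \<times> int) \<times> int) set \<Rightarrow> int \<Rightarrow> (int \<times> int) set" where
  "slice H j = {v. (v, j) \<in> H}"

text \<open>The subgroups that project onto the multiples of \<open>m\<close> and meet the plane in a lattice of index
  \<open>k\<close>. Every subgroup of finite index is of this kind (\<open>finite_index_subs\<close>), with index \<open>m * k\<close>
  (\<open>subs_index\<close>).\<close>

definition subs :: "nat \<Rightarrow> nat \<Rightarrow> ((int \<times> int) \<times> int) set set" where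
  "subs m k = {H. subgroup H (Tw 1) \<and> (\<exists>u. (u, int m) \<in> H) \<and> (\<forall>v j. (v, j) \<in> H \<longrightarrow> int m dvd j) \<and>
     slice H 0 \<in> lattices k}"

lemma subgroup_TwD:
  assumes H: "subgroup H (Tw e)"
  shows "(0, 0) \<in> H" "(v, j) \<in> H \<Longrightarrow> (w, k) \<in> H \<Longrightarrow> (v + rot (e * j) w, j + k) \<in> H"
    "(v, j) \<in> H \<Longrightarrow> (- rot (- (e * j)) v, - j) \<in> H"
    "(v, j) \<in> H \<Longrightarrow> (w, j) \<in> H \<Longrightarrow> (v - w, 0) \<in> H"
    "(v, 0) \<in> H \<Longrightarrow> (w, j) \<in> H \<Longrightarrow> (v + w, j) \<in> H"
proof -
  show "(0, 0) \<in> H" using subgroup.one_closed[OF H] by simp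
  show m: "(v, j) \<in> H \<Longrightarrow> (w, k) \<in> H \<Longrightarrow> (v + rot (e * j) w, j + k) \<in> H" for v j w k
    using subgroup.m_closed[OF H, of "(v, j)" "(w, k)"] by simp
  show i: "(v, j) \<in> H \<Longrightarrow> (- rot (- (e * j)) v, - j) \<in> H" for v j
    using subgroup.m_inv_closed[OF H, of "(v, j)"] by simp
  show "(v, j) \<in> H \<Longrightarrow> (w, j) \<in> H \<Longrightarrow> (v - w, 0) \<in> H"
    using m[of v j "- rot (- (e * j)) w" "- j"] i[of w j] by simp
  show "(v, 0) \<in> H \<Longrightarrow> (w, j) \<in> H \<Longrightarrow> (v + w, j) \<in> H"
    using m[of v 0 w j] by simp
qed

lemma slice_add_subgroup: "subgroup H (Tw e) \<Longrightarrow> add_subgroup (slice H 0)"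
  unfolding add_subgroup_def slice_def using subgroup_TwD by fastforce

text \<open>Conjugation by \<open>(u, m)\<close> turns the plane part of \<open>H\<close> by \<open>e * m\<close> quarter turns.\<close>

lemma slice_rot:
  assumes H: "subgroup H (Tw e)" and u: "(u, m) \<in> H" and v: "v \<in> slice H 0"
  shows "rot (e * m) v \<in> slice H 0"
proof -
  have "(u + rot (e * m) v, m) \<in> H" using subgroup_TwD(2)[OF H u, of v 0] v by (simp add: slice_def)
  then show ?thesis using subgroup_TwD(4)[OF H _ u] by (fastforce simp: slice_def)
qed

text \<open>Among the powers of any element two lie in the same coset, so \<open>H\<close> contains a nontrivial power of
  each of the three generators. Hence its plane part is a lattice and its projection is nonzero.\<close>

lemma finite_index_subs:
  assumes H: "subgroup H (Tw 1)" and fin: "finite (rcosets\<^bsub>Tw 1\<^esub> H)"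
  obtains m k where "0 < m" "H \<in> subs m k"
proof -
  have pig: "\<exists>i j. i < j \<and> (\<exists>h\<in>H. f j = h \<otimes>\<^bsub>Tw 1\<^esub> f i)" for f :: "nat \<Rightarrow> (int \<times> int) \<times> int"
  proof -
    let ?g = "\<lambda>i. H #>\<^bsub>Tw 1\<^esub> f i"
    have "range ?g \<subseteq> rcosets\<^bsub>Tw 1\<^esub> H" by (auto simp: RCOSETS_def)
    then have "\<not> inj ?g" using fin finite_subset range_inj_infinite by blast
    then obtain i j where ij: "i \<noteq> j" "?g i = ?g j" by (auto simp: inj_def)
    have "\<exists>h\<in>H. f j = h \<otimes>\<^bsub>Tw 1\<^esub> f i" "\<exists>h\<in>H. f i = h \<otimes>\<^bsub>Tw 1\<^esub> f j"
      using rcoset_eq_iff[OF group_Tw H, of "f i" "f j"] rcoset_eq_iff[OF group_Tw H, of "f j" "f i"] ij(2) by auto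
    then show ?thesis using ij(1) by (metis linorder_neqE_nat)
  qed
  obtain N where N: "N > 0" "((N, 0), 0) \<in> H"
  proof -
    obtain i j h where h: "i < j" "h \<in> H" "((int j, 0), 0) = h \<otimes>\<^bsub>Tw 1\<^esub> ((int i, 0), 0)"
      using pig[of "\<lambda>i. ((int i, 0), 0)"] by blast
    obtain a b c where "h = ((a, b), c)" by (metis surj_pair)
    with h have "h = ((int j - int i, 0), 0)" by (auto)
    then show ?thesis using that[of "int j - int i"] h by simp
  qed
  obtain M where M: "M > 0" "((0, M), 0) \<in> H"
  proof -
    obtain i j h where h: "i < j" "h \<in> H" "((0, int j), 0) = h \<otimes>\<^bsub>Tw 1\<^esub> ((0, int i), 0)"
      using pig[of "\<lambda>i. ((0, int i), 0)"] by blast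
    obtain a b c where "h = ((a, b), c)" by (metis surj_pair)
    with h have "h = ((0, int j - int i), 0)" by (auto)
    then show ?thesis using that[of "int j - int i"] h by simp
  qed
  obtain P v where P: "P > 0" "(v, P) \<in> H"
  proof -
    obtain i j h where h: "i < j" "h \<in> H" "(0, int j) = h \<otimes>\<^bsub>Tw 1\<^esub> (0, int i)"
      using pig[of "\<lambda>i. (0, int i)"] by blast
    then have "h = (0, int j - int i)" by (cases h) auto
    then show ?thesis using that[of "int j - int i"] h by simp
  qed
  obtain k where k: "slice H 0 \<in> lattices k"
    using add_subgroup_lattice[OF slice_add_subgroup[OF H], of N M] N M by (auto simp: slice_def)
  obtain m where m: "m > 0" "\<And>j. (\<exists>v. (v, j) \<in> H) \<longleftrightarrow> m dvd j"
  proof (rule int_subgroup_multiples[of "{j. \<exists>v. (v, j) \<in> H}" P])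
    show "i - j \<in> {j. \<exists>v. (v, j) \<in> H}" if ij: "i \<in> {j. \<exists>v. (v, j) \<in> H}" "j \<in> {j. \<exists>v. (v, j) \<in> H}" for i j
    proof -
      obtain v w where "(v, i) \<in> H" "(w, j) \<in> H" using ij by blast
      then have "(v + rot i (- rot (- j) w), i - j) \<in> H"
        using subgroup_TwD(2)[OF H, of v i "- rot (- j) w" "- j"] subgroup_TwD(3)[OF H, of w j] by simp
      then show ?thesis by blast
    qed
    show "P \<in> {j. \<exists>v. (v, j) \<in> H}" using P(2) by blast
  qed (use P(1) in auto)
  have "H \<in> subs (nat m) k" unfolding subs_def using H k m by auto
  then show ?thesis using that[of "nat m" k] m by simp
qed

text \<open>A normal form of vectors modulo \<^term>\<open>lat a b d\<close>: a multiple of \<open>(b, d)\<close> reduces the second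
  coordinate modulo \<open>d\<close>, then the first is reduced modulo \<open>a\<close>. The reduced second coordinate comes
  first in the result.\<close>

definition lat_res :: "int \<Rightarrow> int \<Rightarrow> int \<Rightarrow> int \<times> int \<Rightarrow> int \<times> int" where
  "lat_res a b d v = (snd v mod d, (fst v - b * (snd v div d)) mod a)"

lemma lat_res_eq:
  assumes "0 < a" "0 < d"
  shows "lat_res a b d v = lat_res a b d w \<longleftrightarrow> v - w \<in> lat a b d"
proof
  assume e: "lat_res a b d v = lat_res a b d w"
  define j where "j = snd v div d - snd w div d"
  have "snd v mod d = snd w mod d" using e by (simp add: lat_res_def)
  then have "snd v - snd w = d * (snd v div d) - d * (snd w div d)"
    using mult_div_mod_eq[of d "snd v"] mult_div_mod_eq[of d "snd w"] by linarith
  then have "snd (v - w) = d * j" by (simp add: j_def right_diff_distrib)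
  moreover have "a dvd (fst v - b * (snd v div d)) - (fst w - b * (snd w div d))"
    using e by (simp add: lat_res_def mod_eq_dvd_iff)
  then have "a dvd fst (v - w) - b * j" by (simp add: j_def algebra_simps)
  ultimately show "v - w \<in> lat a b d" by (auto simp: lat_def)
next
  assume "v - w \<in> lat a b d"
  then obtain j where j: "snd v = d * j + snd w" "a dvd fst v - fst w - b * j" by (auto simp: lat_def algebra_simps)
  then have "snd v mod d = snd w mod d" "snd v div d = j + snd w div d" using assms by simp_all
  moreover have "(fst v - b * (j + snd w div d)) mod a = (fst w - b * (snd w div d)) mod a"
    using j(2) by (simp add: mod_eq_dvd_iff algebra_simps)
  ultimately show "lat_res a b d v = lat_res a b d w" by (simp add: lat_res_def)
qed

lemma lat_res_fixed: "0 \<le> x \<Longrightarrow> x < a \<Longrightarrow> 0 \<le> y \<Longrightarrow> y < d \<Longrightarrow> lat_res a b d (x, y) = (y, x)"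
  by (simp add: lat_res_def)

lemma lat_res_range:
  assumes "0 < a" "0 < d" shows "range (lat_res a b d) = {0..<d} \<times> {0..<a}"
proof (intro equalityI subsetI)
  fix z assume "z \<in> {0..<d} \<times> {0..<a}"
  then have "z = lat_res a b d (snd z, fst z)" by (cases z) (simp add: lat_res_fixed)
  then show "z \<in> range (lat_res a b d)" by blast
qed (use assms in \<open>auto simp: lat_res_def\<close>)

text \<open>Every coset of \<open>H\<close> has elements at exactly one height from 0 to \<open>m - 1\<close>, and these form one class
  of vectors modulo the lattice of \<open>H\<close>.\<close>

lemma subs_index:
  assumes H: "H \<in> subs m k" and m: "0 < m"
  shows "finite (rcosets\<^bsub>Tw 1\<^esub> H) \<and> card (rcosets\<^bsub>Tw 1\<^esub> H) = m * k"
proof -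
  have s: "subgroup H (Tw 1)" and dv: "\<And>v j. (v, j) \<in> H \<Longrightarrow> int m dvd j" using H by (auto simp: subs_def)
  obtain u where u: "(u, int m) \<in> H" using H by (auto simp: subs_def)
  obtain a b d where L: "slice H 0 = lat a b d" "0 < a" "0 < d" "a * d = int k"
    using H by (auto simp: subs_def lattices_def)
  let ?A = "{0..<int m} \<times> (UNIV :: (int \<times> int) set)"
  let ?f = "\<lambda>(r, v). H #>\<^bsub>Tw 1\<^esub> (v, r)" and ?g = "\<lambda>(r, v). (r, lat_res a b d v)"
  have eq: "?f x = ?f y \<longleftrightarrow> ?g x = ?g y" if xy: "x \<in> ?A" "y \<in> ?A" for x y
  proof -
    obtain r v where ex: "x = (r, v)" by (cases x)
    obtain r' v' where ey: "y = (r', v')" by (cases y)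
    note e = ex ey
    have "?f x = ?f y \<longleftrightarrow> (\<exists>h\<in>H. (v', r') = h \<otimes>\<^bsub>Tw 1\<^esub> (v, r))"
      using rcoset_eq_iff[OF group_Tw s, of "(v, r)" "(v', r')"] by (simp add: e)
    also have "\<dots> \<longleftrightarrow> r = r' \<and> v' - v \<in> slice H 0"
    proof
      assume "\<exists>h\<in>H. (v', r') = h \<otimes>\<^bsub>Tw 1\<^esub> (v, r)"
      then obtain w j where h: "(w, j) \<in> H" "v' = w + rot j v" "r' = j + r" by force
      have "int m dvd r' - r" using dv[OF h(1)] h(3) by simp
      moreover have "\<bar>r' - r\<bar> < int m" using xy e by auto
      ultimately have "r' = r" using zdvd_imp_le[of "int m" "\<bar>r' - r\<bar>"] by fastforce
      then show "r = r' \<and> v' - v \<in> slice H 0" using h by (auto simp: slice_def)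
    next
      assume "r = r' \<and> v' - v \<in> slice H 0"
      then show "\<exists>h\<in>H. (v', r') = h \<otimes>\<^bsub>Tw 1\<^esub> (v, r)"
        by (intro bexI[of _ "(v' - v, 0)"]) (auto simp: slice_def)
    qed
    also have "\<dots> \<longleftrightarrow> ?g x = ?g y" using lat_res_eq[OF L(2,3), of b v' v] by (auto simp: e L(1))
    finally show ?thesis .
  qed
  obtain h where h: "bij_betw h (?f ` ?A) (?g ` ?A)" using bij_betw_images[OF eq] .
  have "?f ` ?A = rcosets\<^bsub>Tw 1\<^esub> H"
  proof (intro equalityI subsetI)
    fix C assume "C \<in> rcosets\<^bsub>Tw 1\<^esub> H"
    then obtain v j where C: "C = H #>\<^bsub>Tw 1\<^esub> (v, j)" by (auto simp: RCOSETS_def)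
    obtain w where w: "(w, int m * - (j div int m)) \<in> H" by (rule subgroup_Tw_pow[OF s u])
    have "(w + rot (int m * - (j div int m)) v, j mod int m) = (w, int m * - (j div int m)) \<otimes>\<^bsub>Tw 1\<^esub> (v, j)"
      by (simp add: minus_mult_div_eq_mod[symmetric])
    then have "\<exists>h\<in>H. (w + rot (int m * - (j div int m)) v, j mod int m) = h \<otimes>\<^bsub>Tw 1\<^esub> (v, j)"
      using w by blast
    then have "C = H #>\<^bsub>Tw 1\<^esub> (w + rot (int m * - (j div int m)) v, j mod int m)"
      unfolding C by (subst rcoset_eq_iff[OF group_Tw s]) simp_all
    then have "C = ?f (j mod int m, w + rot (int m * - (j div int m)) v)" by simp
    then show "C \<in> ?f ` ?A" by (rule image_eqI) (use m in simp)
  qed (auto simp: RCOSETS_def)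
  moreover have "?g ` ?A = {0..<int m} \<times> {0..<d} \<times> {0..<a}"
    using image_paired_Times[of "\<lambda>r. r" "lat_res a b d" "{0..<int m}" UNIV] lat_res_range[OF L(2,3), of b]
    by simp
  moreover have "card ({0..<int m} \<times> {0..<d} \<times> {0..<a}) = m * k"
  proof -
    have "nat a * nat d = k" using nat_mult_distrib[of a d] L by simp
    then show ?thesis by (simp add: card_cartesian_product mult.commute)
  qed
  ultimately show ?thesis using bij_betw_finite[OF h] bij_betw_same_card[OF h] by simp
qed

section \<open>Subgroups with a given lattice and height\<close>

text \<open>Elements of \<^const>\<open>Tw\<close> are nested pairs; quantifiers over them are kept unsplit.\<close>

declare split_paired_All [simp del] split_paired_Ex [simp del]

text \<open>Both groups contain the powers of \<open>(u, m)\<close>, and every element of either differs from one of these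
  powers by a vector of the common lattice.\<close>

lemma slice_unique:
  assumes H: "H \<in> subs m k" and H': "H' \<in> subs m k" and s: "slice H 0 = slice H' 0"
    and u: "(u, int m) \<in> H" "(u, int m) \<in> H'"
  shows "H = H'"
proof -
  have sub: "H1 \<subseteq> H2" if H1: "H1 \<in> subs m k" and H2: "H2 \<in> subs m k" and s: "slice H1 0 = slice H2 0"
    and u: "(u, int m) \<in> H1" "(u, int m) \<in> H2" for H1 H2
  proof
    fix h assume h: "h \<in> H1"
    obtain v j where vj: "h = (v, j)" by (cases h)
    have g: "subgroup H1 (Tw 1)" "subgroup H2 (Tw 1)" using H1 H2 by (auto simp: subs_def)
    have "int m dvd j" using H1 h vj by (auto simp: subs_def)
    then obtain c where c: "j = int m * c" by (auto simp: dvd_def)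
    have i: "subgroup (H1 \<inter> H2) (Tw 1)" by (rule group.subgroups_Inter_pair[OF group_Tw g])
    obtain w where w: "(w, int m * c) \<in> H1 \<inter> H2"
      by (rule subgroup_Tw_pow[OF i, of u "int m" c]) (use u in auto)
    have "v - w \<in> slice H1 0" using subgroup_TwD(4)[OF g(1)] h w by (auto simp: slice_def vj c)
    then have "(v - w, 0) \<in> H2" using s by (auto simp: slice_def)
    then have "(v - w + w, j) \<in> H2" using subgroup_TwD(5)[OF g(2)] w c by blast
    then show "h \<in> H2" by (simp add: vj)
  qed
  show ?thesis using sub[OF H H' s u] sub[OF H' H s[symmetric] u(2,1)] by blast
qed

text \<open>As \<^const>\<open>rot\<close> has period four, negative \<open>c\<close> reduce to nonnegative ones.\<close>

lemma rot_multiple_closed: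
  assumes r: "\<And>v. v \<in> L \<Longrightarrow> rot m v \<in> L" and v: "v \<in> L"
  shows "rot (m * c) v \<in> L"
proof -
  have nat: "rot (m * int n) v \<in> L" for n
  proof (induction n)
    case (Suc n)
    then show ?case using r[OF Suc] by (simp add: rot_add[symmetric] algebra_simps)
  qed (use v in simp)
  have "rot (m * c) v = rot (m * (c mod 4)) v"
  proof -
    have "m * c = m * (c mod 4) + 4 * (m * (c div 4))"
    proof -
      have "m * (4 * (c div 4) + c mod 4) = m * (c mod 4) + 4 * (m * (c div 4))" by (simp only: algebra_simps)
      then show ?thesis by (simp only: mult_div_mod_eq)
    qed
    then show ?thesis by (simp only: rot_add) (simp add: rot_id)
  qed
  then show ?thesis using nat[of "nat (c mod 4)"] by simp
qed

text \<open>With \<open>pw c\<close> the plane part of the power of \<open>(u, m)\<close> at height \<open>m * c\<close>, the group consists of the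
  translates of \<open>pw c\<close> by \<open>L\<close> at these heights. The identity \<open>pw_add\<close> makes it closed.\<close>

lemma subs_exist:
  assumes m: "0 < m" and L: "L \<in> lattices k" and r: "\<And>v. v \<in> L \<Longrightarrow> rot (int m) v \<in> L"
  obtains H where "H \<in> subs m k" "slice H 0 = L" "(u, int m) \<in> H"
proof -
  interpret group "Tw 1" by (rule group_Tw)
  have A: "add_subgroup L" using L by (rule lattices_add_subgroup)
  define g where "g = (u, int m)"
  define pw where "pw c = fst (g [^]\<^bsub>Tw 1\<^esub> (c :: int))" for c
  have snd_mult: "snd (x \<otimes>\<^bsub>Tw 1\<^esub> y) = snd x + snd y" for x y by (cases x; cases y) simp
  have snd_pow: "snd (g [^]\<^bsub>Tw 1\<^esub> c) = int m * c" for c :: int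
  proof (induction c rule: int_induct[where k = 0])
    case base
    show ?case by simp
  next
    case (step1 c)
    then show ?case using int_pow_mult[of g c 1] by (simp add: snd_mult g_def distrib_left)
  next
    case (step2 c)
    have "snd (g [^]\<^bsub>Tw 1\<^esub> c) = snd (g [^]\<^bsub>Tw 1\<^esub> (c - 1)) + int m"
      using int_pow_mult[of g "c - 1" 1] by (simp add: snd_mult g_def)
    then show ?case using step2 by (simp add: right_diff_distrib)
  qed
  have pow: "g [^]\<^bsub>Tw 1\<^esub> c = (pw c, int m * c)" for c
    using snd_pow[of c] by (simp add: pw_def prod_eq_iff)
  have pw_add: "pw (c + c') = pw c + rot (int m * c) (pw c')" for c c'
    using int_pow_mult[of g c c'] by (simp add: pow)
  have pw0: "pw 0 = 0" by (simp add: pw_def)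
  have pw1: "pw 1 = u" by (simp add: pw_def g_def)
  define H where "H = {h. \<exists>c. snd h = int m * c \<and> fst h - pw c \<in> L}"
  have "subgroup H (Tw 1)"
  proof (rule subgroupI)
    have "(0, 0) \<in> H"
      unfolding H_def mem_Collect_eq by (rule exI[of _ 0]) (simp add: pw0 add_subgroup_0[OF A])
    then show "H \<noteq> {}" by blast
    show "x \<otimes>\<^bsub>Tw 1\<^esub> y \<in> H" if H: "x \<in> H" "y \<in> H" for x y
    proof -
      obtain c c' where c: "snd x = int m * c" "fst x - pw c \<in> L" "snd y = int m * c'" "fst y - pw c' \<in> L"
        using H unfolding H_def by blast
      have xy: "x \<otimes>\<^bsub>Tw 1\<^esub> y = (fst x + rot (int m * c) (fst y), int m * (c + c'))"
        using c by (cases x; cases y) (simp add: distrib_left)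
      have "(fst x - pw c) + rot (int m * c) (fst y - pw c') \<in> L"
        using add_subgroup_add[OF A c(2) rot_multiple_closed[OF r c(4), of c]] .
      then have "fst (x \<otimes>\<^bsub>Tw 1\<^esub> y) - pw (c + c') \<in> L"
        unfolding xy fst_conv pw_add by (simp add: algebra_simps)
      then show ?thesis using xy by (auto simp: H_def)
    qed
    show "inv\<^bsub>Tw 1\<^esub> x \<in> H" if H: "x \<in> H" for x
    proof -
      obtain c where c: "snd x = int m * c" "fst x - pw c \<in> L" using H unfolding H_def by blast
      have ix: "inv\<^bsub>Tw 1\<^esub> x = (- rot (int m * - c) (fst x), int m * - c)" using c by (cases x) simp
      have "pw (- c) = - rot (int m * - c) (pw c)"
        using pw_add[of "- c" c] pw0 by (simp add: eq_neg_iff_add_eq_0)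
      moreover have "- rot (int m * - c) (fst x - pw c) \<in> L"
        by (rule add_subgroup_minus[OF A rot_multiple_closed[OF r c(2)]])
      ultimately have "fst (inv\<^bsub>Tw 1\<^esub> x) - pw (- c) \<in> L" by (simp add: ix)
      then show ?thesis unfolding H_def by (simp add: ix) (metis mult_minus_right)
    qed
  qed simp
  moreover have sl: "slice H 0 = L" using m pw0 by (auto simp: slice_def H_def)
  moreover have "(u, int m) \<in> H"
    unfolding H_def mem_Collect_eq by (rule exI[of _ 1]) (simp add: pw1 add_subgroup_0[OF A])
  moreover have "int m dvd j" if "(v, j) \<in> H" for v j using that by (auto simp: H_def)
  ultimately show ?thesis using that[of H] L by (auto simp: subs_def)
qed

section \<open>Conjugacy classes of subgroups\<close>

text \<open>Conjugation by a vector \<open>w\<close> of the plane adds \<open>w - rot m w\<close> to the plane part of an element at height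
  \<open>m\<close>. Adding all these vectors to a set makes it insensitive to such conjugations.\<close>

definition shear :: "int \<Rightarrow> (int \<times> int) set \<Rightarrow> (int \<times> int) set" where
  "shear m L = {l + (w - rot m w) | l w. l \<in> L}"

lemma shearI: "l \<in> L \<Longrightarrow> l + (w - rot m w) \<in> shear m L"
  by (auto simp: shear_def)

definition rot_pair :: "int \<Rightarrow> (int \<times> int) set \<times> (int \<times> int) set \<Rightarrow> (int \<times> int) set \<times> (int \<times> int) set" where
  "rot_pair j x = (rot j ` fst x, rot j ` snd x)"

text \<open>The lattice of \<open>H\<close> and the plane parts of its elements at height \<open>m\<close>, the latter up to conjugation by
  vectors of the plane. Conjugation by \<open>(w, j)\<close> turns this pair by \<open>j\<close> quarter turns (\<open>conj_invariant_conj\<close>), and up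
  to these turns it is a complete invariant of conjugacy (\<open>subs_conj_iff\<close>).\<close>

definition conj_invariant :: "nat \<Rightarrow> ((int \<times> int) \<times> int) set \<Rightarrow> (int \<times> int) set \<times> (int \<times> int) set" where
  "conj_invariant m H = (slice H 0, shear (int m) (slice H (int m)))"

lemma Tw_conj: "(w, j) \<otimes>\<^bsub>Tw 1\<^esub> (v, i) \<otimes>\<^bsub>Tw 1\<^esub> inv\<^bsub>Tw 1\<^esub> (w, j) = (w - rot i w + rot j v, i)"
proof -
  have "rot (j + i) (rot (- j) w) = rot i w" by (simp add: rot_add[symmetric])
  then show ?thesis by (simp add: algebra_simps)
qed

lemma slice_conj:
  "slice ((\<lambda>h. (w, j) \<otimes>\<^bsub>Tw 1\<^esub> h \<otimes>\<^bsub>Tw 1\<^esub> inv\<^bsub>Tw 1\<^esub> (w, j)) ` H) i = (\<lambda>v. w - rot i w + rot j v) ` slice H i"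
proof (intro equalityI subsetI)
  fix x assume "x \<in> slice ((\<lambda>h. (w, j) \<otimes>\<^bsub>Tw 1\<^esub> h \<otimes>\<^bsub>Tw 1\<^esub> inv\<^bsub>Tw 1\<^esub> (w, j)) ` H) i"
  then obtain h where h: "h \<in> H" "(x, i) = (w, j) \<otimes>\<^bsub>Tw 1\<^esub> h \<otimes>\<^bsub>Tw 1\<^esub> inv\<^bsub>Tw 1\<^esub> (w, j)" by (auto simp: slice_def)
  obtain v i' where v: "h = (v, i')" by (cases h)
  have "(x, i) = (w - rot i' w + rot j v, i')" using h(2) unfolding v Tw_conj .
  then show "x \<in> (\<lambda>v. w - rot i w + rot j v) ` slice H i" using h(1) v by (auto simp: slice_def)
next
  fix x assume "x \<in> (\<lambda>v. w - rot i w + rot j v) ` slice H i"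
  then obtain v where v: "(v, i) \<in> H" "x = w - rot i w + rot j v" by (auto simp: slice_def)
  then have "(x, i) = (w, j) \<otimes>\<^bsub>Tw 1\<^esub> (v, i) \<otimes>\<^bsub>Tw 1\<^esub> inv\<^bsub>Tw 1\<^esub> (w, j)" by (simp only: Tw_conj)
  then show "x \<in> slice ((\<lambda>h. (w, j) \<otimes>\<^bsub>Tw 1\<^esub> h \<otimes>\<^bsub>Tw 1\<^esub> inv\<^bsub>Tw 1\<^esub> (w, j)) ` H) i"
    using v(1) unfolding slice_def by blast
qed

lemma rot_image_shear: "rot j ` shear m U = shear m (rot j ` U)"
proof (intro equalityI subsetI)
  fix x assume "x \<in> rot j ` shear m U"
  then obtain l w where "l \<in> U" "x = rot j l + (rot j w - rot m (rot j w))"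
    by (auto simp: shear_def rot_commute[of m j])
  then show "x \<in> shear m (rot j ` U)" by (simp add: shearI)
next
  fix x assume "x \<in> shear m (rot j ` U)"
  then obtain l w where l: "l \<in> U" "x = rot j l + (w - rot m w)" by (auto simp: shear_def)
  then have "x = rot j (l + (rot (- j) w - rot m (rot (- j) w)))"
    by (simp add: rot_commute[of j m])
  then show "x \<in> rot j ` shear m U" using l(1) unfolding shear_def by blast
qed

lemma shear_translate: "shear m ((\<lambda>v. w - rot m w + v) ` U) = shear m U"
proof (intro equalityI subsetI)
  fix x assume "x \<in> shear m ((\<lambda>v. w - rot m w + v) ` U)"
  then obtain l w' where l: "l \<in> U" "x = w - rot m w + l + (w' - rot m w')" by (auto simp: shear_def)
  then have "x = l + ((w + w') - rot m (w + w'))" by (simp add: algebra_simps)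
  then show "x \<in> shear m U" using l(1) unfolding shear_def by blast
next
  fix x assume "x \<in> shear m U"
  then obtain l w' where l: "l \<in> U" "x = l + (w' - rot m w')" by (auto simp: shear_def)
  then have "x = (w - rot m w + l) + ((w' - w) - rot m (w' - w))" by (simp add: algebra_simps)
  then show "x \<in> shear m ((\<lambda>v. w - rot m w + v) ` U)" using l(1) unfolding shear_def by blast
qed

lemma conj_invariant_conj:
  "conj_invariant m ((\<lambda>h. (w, j) \<otimes>\<^bsub>Tw 1\<^esub> h \<otimes>\<^bsub>Tw 1\<^esub> inv\<^bsub>Tw 1\<^esub> (w, j)) ` H) = rot_pair j (conj_invariant m H)"
proof -
  have "(\<lambda>v. w - rot 0 w + rot j v) ` slice H 0 = rot j ` slice H 0" by simp
  moreover have "shear (int m) ((\<lambda>v. w - rot (int m) w + rot j v) ` slice H (int m)) = rot j ` shear (int m) (slice H (int m))"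
    using shear_translate[of "int m" w "rot j ` slice H (int m)"] by (simp add: rot_image_shear image_image)
  ultimately show ?thesis unfolding conj_invariant_def rot_pair_def slice_conj by simp
qed

lemma subs_conj:
  assumes H: "H \<in> subs m k" and c: "H' = (\<lambda>h. (w, j) \<otimes>\<^bsub>Tw 1\<^esub> h \<otimes>\<^bsub>Tw 1\<^esub> inv\<^bsub>Tw 1\<^esub> (w, j)) ` H"
    and L: "slice H' 0 \<in> lattices k"
  shows "H' \<in> subs m k"
proof -
  interpret group "Tw 1" by (rule group_Tw)
  have s: "subgroup H (Tw 1)" using H by (simp add: subs_def)
  have hom: "(\<lambda>h. (w, j) \<otimes>\<^bsub>Tw 1\<^esub> h \<otimes>\<^bsub>Tw 1\<^esub> inv\<^bsub>Tw 1\<^esub> (w, j)) \<in> hom (Tw 1) (Tw 1)"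
  proof (rule homI)
    fix x y
    have "(w, j) \<otimes>\<^bsub>Tw 1\<^esub> x \<otimes>\<^bsub>Tw 1\<^esub> inv\<^bsub>Tw 1\<^esub> (w, j) \<otimes>\<^bsub>Tw 1\<^esub> ((w, j) \<otimes>\<^bsub>Tw 1\<^esub> y \<otimes>\<^bsub>Tw 1\<^esub> inv\<^bsub>Tw 1\<^esub> (w, j)) =
      (w, j) \<otimes>\<^bsub>Tw 1\<^esub> x \<otimes>\<^bsub>Tw 1\<^esub> (inv\<^bsub>Tw 1\<^esub> (w, j) \<otimes>\<^bsub>Tw 1\<^esub> (w, j)) \<otimes>\<^bsub>Tw 1\<^esub> y \<otimes>\<^bsub>Tw 1\<^esub> inv\<^bsub>Tw 1\<^esub> (w, j)"
      by (simp only: m_assoc carrier_Tw UNIV_I m_closed inv_closed)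
    also have "\<dots> = (w, j) \<otimes>\<^bsub>Tw 1\<^esub> (x \<otimes>\<^bsub>Tw 1\<^esub> y) \<otimes>\<^bsub>Tw 1\<^esub> inv\<^bsub>Tw 1\<^esub> (w, j)"
      by (simp only: m_assoc carrier_Tw UNIV_I m_closed inv_closed l_inv l_one)
    finally show "(w, j) \<otimes>\<^bsub>Tw 1\<^esub> (x \<otimes>\<^bsub>Tw 1\<^esub> y) \<otimes>\<^bsub>Tw 1\<^esub> inv\<^bsub>Tw 1\<^esub> (w, j) =
      (w, j) \<otimes>\<^bsub>Tw 1\<^esub> x \<otimes>\<^bsub>Tw 1\<^esub> inv\<^bsub>Tw 1\<^esub> (w, j) \<otimes>\<^bsub>Tw 1\<^esub> ((w, j) \<otimes>\<^bsub>Tw 1\<^esub> y \<otimes>\<^bsub>Tw 1\<^esub> inv\<^bsub>Tw 1\<^esub> (w, j))"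
      by (rule HOL.sym)
  qed simp
  have "subgroup H' (Tw 1)"
    unfolding c by (rule group_hom.subgroup_img_is_subgroup[OF _ s])
      (simp add: group_hom_def group_hom_axioms_def group_Tw hom del: inv_Tw)
  moreover obtain u where "(u, int m) \<in> H" using H by (auto simp: subs_def)
  then have "\<exists>u. u \<in> slice H' (int m)" unfolding c slice_conj by (auto simp: slice_def)
  moreover have "int m dvd i" if "(v, i) \<in> H'" for v i
  proof -
    have "v \<in> slice H' i" using that by (simp add: slice_def)
    then have "\<exists>v. (v, i) \<in> H" unfolding c slice_conj by (auto simp: slice_def)
    then show ?thesis using H by (auto simp: subs_def)
  qed
  ultimately show ?thesis using L by (auto simp: subs_def slice_def)
qed

text \<open>If the invariants agree up to a turn by \<open>j\<close>, an element \<open>u\<close> of \<open>H'\<close> at height \<open>m\<close> also lies in the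
  conjugate of \<open>H\<close> by some \<open>(w, j)\<close>. The two groups share their lattice too, so they are equal.\<close>

lemma subs_conj_iff:
  assumes H: "H \<in> subs m k" and H': "H' \<in> subs m k"
  shows "conj_class (Tw 1) H = conj_class (Tw 1) H' \<longleftrightarrow> (\<exists>j. conj_invariant m H' = rot_pair j (conj_invariant m H))"
proof -
  have "conj_class (Tw 1) H = conj_class (Tw 1) H' \<longleftrightarrow>
      (\<exists>w j. H' = (\<lambda>h. (w, j) \<otimes>\<^bsub>Tw 1\<^esub> h \<otimes>\<^bsub>Tw 1\<^esub> inv\<^bsub>Tw 1\<^esub> (w, j)) ` H)"
    using conj_class_eq_iff[OF group_Tw, of H 1 H'] by (simp add: split_paired_Ex del: inv_Tw)
  also have "\<dots> \<longleftrightarrow> (\<exists>j. conj_invariant m H' = rot_pair j (conj_invariant m H))"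
  proof
    assume "\<exists>w j. H' = (\<lambda>h. (w, j) \<otimes>\<^bsub>Tw 1\<^esub> h \<otimes>\<^bsub>Tw 1\<^esub> inv\<^bsub>Tw 1\<^esub> (w, j)) ` H"
    then show "\<exists>j. conj_invariant m H' = rot_pair j (conj_invariant m H)" using conj_invariant_conj by blast
  next
    assume "\<exists>j. conj_invariant m H' = rot_pair j (conj_invariant m H)"
    then obtain j where j: "slice H' 0 = rot j ` slice H 0"
      "shear (int m) (slice H' (int m)) = rot j ` shear (int m) (slice H (int m))"
      by (auto simp: conj_invariant_def rot_pair_def)
    obtain u where u: "(u, int m) \<in> H'" using H' by (auto simp: subs_def)
    have "u = u + (0 - rot (int m) 0)" by simp
    then have "u \<in> shear (int m) (slice H' (int m))" using u unfolding shear_def slice_def by blast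
    then have "u \<in> shear (int m) (rot j ` slice H (int m))" using j(2) by (simp add: rot_image_shear)
    then obtain v w where v: "(v, int m) \<in> H" "u = rot j v + (w - rot (int m) w)" by (auto simp: shear_def slice_def)
    define H'' where "H'' = (\<lambda>h. (w, j) \<otimes>\<^bsub>Tw 1\<^esub> h \<otimes>\<^bsub>Tw 1\<^esub> inv\<^bsub>Tw 1\<^esub> (w, j)) ` H"
    have sl: "slice H'' 0 = slice H' 0" unfolding H''_def slice_conj j(1) by simp
    then have s: "H'' \<in> subs m k" using subs_conj[OF H H''_def] H' by (simp add: subs_def)
    have "u \<in> slice H'' (int m)" unfolding H''_def slice_conj using v by (auto simp: slice_def algebra_simps)
    then have "H' = H''" using slice_unique[OF H' s sl[symmetric] u] by (simp add: slice_def)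
    then show "\<exists>w j. H' = (\<lambda>h. (w, j) \<otimes>\<^bsub>Tw 1\<^esub> h \<otimes>\<^bsub>Tw 1\<^esub> inv\<^bsub>Tw 1\<^esub> (w, j)) ` H" unfolding H''_def by blast
  qed
  finally show ?thesis .
qed

text \<open>The values of the invariant: the elements of \<open>H\<close> at height \<open>m\<close> form one coset of its lattice, and
  the lattice is invariant under \<open>m\<close> quarter turns.\<close>

definition pairs :: "nat \<Rightarrow> nat \<Rightarrow> ((int \<times> int) set \<times> (int \<times> int) set) set" where
  "pairs m k = {(L, (+) u ` shear (int m) L) | L u. L \<in> lattices k \<and> (\<forall>v\<in>L. rot (int m) v \<in> L)}"

lemma conj_invariant_subs:
  assumes m: "0 < m"
  shows "conj_invariant m ` subs m k = pairs m k"
proof -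
  have conj_invariant: "conj_invariant m H = (slice H 0, (+) u ` shear (int m) (slice H 0))"
    if H: "H \<in> subs m k" and u: "(u, int m) \<in> H" for H u
  proof -
    have s: "subgroup H (Tw 1)" using H by (simp add: subs_def)
    have "slice H (int m) = (+) u ` slice H 0"
    proof (intro equalityI subsetI)
      fix v assume "v \<in> slice H (int m)"
      then have "v - u \<in> slice H 0" using subgroup_TwD(4)[OF s _ u] by (simp add: slice_def)
      then show "v \<in> (+) u ` slice H 0" by (intro image_eqI[of _ _ "v - u"]) simp_all
    next
      fix v assume "v \<in> (+) u ` slice H 0"
      then obtain l where "(l, 0) \<in> H" "v = u + l" by (auto simp: slice_def)
      then show "v \<in> slice H (int m)" using subgroup_TwD(5)[OF s _ u, of l] by (simp add: slice_def add.commute)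
    qed
    moreover have "shear (int m) ((+) u ` L) = (+) u ` shear (int m) L" for L
    proof (intro equalityI subsetI)
      fix z assume "z \<in> shear (int m) ((+) u ` L)"
      then obtain l w where "l \<in> L" "z = u + (l + (w - rot (int m) w))"
        by (auto simp: shear_def add.assoc)
      then show "z \<in> (+) u ` shear (int m) L" using shearI by blast
    next
      fix z assume "z \<in> (+) u ` shear (int m) L"
      then obtain l w where l: "l \<in> L" "z = u + l + (w - rot (int m) w)"
        by (auto simp: shear_def add.assoc)
      then show "z \<in> shear (int m) ((+) u ` L)" using shearI[of "u + l" "(+) u ` L"] by blast
    qed
    ultimately show ?thesis by (simp add: conj_invariant_def)
  qed
  show ?thesis
  proof (intro equalityI subsetI)
    fix x assume "x \<in> conj_invariant m ` subs m k"
    then obtain H where H: "H \<in> subs m k" "x = conj_invariant m H" by blast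
    obtain u where u: "(u, int m) \<in> H" using H(1) by (auto simp: subs_def)
    have "rot (int m) v \<in> slice H 0" if "v \<in> slice H 0" for v
      using slice_rot[of H 1 u "int m" v] u that H(1) by (simp add: subs_def)
    then show "x \<in> pairs m k" unfolding H(2) conj_invariant[OF H(1) u] pairs_def using H(1) by (auto simp: subs_def)
  next
    fix x assume "x \<in> pairs m k"
    then obtain L u where L: "x = (L, (+) u ` shear (int m) L)" "L \<in> lattices k" "\<And>v. v \<in> L \<Longrightarrow> rot (int m) v \<in> L"
      by (auto simp: pairs_def)
    obtain H where H: "H \<in> subs m k" "slice H 0 = L" "(u, int m) \<in> H" by (rule subs_exist[OF m L(2,3)])
    then have "x = conj_invariant m H" using conj_invariant[OF H(1,3)] L(1) by simp
    then show "x \<in> conj_invariant m ` subs m k" using H(1) by (rule image_eqI)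
  qed
qed

definition rot_orbit :: "(int \<times> int) set \<times> (int \<times> int) set \<Rightarrow> ((int \<times> int) set \<times> (int \<times> int) set) set" where
  "rot_orbit x = range (\<lambda>j. rot_pair j x)"

lemma rot_pair_add: "rot_pair (i + j) x = rot_pair i (rot_pair j x)"
  by (simp add: rot_pair_def image_image rot_add)

lemma rot_pair_0 [simp]: "rot_pair 0 x = x"
  by (simp add: rot_pair_def)

lemma rot_orbit_eq_iff: "rot_orbit x = rot_orbit y \<longleftrightarrow> (\<exists>j. y = rot_pair j x)"
proof
  assume "rot_orbit x = rot_orbit y"
  moreover have "y \<in> rot_orbit y" unfolding rot_orbit_def by (intro image_eqI[of _ _ 0]) simp_all
  ultimately show "\<exists>j. y = rot_pair j x" by (auto simp: rot_orbit_def)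
next
  assume "\<exists>j. y = rot_pair j x"
  then obtain j where j: "y = rot_pair j x" by blast
  show "rot_orbit x = rot_orbit y"
  proof (intro equalityI subsetI)
    fix z assume "z \<in> rot_orbit x"
    then obtain i where "z = rot_pair i x" by (auto simp: rot_orbit_def)
    then have "z = rot_pair (i - j) y" by (simp add: j rot_pair_add[symmetric])
    then show "z \<in> rot_orbit y" by (auto simp: rot_orbit_def)
  next
    fix z assume "z \<in> rot_orbit y"
    then obtain i where "z = rot_pair i y" by (auto simp: rot_orbit_def)
    then have "z = rot_pair (i + j) x" by (simp add: j rot_pair_add)
    then show "z \<in> rot_orbit x" by (auto simp: rot_orbit_def)
  qed
qed

lemma subs_classes_bij:
  assumes m: "0 < m"
  obtains h where "bij_betw h (conj_class (Tw 1) ` subs m k) (rot_orbit ` pairs m k)"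
proof -
  obtain h where "bij_betw h (conj_class (Tw 1) ` subs m k) ((\<lambda>H. rot_orbit (conj_invariant m H)) ` subs m k)"
  proof (rule bij_betw_images)
    show "conj_class (Tw 1) H = conj_class (Tw 1) H' \<longleftrightarrow> rot_orbit (conj_invariant m H) = rot_orbit (conj_invariant m H')"
      if "H \<in> subs m k" "H' \<in> subs m k" for H H'
      using subs_conj_iff[OF that] by (simp add: rot_orbit_eq_iff)
  qed
  then show ?thesis using that conj_invariant_subs[OF m, of k] by (simp add: image_image[symmetric])
qed

section \<open>The geometric type of a subgroup\<close>

text \<open>Every element of \<open>H\<close> differs from a power of \<open>(u, m)\<close> by a vector of the lattice.\<close>

lemma subs_generate:
  assumes H: "H \<in> subs m k" and u: "(u, int m) \<in> H"
    and L: "slice H 0 = {smul x e1 + smul y e2 | x y. True}"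
  shows "generate (Tw 1) {(e1, 0), (e2, 0), (u, int m)} = H"
proof -
  let ?S = "{(e1, 0), (e2, 0), (u, int m)}"
  interpret group "Tw 1" by (rule group_Tw)
  have s: "subgroup H (Tw 1)" using H by (simp add: subs_def)
  have g: "subgroup (generate (Tw 1) ?S) (Tw 1)" by (rule generate_is_subgroup) simp
  have "e1 = smul 1 e1 + smul 0 e2" "e2 = smul 0 e1 + smul 1 e2" by simp_all
  then have "e1 \<in> slice H 0" "e2 \<in> slice H 0" unfolding L by blast+
  then have S: "?S \<subseteq> H" using u by (simp add: slice_def)
  then have sub: "generate (Tw 1) ?S \<subseteq> H" by (rule generate_subgroup_incl[OF _ s])
  have G: "(e1, 0) \<in> generate (Tw 1) ?S" "(e2, 0) \<in> generate (Tw 1) ?S" "(u, int m) \<in> generate (Tw 1) ?S"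
    by (auto intro: generate.incl)
  have "(v, j) \<in> generate (Tw 1) ?S" if h: "(v, j) \<in> H" for v j
  proof -
    have "int m dvd j" using H h unfolding subs_def by blast
    then obtain c where c: "j = int m * c" by (auto simp: dvd_def)
    obtain w where w: "(w, int m * c) \<in> generate (Tw 1) ?S" by (rule subgroup_Tw_pow[OF g G(3)])
    have "v - w \<in> slice H 0" using subgroup_TwD(4)[OF s h[unfolded c], of w] w sub unfolding slice_def by blast
    then obtain x y where xy: "v - w = smul x e1 + smul y e2" unfolding L by blast
    have "(smul x e1 + smul y e2, 0) \<in> generate (Tw 1) ?S"
      using subgroup_TwD(5)[OF g subgroup_Tw_smul[OF g G(1)] subgroup_Tw_smul[OF g G(2)]] .
    then have "(v - w + w, int m * c) \<in> generate (Tw 1) ?S"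
      using subgroup_TwD(5)[OF g _ w] xy by metis
    then show ?thesis by (simp add: c)
  qed
  then show ?thesis using sub by auto
qed

definition vec3 :: "real \<times> real \<Rightarrow> real \<Rightarrow> real^3" where
  "vec3 p z = (\<chi> i. if i = 1 then fst p else if i = 2 then snd p else z)"

lemma vec3_simps [simp]: "xy (vec3 p z) = p" "vec3 p z $ 3 = z"
  by (simp_all add: vec3_def xy_def)

lemma continuous_vec3:
  assumes "continuous_on S p" "continuous_on S z"
  shows "continuous_on S (\<lambda>v. vec3 (p v) (z v))"
  unfolding vec3_def
proof (rule continuous_on_vec_lambda)
  fix i :: 3
  show "continuous_on S (\<lambda>v. if i = 1 then fst (p v) else if i = 2 then snd (p v) else z v)"
    by (cases "i = 1"; cases "i = 2") (use assms in \<open>auto intro!: continuous_intros\<close>)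
qed

lemma continuous_xy: "continuous_on S xy"
  unfolding xy_def by (intro continuous_intros)

lemma rot_scaleR: "rot k (c *\<^sub>R p) = c *\<^sub>R rot k (p :: real \<times> real)"
  by (auto simp: rot_def prod_eq_iff)

text \<open>The real linear map that takes the standard basis to \<open>e1\<close> and \<open>e2\<close>.\<close>

definition frame :: "int \<times> int \<Rightarrow> int \<times> int \<Rightarrow> real \<times> real \<Rightarrow> real \<times> real" where
  "frame e1 e2 p = fst p *\<^sub>R real_pair e1 + snd p *\<^sub>R real_pair e2"

lemma frame_simps: "frame e1 e2 (p + q) = frame e1 e2 p + frame e1 e2 q"
  "frame e1 e2 (- p) = - frame e1 e2 p"
  "frame e1 e2 (real_pair (1, 0)) = real_pair e1" "frame e1 e2 (real_pair (0, 1)) = real_pair e2"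
  by (simp_all add: frame_def real_pair_def prod_eq_iff algebra_simps)

lemma continuous_frame: "continuous_on S f \<Longrightarrow> continuous_on S (\<lambda>v. frame e1 e2 (f v))"
  unfolding frame_def by (intro continuous_intros)

lemma frame_inverse:
  assumes "fst e1 * snd e2 - snd e1 * fst e2 \<noteq> 0"
  shows "\<exists>B. continuous_on UNIV B \<and> (\<forall>p. B (frame e1 e2 p) = p) \<and> (\<forall>p. frame e1 e2 (B p) = p)"
proof -
  define D where "D = real_of_int (fst e1 * snd e2 - snd e1 * fst e2)"
  have D: "D \<noteq> 0" using assms unfolding D_def by linarith
  define B where "B q = ((fst q * snd e2 - snd q * fst e2) / D, (fst e1 * snd q - snd e1 * fst q) / D)" for q :: "real \<times> real"
  have "continuous_on UNIV B" unfolding B_def using D by (intro continuous_intros) auto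
  moreover have "B (frame e1 e2 p) = p" for p
  proof -
    have "fst (frame e1 e2 p) * snd e2 - snd (frame e1 e2 p) * fst e2 = fst p * D"
      "fst e1 * snd (frame e1 e2 p) - snd e1 * fst (frame e1 e2 p) = snd p * D"
      by (simp_all add: frame_def real_pair_def D_def algebra_simps)
    then show ?thesis using D by (simp add: B_def)
  qed
  moreover have "frame e1 e2 (B q) = q" for q
  proof -
    have "fst (frame e1 e2 (B q)) = fst q * D / D" "snd (frame e1 e2 (B q)) = snd q * D / D"
      unfolding frame_def B_def real_pair_def
      by (simp_all add: add_divide_distrib[symmetric] D_def algebra_simps del: nonzero_mult_div_cancel_right)
    then show ?thesis using D by (simp add: prod_eq_iff)
  qed
  ultimately show ?thesis by blast
qed

lemma conj_group_hom:
  assumes F: "bij (F :: real^3 \<Rightarrow> real^3)"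
  shows "group_hom (BijGroup UNIV) (BijGroup UNIV) (\<lambda>\<gamma>. F \<circ> \<gamma> \<circ> finv F)"
proof -
  have FF: "finv F (F x) = x" for x using F by (simp add: bij_is_inj)
  have b: "bij (F \<circ> \<gamma> \<circ> finv F)" if "bij \<gamma>" for \<gamma>
    using that F bij_imp_bij_inv by (auto intro!: bij_comp)
  have "(\<lambda>\<gamma>. F \<circ> \<gamma> \<circ> finv F) \<in> hom (BijGroup UNIV) (BijGroup UNIV)"
    by (rule homI) (auto simp: b FF)
  then show ?thesis by (simp add: group_hom_def group_hom_axioms_def group_BijGroup)
qed

text \<open>The map \<open>F\<close> is affine: it takes the standard basis of the plane to \<open>e1, e2\<close> and the unit height to
  height \<open>m\<close>, displaced by \<open>c1\<close>; the origin goes to \<open>c0\<close>. By \<open>eq\<close> and \<open>c1\<close> it conjugates the standard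
  screw motion to the one of \<open>(u, m)\<close>, so it carries generators to generators.\<close>

lemma subs_affine_conj:
  assumes H: "H \<in> subs m k" and m: "0 < m" and u: "(u, int m) \<in> H"
    and L: "slice H 0 = {smul x e1 + smul y e2 | x y. True}"
    and det: "fst e1 * snd e2 - snd e1 * fst e2 \<noteq> 0"
    and eq: "\<And>p. frame e1 e2 (rot e p) + c1 + c0 = rot (int m) (frame e1 e2 p + c0) + real_pair u"
    and c1: "rot (int m) c1 = c1"
  obtains F where "homeomorphic_map euclidean euclidean F"
    "move 1 ` H = (\<lambda>\<gamma>. F \<circ> \<gamma> \<circ> finv F) ` range (move e)"
proof -
  obtain B where B: "continuous_on UNIV B" "\<And>p. B (frame e1 e2 p) = p" "\<And>p. frame e1 e2 (B p) = p"
    using frame_inverse[OF det] by auto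
  define F where "F v = vec3 (frame e1 e2 (xy v) + v$3 *\<^sub>R c1 + c0) (real m * v$3)" for v
  define G where "G w = vec3 (B (xy w - (w$3 / real m) *\<^sub>R c1 - c0)) (w$3 / real m)" for w
  have GF: "G (F v) = v" for v by (rule vec3_eqI) (use m in \<open>simp_all add: F_def G_def B\<close>)
  have FG: "F (G v) = v" for v by (rule vec3_eqI) (use m in \<open>simp_all add: F_def G_def B\<close>)
  have cF: "continuous_on UNIV F"
    unfolding F_def by (intro continuous_vec3 continuous_intros continuous_frame continuous_xy)
  have cG: "continuous_on UNIV G"
    unfolding G_def using m
    by (intro continuous_vec3 continuous_on_compose2[OF B(1)] continuous_intros continuous_xy) auto
  have "homeomorphic_maps euclidean euclidean F G"
    using cF cG GF FG by (simp add: homeomorphic_maps_def)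
  then have hF: "homeomorphic_map euclidean euclidean F" by (rule homeomorphic_maps_imp_map)
  have bF: "bij F" by (rule o_bij[of G]) (use GF FG in auto)
  have FF: "F (finv F x) = x" for x using bF by (simp add: bij_is_surj surj_f_inv_f)
  let ?c = "\<lambda>\<gamma>. F \<circ> \<gamma> \<circ> finv F"
  have "F (move e ((1, 0), 0) v) = move 1 (e1, 0) (F v)" for v
    by (rule vec3_eqI) (simp_all add: F_def frame_simps)
  moreover have "F (move e ((0, 1), 0) v) = move 1 (e2, 0) (F v)" for v
    by (rule vec3_eqI) (simp_all add: F_def frame_simps)
  moreover have "F (move e (0, 1) v) = move 1 (u, int m) (F v)" for v
  proof (rule vec3_eqI)
    have "frame e1 e2 (rot e (xy v)) + (v$3 + 1) *\<^sub>R c1 + c0 = frame e1 e2 (rot e (xy v)) + c1 + c0 + v$3 *\<^sub>R c1"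
      by (simp add: scaleR_add_left)
    also have "\<dots> = rot (int m) (frame e1 e2 (xy v) + v$3 *\<^sub>R c1 + c0) + real_pair u"
      unfolding eq by (simp add: rot_scaleR c1)
    finally show "xy (F (move e (0, 1) v)) = xy (move 1 (u, int m) (F v))" by (simp add: F_def)
    show "F (move e (0, 1) v) $ 3 = move 1 (u, int m) (F v) $ 3" by (simp add: F_def algebra_simps)
  qed
  ultimately have gens: "?c ` move e ` {((1, 0), 0), ((0, 1), 0), (0, 1)} = move 1 ` {(e1, 0), (e2, 0), (u, int m)}"
    by (simp add: comp_def FF)
  have "?c ` range (move e) = ?c ` generate (BijGroup UNIV) (move e ` {((1, 0), 0), ((0, 1), 0), (0, 1)})"
    using motion_group_move[of e] by (simp add: motion_group_def)
  also have "\<dots> = generate (BijGroup UNIV) (?c ` move e ` {((1, 0), 0), ((0, 1), 0), (0, 1)})"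
    by (rule group_hom.generate_img[OF conj_group_hom[OF bF], symmetric]) (auto simp: move_bij)
  also have "\<dots> = move 1 ` generate (Tw 1) {(e1, 0), (e2, 0), (u, int m)}"
    unfolding gens by (rule group_hom.generate_img[OF group_hom_move]) simp
  also have "\<dots> = move 1 ` H" unfolding subs_generate[OF H u L] ..
  finally show ?thesis using that[OF hF] by simp
qed

text \<open>The turn by \<open>m\<close> quarter turns is conjugate, by a linear map of the plane, to that by \<open>twist m\<close>
  quarter turns.\<close>

definition twist :: "nat \<Rightarrow> int" where
  "twist m = (if odd m then 1 else if 4 dvd m then 4 else 2)"

text \<open>The square of \<open>m\<close> is 1 modulo 4, so \<open>m\<close> turns by \<open>m\<close> quarter turns make one quarter turn.\<close>

lemma odd_lattice_ideal:
  assumes m: "odd (m :: nat)" and r: "\<And>v. v \<in> L \<Longrightarrow> rot (int m) v \<in> L" and v: "v \<in> L"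
  shows "rot 1 v \<in> L"
proof -
  have "int m mod 4 = 1 \<or> int m mod 4 = 3" using m by presburger
  moreover have "(int m * int m) mod 4 = ((int m mod 4) * (int m mod 4)) mod 4" by (simp only: mod_mult_eq)
  ultimately have "(int m * int m) mod 4 = 1" by auto
  then have "rot (int m * int m) v = rot 1 v" by (simp add: rot_def)
  then show ?thesis using rot_multiple_closed[OF r v, of "int m"] by simp
qed

text \<open>For odd \<open>m\<close> the lattice is an ideal with basis \<open>v, rot m v\<close>, in which the turn by \<open>m\<close> quarter turns
  looks like one quarter turn; the axis of the screw motion passes through the fixed point
  \<open>(u + rot m u) / 2\<close> of \<open>p \<mapsto> rot m p + u\<close>. If \<open>m\<close> is 2 modulo 4, the turn is negation in every basis
  and the fixed point is \<open>u / 2\<close>. If 4 divides \<open>m\<close>, there is no turn, and \<open>u\<close> is the horizontal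
  displacement of the third generating translation.\<close>

theorem subs_geometry:
  assumes H: "H \<in> subs m k" and m: "0 < m"
  obtains F where "homeomorphic_map euclidean euclidean F"
    "move 1 ` H = (\<lambda>\<gamma>. F \<circ> \<gamma> \<circ> finv F) ` range (move (twist m))"
proof -
  obtain u where u: "(u, int m) \<in> H" using H by (auto simp: subs_def)
  have s: "subgroup H (Tw 1)" and L: "slice H 0 \<in> lattices k" using H by (auto simp: subs_def)
  have r: "rot (int m) v \<in> slice H 0" if "v \<in> slice H 0" for v
    using slice_rot[of H 1 u "int m" v] u that s by simp
  obtain a b d where ab: "slice H 0 = lat a b d" "0 < a" "0 < d" using L by (auto simp: lattices_def)
  have L2: "slice H 0 = {smul x (a, 0) + smul y (b, d) | x y. True}" unfolding ab(1) by (rule lat_span)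
  have det2: "fst (a, 0) * snd (b, d) - snd (a, 0) * fst (b, d) \<noteq> 0" using ab by simp
  consider "odd m" | "even m" "\<not> 4 dvd m" | "4 dvd m" by blast
  then show ?thesis
  proof cases
    case 1
    have m4: "int m mod 4 = 1 \<or> int m mod 4 = 3" using 1 by presburger
    obtain v where v: "v \<noteq> 0" "slice H 0 = gauss_ideal v"
      using ideal_principal[OF L odd_lattice_ideal[OF 1 r]] by blast
    obtain s t where st: "v = (s, t)" by (cases v)
    have "slice H 0 = {smul x v + smul y (rot (int m) v) | x y. True}"
    proof (intro equalityI subsetI)
      fix w assume "w \<in> slice H 0"
      then obtain q where "w = gauss_mul q v" by (auto simp: v(2) gauss_ideal_def)
      then have "w = smul (fst q) v + smul (snd q) (rot (int m) v) \<or> w = smul (fst q) v + smul (- snd q) (rot (int m) v)"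
        using m4 by (auto simp: gauss_mul_def rot_def smul_def prod_eq_iff)
      then show "w \<in> {smul x v + smul y (rot (int m) v) | x y. True}" by blast
    next
      fix w assume "w \<in> {smul x v + smul y (rot (int m) v) | x y. True}"
      then obtain x y where w: "w = smul x v + smul y (rot (int m) v)" by blast
      have A: "add_subgroup (slice H 0)" by (rule slice_add_subgroup[OF s])
      have "v \<in> slice H 0" using v gauss_ideal_self by simp
      then show "w \<in> slice H 0" unfolding w by (intro add_subgroup_add[OF A] add_subgroup_smul[OF A] r)
    qed
    moreover have "fst v * snd (rot (int m) v) - snd v * fst (rot (int m) v) \<noteq> 0"
    proof -
      have "fst v * snd (rot (int m) v) - snd v * fst (rot (int m) v) = gauss_norm v \<or>
          fst v * snd (rot (int m) v) - snd v * fst (rot (int m) v) = - gauss_norm v"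
        using m4 by (auto simp: rot_def gauss_norm_def power2_eq_square)
      then show ?thesis using v(1) gauss_norm_eq_0[of v] by auto
    qed
    moreover have "frame v (rot (int m) v) (rot 1 p) + 0 + (1/2) *\<^sub>R (real_pair u + rot (int m) (real_pair u)) =
      rot (int m) (frame v (rot (int m) v) p + (1/2) *\<^sub>R (real_pair u + rot (int m) (real_pair u))) + real_pair u" for p
    proof -
      have h: "(int m + int m) mod 4 = 2" using m4 by presburger
      then have sq: "rot (int m) (rot (int m) q) = - q" for q :: "real \<times> real"
        unfolding rot_add[symmetric] unfolding rot_def h by (simp add: prod_eq_iff)
      have fr: "frame v (rot (int m) v) (rot 1 p) = rot (int m) (frame v (rot (int m) v) p)"
        by (simp add: frame_def rot_scaleR sq) (simp add: rot_def)
      have half: "(1/2) *\<^sub>R (U + V) = (1/2) *\<^sub>R (V + - U) + U" for U V :: "real \<times> real"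
        by (simp add: prod_eq_iff field_simps)
      have "rot (int m) (frame v (rot (int m) v) p + (1/2) *\<^sub>R (real_pair u + rot (int m) (real_pair u))) + real_pair u =
          rot (int m) (frame v (rot (int m) v) p) + ((1/2) *\<^sub>R (rot (int m) (real_pair u) + - real_pair u) + real_pair u)"
        by (simp only: rot_plus rot_scaleR sq add.assoc)
      then show ?thesis by (simp only: fr half[symmetric] add_0_right)
    qed
    ultimately obtain F where "homeomorphic_map euclidean euclidean F"
      "move 1 ` H = (\<lambda>\<gamma>. F \<circ> \<gamma> \<circ> finv F) ` range (move 1)"
      using subs_affine_conj[OF H m u, of v "rot (int m) v" 1 0, OF _ _ _ rot_zero] by blast
    then show ?thesis using that 1 by (simp add: twist_def)
  next
    case 2
    then have m4: "int m mod 4 = 2" by presburger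
    have "frame (a, 0) (b, d) (rot 2 p) + 0 + (1/2) *\<^sub>R real_pair u =
      rot (int m) (frame (a, 0) (b, d) p + (1/2) *\<^sub>R real_pair u) + real_pair u" for p
    proof -
      have r: "rot (int m) q = - q" "rot 2 q = - q" for q :: "real \<times> real"
        using m4 by (simp_all add: rot_def prod_eq_iff)
      show ?thesis unfolding r frame_simps by (simp add: prod_eq_iff field_simps)
    qed
    then obtain F where "homeomorphic_map euclidean euclidean F"
      "move 1 ` H = (\<lambda>\<gamma>. F \<circ> \<gamma> \<circ> finv F) ` range (move 2)"
      using subs_affine_conj[OF H m u L2 det2, of 2 0, OF _ rot_zero] by blast
    then show ?thesis using that 2 by (simp add: twist_def)
  next
    case 3
    then have m4: "int m mod 4 = 0" by presburger
    have "frame (a, 0) (b, d) (rot 4 p) + real_pair u + 0 =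
      rot (int m) (frame (a, 0) (b, d) p + 0) + real_pair u" for p
      using m4 by (simp add: rot_def)
    then obtain F where "homeomorphic_map euclidean euclidean F"
      "move 1 ` H = (\<lambda>\<gamma>. F \<circ> \<gamma> \<circ> finv F) ` range (move 4)"
      using subs_affine_conj[OF H m u L2 det2, of 4 "real_pair u" 0, OF _ rot_id[OF m4]] by blast
    moreover have "even m" using 3 by presburger
    ultimately show ?thesis using that 3 by (simp add: twist_def)
  qed
qed

section \<open>Transport along isomorphisms\<close>

lemma iso_image_rcosets:
  assumes f: "f \<in> hom G G'" and K: "K \<subseteq> carrier G" and onto: "f ` carrier G = carrier G'"
  shows "rcosets\<^bsub>G'\<^esub> (f ` K) = (`) f ` (rcosets\<^bsub>G\<^esub> K)"
proof -
  have "f ` (K #>\<^bsub>G\<^esub> x) = f ` K #>\<^bsub>G'\<^esub> f x" if "x \<in> carrier G" for x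
  proof -
    have "f ` (K #>\<^bsub>G\<^esub> x) = (\<Union>h\<in>K. {f (h \<otimes>\<^bsub>G\<^esub> x)})" by (auto simp: r_coset_def)
    also have "\<dots> = (\<Union>h\<in>K. {f h \<otimes>\<^bsub>G'\<^esub> f x})"
      using that K hom_mult[OF f] by (intro SUP_cong) auto
    finally show ?thesis by (simp add: r_coset_def)
  qed
  then show ?thesis
    by (auto simp: RCOSETS_def onto[symmetric] image_image)
qed

lemma iso_image_conj_class:
  assumes f: "f \<in> hom G G'" and G: "group G" "group G'" and K: "K \<subseteq> carrier G" and onto: "f ` carrier G = carrier G'"
  shows "conj_class G' (f ` K) = (`) f ` conj_class G K"
proof -
  interpret group_hom G G' f using f G by (simp add: group_hom_def group_hom_axioms_def)
  have "f ` (\<lambda>k. g \<otimes>\<^bsub>G\<^esub> k \<otimes>\<^bsub>G\<^esub> inv\<^bsub>G\<^esub> g) ` K = (\<lambda>k. f g \<otimes>\<^bsub>G'\<^esub> k \<otimes>\<^bsub>G'\<^esub> inv\<^bsub>G'\<^esub> f g) ` f ` K"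
    if "g \<in> carrier G" for g
    unfolding image_image using that K by (intro image_cong) (auto simp: subset_iff)
  note c = this
  show ?thesis
  proof (intro equalityI subsetI)
    fix L assume "L \<in> conj_class G' (f ` K)"
    then obtain g' where g': "g' \<in> carrier G'" "L = (\<lambda>k. g' \<otimes>\<^bsub>G'\<^esub> k \<otimes>\<^bsub>G'\<^esub> inv\<^bsub>G'\<^esub> g') ` f ` K"
      using conj_class_mem[OF G(2)] by metis
    have "g' \<in> f ` carrier G" using g'(1) onto by simp
    then obtain g0 where "g0 \<in> carrier G" "g' = f g0" by blast
    then obtain g where g: "g \<in> carrier G" "L = f ` (\<lambda>k. g \<otimes>\<^bsub>G\<^esub> k \<otimes>\<^bsub>G\<^esub> inv\<^bsub>G\<^esub> g) ` K"
      using g'(2) c by simp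
    then have "(\<lambda>k. g \<otimes>\<^bsub>G\<^esub> k \<otimes>\<^bsub>G\<^esub> inv\<^bsub>G\<^esub> g) ` K \<in> conj_class G K" using conj_class_mem[OF G(1)] by blast
    then show "L \<in> (`) f ` conj_class G K" using g(2) by blast
  next
    fix L assume "L \<in> (`) f ` conj_class G K"
    then obtain M where M: "M \<in> conj_class G K" "L = f ` M" by blast
    then obtain g where g: "g \<in> carrier G" "M = (\<lambda>k. g \<otimes>\<^bsub>G\<^esub> k \<otimes>\<^bsub>G\<^esub> inv\<^bsub>G\<^esub> g) ` K"
      using conj_class_mem[OF G(1)] by metis
    then have "L = (\<lambda>k. f g \<otimes>\<^bsub>G'\<^esub> k \<otimes>\<^bsub>G'\<^esub> inv\<^bsub>G'\<^esub> f g) ` f ` K" using M(2) c by simp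
    then show "L \<in> conj_class G' (f ` K)"
      unfolding conj_class_mem[OF G(2)] by (rule bexI) (rule hom_closed[OF g(1)])
  qed
qed

definition index_subgroups :: "('a, 'b) monoid_scheme \<Rightarrow> nat \<Rightarrow> 'a set set" where
  "index_subgroups G n = {K. subgroup K G \<and> finite (rcosets\<^bsub>G\<^esub> K) \<and> card (rcosets\<^bsub>G\<^esub> K) = n}"

lemma iso_index_subgroups:
  assumes f: "f \<in> iso G G'" and G: "group G" "group G'"
  shows "index_subgroups G' n = (`) f ` index_subgroups G n"
proof -
  have sub: "f ` K \<in> index_subgroups G' n" if f: "f \<in> iso G G'" and G: "group G" "group G'" and K: "K \<in> index_subgroups G n"
    for f K and G :: "('x, 'y) monoid_scheme" and G' :: "('z, 'w) monoid_scheme"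
  proof -
    have h: "f \<in> hom G G'" "f ` carrier G = carrier G'" "inj_on f (carrier G)"
      using f by (auto simp: iso_def bij_betw_def)
    have K1: "subgroup K G" "K \<subseteq> carrier G" using K subgroup.subset by (auto simp: index_subgroups_def)
    have "subgroup (f ` K) G'"
      by (rule group_hom.subgroup_img_is_subgroup[OF _ K1(1)]) (use h G in \<open>simp add: group_hom_def group_hom_axioms_def\<close>)
    moreover have r: "rcosets\<^bsub>G'\<^esub> (f ` K) = (`) f ` (rcosets\<^bsub>G\<^esub> K)" by (rule iso_image_rcosets[OF h(1) K1(2) h(2)])
    have "rcosets\<^bsub>G\<^esub> K \<subseteq> Pow (carrier G)"
      using subgroup.rcosets_carrier[OF K1(1) G(1)] by blast
    then have "inj_on ((`) f) (rcosets\<^bsub>G\<^esub> K)" using inj_on_image_Pow[OF h(3)] inj_on_subset by blast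
    ultimately show ?thesis using K by (simp add: index_subgroups_def r card_image)
  qed
  show ?thesis
  proof (intro equalityI subsetI)
    fix K' assume K': "K' \<in> index_subgroups G' n"
    let ?g = "inv_into (carrier G) f"
    have g: "?g \<in> iso G' G" using group.iso_set_sym[OF G(1) f] .
    have "K' \<subseteq> f ` carrier G"
      using K' subgroup.subset f unfolding index_subgroups_def iso_def bij_betw_def by blast
    then have "f ` ?g ` K' = K'" by (rule image_inv_into_cancel[OF HOL.refl])
    then show "K' \<in> (`) f ` index_subgroups G n" using sub[OF g G(2,1) K'] by (metis image_eqI)
  qed (use sub[OF f G] in blast)
qed

text \<open>The correspondence respects any property that the isomorphism carries over; it is used for
  the isomorphism type of a subgroup and for the homeomorphism type of its orbit space.\<close>

lemma classes_transport:
  assumes f: "f \<in> iso G G'" and G: "group G" "group G'"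
    and P: "\<And>K. K \<in> index_subgroups G n \<Longrightarrow> P K \<longleftrightarrow> P' (f ` K)"
  obtains b where "bij_betw b (conj_class G ` {K \<in> index_subgroups G n. P K}) (conj_class G' ` {K \<in> index_subgroups G' n. P' K})"
proof -
  have h: "f \<in> hom G G'" "f ` carrier G = carrier G'" "inj_on f (carrier G)"
    using f by (auto simp: iso_def bij_betw_def)
  have K: "K \<subseteq> carrier G" if "K \<in> index_subgroups G n" for K
    using that subgroup.subset by (auto simp: index_subgroups_def)
  have eq: "conj_class G K = conj_class G L \<longleftrightarrow> conj_class G' (f ` K) = conj_class G' (f ` L)"
    if "K \<in> {K \<in> index_subgroups G n. P K}" "L \<in> {K \<in> index_subgroups G n. P K}" for K L
  proof -
    have KL: "K \<subseteq> carrier G" "L \<subseteq> carrier G" using that K by blast+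
    have c: "conj_class G M \<subseteq> Pow (carrier G)" if "M \<subseteq> carrier G" for M
    proof -
      interpret group G by (rule G)
      show ?thesis using that conj_class_mem[OF G(1)] by (auto simp: subset_iff)
    qed
    have "conj_class G' (f ` K) = conj_class G' (f ` L) \<longleftrightarrow> (`) f ` conj_class G K = (`) f ` conj_class G L"
      by (simp add: iso_image_conj_class[OF h(1) G _ h(2)] KL)
    also have "\<dots> \<longleftrightarrow> conj_class G K = conj_class G L"
      by (rule inj_on_image_eq_iff[OF inj_on_image_Pow[OF h(3)] c c]) (use KL in auto)
    finally show ?thesis by simp
  qed
  obtain b where b: "bij_betw b (conj_class G ` {K \<in> index_subgroups G n. P K})
      ((\<lambda>K. conj_class G' (f ` K)) ` {K \<in> index_subgroups G n. P K})"
    using bij_betw_images[OF eq] .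
  have "{K \<in> index_subgroups G' n. P' K} = (`) f ` {K \<in> index_subgroups G n. P K}"
    unfolding iso_index_subgroups[OF f G] using P by blast
  then show ?thesis using b that by (simp add: image_image)
qed

section \<open>Orbits of quarter turns\<close>

text \<open>Burnside's lemma for a cyclic group of order four. Give \<open>x\<close> the weight 1, plus 2 if \<open>f\<close> fixes it,
  plus 1 if \<open>f \<circ> f\<close> fixes it: the weights of an orbit then add up to 4, whether it has one, two or
  four elements.\<close>

lemma card_orbits_period_4:
  fixes f :: "'a \<Rightarrow> 'a"
  assumes fin: "finite A" and cl: "\<And>x. x \<in> A \<Longrightarrow> f x \<in> A" and f4: "\<And>x. x \<in> A \<Longrightarrow> f (f (f (f x))) = x"
  shows "4 * card ((\<lambda>x. {x, f x, f (f x), f (f (f x))}) ` A) =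
    card A + 2 * card {x \<in> A. f x = x} + card {x \<in> A. f (f x) = x}"
proof -
  let ?o = "\<lambda>x. {x, f x, f (f x), f (f (f x))}"
  define w :: "'a \<Rightarrow> nat" where "w x = 1 + (2 * of_bool (f x = x) + of_bool (f (f x) = x))" for x
  have "sum w A = card A + (2 * (\<Sum>x\<in>A. of_bool (f x = x)) + (\<Sum>x\<in>A. of_bool (f (f x) = x)))"
    unfolding w_def sum.distrib sum_distrib_left[symmetric] by simp
  also have "\<dots> = card A + 2 * card {x \<in> A. f x = x} + card {x \<in> A. f (f x) = x}"
    using fin by (simp add: sum_of_bool_eq Int_def)
  finally have wA: "sum w A = card A + 2 * card {x \<in> A. f x = x} + card {x \<in> A. f (f x) = x}" .
  have o: "{y \<in> A. ?o y = ?o x} = ?o x" if x: "x \<in> A" for x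
  proof -
    have "?o (f x) = ?o x" "?o (f (f x)) = ?o x" "?o (f (f (f x))) = ?o x" using f4[OF x] by auto
    moreover have "y \<in> ?o x" if "?o y = ?o x" for y
    proof -
      have "y \<in> ?o y" by simp
      then show ?thesis by (simp only: that)
    qed
    ultimately show ?thesis using x cl by auto
  qed
  have "sum w (?o x) = 4" if x: "x \<in> A" for x
  proof -
    note e = f4[OF x]
    consider "f x = x" | "f x \<noteq> x" "f (f x) = x" | "f (f x) \<noteq> x" by blast
    then show ?thesis
    proof cases
      case 1
      then show ?thesis by (simp add: w_def)
    next
      case 2
      then have "?o x = {x, f x}" by auto
      then show ?thesis using 2 by (simp add: w_def)
    next
      case 3
      have a: "f x \<noteq> x" using 3 by auto
      have b: "f (f (f x)) \<noteq> x" using e a by metis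
      have c: "f (f x) \<noteq> f x" using e 3 by metis
      have d: "f (f (f x)) \<noteq> f x" using e 3 by metis
      have g: "f (f (f x)) \<noteq> f (f x)" using e b by metis
      have "w x = 1" "w (f x) = 1" "w (f (f x)) = 1" "w (f (f (f x))) = 1"
        using 3 a b c d g e by (auto simp: w_def)
      then show ?thesis using 3 a b c d g by auto
    qed
  qed
  then have "sum w {y \<in> A. ?o y = ?o x} = 4" if "x \<in> A" for x using o that by simp
  then have "(\<Sum>C\<in>?o ` A. sum w {y \<in> A. ?o y = C}) = (\<Sum>C\<in>?o ` A. 4)" by (intro sum.cong) auto
  moreover have "sum w A = (\<Sum>C\<in>?o ` A. sum w {y \<in> A. ?o y = C})" by (rule sum.image_gen[OF fin])
  ultimately show ?thesis using wA by simp
qed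

lemma rot_orbit_eq:
  "rot_orbit x = {x, rot_pair 1 x, rot_pair 1 (rot_pair 1 x), rot_pair 1 (rot_pair 1 (rot_pair 1 x))}"
proof -
  have p: "rot_pair 1 (rot_pair 1 x) = rot_pair 2 x" "rot_pair 1 (rot_pair 2 x) = rot_pair 3 x"
    by (simp_all add: rot_pair_add[symmetric])
  have "rot_pair j x \<in> {x, rot_pair 1 x, rot_pair 2 x, rot_pair 3 x}" for j
  proof -
    have m: "rot_pair j x = rot_pair (j mod 4) x" by (simp add: rot_pair_def rot_def)
    show ?thesis using mod4_cases[of j] by (subst m) auto
  qed
  moreover have "x = rot_pair 0 x" by simp
  ultimately show ?thesis unfolding rot_orbit_def p by blast
qed

lemma rot_pair_4: "rot_pair 1 (rot_pair 1 (rot_pair 1 (rot_pair 1 x))) = x"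
  by (simp add: rot_pair_add[symmetric]) (simp add: rot_pair_def rot_id)

section \<open>Cosets of lattices\<close>

definition cosets :: "(int \<times> int) set \<Rightarrow> (int \<times> int) set set" where
  "cosets L = range (\<lambda>u. (+) u ` L)"

lemma coset_eq_iff:
  assumes L: "add_subgroup L"
  shows "(+) u ` L = (+) v ` L \<longleftrightarrow> u - v \<in> L"
proof
  assume e: "(+) u ` L = (+) v ` L"
  have "u \<in> (+) u ` L" using add_subgroup_0[OF L] by (intro image_eqI[of _ _ 0]) simp_all
  then obtain l where "l \<in> L" "u = v + l" unfolding e by blast
  then show "u - v \<in> L" by simp
next
  assume uv: "u - v \<in> L"
  show "(+) u ` L = (+) v ` L"
  proof (intro equalityI subsetI)
    fix x assume "x \<in> (+) u ` L"
    then obtain l where "l \<in> L" "x = u + l" by blast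
    then show "x \<in> (+) v ` L"
      using add_subgroup_add[OF L uv, of l] by (intro image_eqI[of _ _ "u - v + l"]) simp_all
  next
    fix x assume "x \<in> (+) v ` L"
    then obtain l where "l \<in> L" "x = v + l" by blast
    then show "x \<in> (+) u ` L"
      using add_subgroup_diff[OF L _ uv, of l] by (intro image_eqI[of _ _ "l - (u - v)"]) simp_all
  qed
qed

lemma card_coset_image:
  assumes L: "add_subgroup L" and h: "\<And>a b. a \<in> A \<Longrightarrow> b \<in> A \<Longrightarrow> g a - g b \<in> L \<longleftrightarrow> h a = h b"
  shows "card ((\<lambda>a. (+) (g a) ` L) ` A) = card (h ` A)"
    and "finite (h ` A) \<Longrightarrow> finite ((\<lambda>a. (+) (g a) ` L) ` A)"
proof -
  have eq: "(+) (g a) ` L = (+) (g b) ` L \<longleftrightarrow> h a = h b" if "a \<in> A" "b \<in> A" for a b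
    using coset_eq_iff[OF L] h[OF that] by simp
  obtain b where b: "bij_betw b ((\<lambda>a. (+) (g a) ` L) ` A) (h ` A)" using bij_betw_images[OF eq] .
  show "card ((\<lambda>a. (+) (g a) ` L) ` A) = card (h ` A)" using bij_betw_same_card[OF b] .
  show "finite (h ` A) \<Longrightarrow> finite ((\<lambda>a. (+) (g a) ` L) ` A)" using bij_betw_finite[OF b] by simp
qed

lemma card_cosets:
  assumes "add_subgroup L" and "\<And>u v. u - v \<in> L \<longleftrightarrow> h u = h v"
  shows "card (cosets L) = card (range h)" "finite (range h) \<Longrightarrow> finite (cosets L)"
  unfolding cosets_def using card_coset_image[of L UNIV "\<lambda>u. u" h] assms by auto

lemma card_cosets_lattice:
  assumes "L \<in> lattices k"
  shows "card (cosets L) = k" "finite (cosets L)"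
proof -
  obtain a b d where L: "L = lat a b d" "0 < a" "0 < d" "a * d = int k" using assms by (auto simp: lattices_def)
  have h: "u - v \<in> L \<longleftrightarrow> lat_res a b d u = lat_res a b d v" for u v
    using lat_res_eq[OF L(2,3)] L(1) by simp
  have "nat a * nat d = k" using nat_mult_distrib[of a d] L by simp
  then show "card (cosets L) = k" "finite (cosets L)"
    using card_cosets[OF lattices_add_subgroup[OF assms] h] lat_res_range[OF L(2,3), of b]
    by (simp_all add: card_cartesian_product mult.commute)
qed

lemma rot_image_mem: "v \<in> rot j ` L \<longleftrightarrow> rot (- j) v \<in> L"
  by (metis image_iff rot_cancel)

lemma add_subgroup_rot: "add_subgroup L \<Longrightarrow> add_subgroup (rot j ` L)"
  unfolding add_subgroup_def rot_image_mem by simp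

lemma rot_image_coset: "rot j ` (+) u ` L = (+) (rot j u) ` rot j ` (L :: (int \<times> int) set)"
  by (simp add: image_image)

text \<open>The turned set contains \<open>k\<close> times the unit vectors, so it is a lattice, and a bijection between the
  cosets shows that its index is again \<open>k\<close>.\<close>

lemma lattices_rot:
  assumes L: "L \<in> lattices k"
  shows "rot j ` L \<in> lattices k"
proof -
  have A: "add_subgroup L" using L by (rule lattices_add_subgroup)
  have A': "add_subgroup (rot j ` L)" by (rule add_subgroup_rot[OF A])
  obtain a b d where ab: "L = lat a b d" "0 < a" "0 < d" "a * d = int k" using L by (auto simp: lattices_def)
  have "smul d (a, 0) \<in> L" "smul a (b, d) - smul b (a, 0) \<in> L"
    unfolding ab(1) by (intro add_subgroup_smul add_subgroup_diff add_subgroup_lat lat_basis)+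
  then have "(int k, 0) \<in> L" "(0, int k) \<in> L" using ab(4) by (simp_all add: mult.commute)
  then have n: "(int k, 0) \<in> L" "(0, int k) \<in> L" "- (int k, 0) \<in> L" "- (0, int k) \<in> L"
    using add_subgroup_minus[OF A] by blast+
  have "(int k, 0) \<in> rot j ` L" "(0, int k) \<in> rot j ` L"
    unfolding rot_image_mem using mod4_cases[of "- j"] n by (auto simp: rot_def)
  then obtain k' where k': "rot j ` L \<in> lattices k'"
    using add_subgroup_lattice[OF A', of "int k" "int k"] lattices_pos[OF L] by auto
  have "cosets (rot j ` L) = (`) (rot j) ` cosets L"
  proof (intro equalityI subsetI)
    fix C assume "C \<in> cosets (rot j ` L)"
    then obtain u where "C = (+) u ` rot j ` L" by (auto simp: cosets_def)
    then have "C = rot j ` (+) (rot (- j) u) ` L" by (simp only: rot_image_coset rot_cancel)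
    then show "C \<in> (`) (rot j) ` cosets L" unfolding cosets_def by blast
  next
    fix C assume "C \<in> (`) (rot j) ` cosets L"
    then obtain u where "C = rot j ` (+) u ` L" by (auto simp: cosets_def)
    then show "C \<in> cosets (rot j ` L)" unfolding rot_image_coset cosets_def by blast
  qed
  moreover have "inj (rot j :: int \<times> int \<Rightarrow> int \<times> int)" by (auto simp: inj_def)
  then have "inj_on ((`) (rot j)) (cosets L)" by (auto simp: inj_on_def inj_image_eq_iff)
  ultimately have "card (cosets (rot j ` L)) = card (cosets L)" by (simp add: card_image)
  then have "k' = k" using card_cosets_lattice(1) L k' by simp
  then show ?thesis using k' by simp
qed

text \<open>In the normal form \<open>a\<close> is any divisor of \<open>k\<close> and \<open>b\<close> any residue modulo \<open>a\<close>.\<close>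

lemma lattices_param:
  assumes k: "0 < k"
  shows "bij_betw (\<lambda>(a, b). lat (int a) (int b) (int (k div a))) (SIGMA a:{a. a dvd k}. {..<a}) (lattices k)"
  unfolding bij_betw_def
proof
  let ?f = "\<lambda>(a, b). lat (int a) (int b) (int (k div a))"
  have pos: "0 < a \<and> 0 < k div a" if "a dvd k" for a
    using that k by (auto simp: div_greater_zero_iff dvd_imp_le intro: Nat.gr0I)
  show "inj_on ?f (SIGMA a:{a. a dvd k}. {..<a})"
  proof (rule inj_onI)
    fix p q assume p: "p \<in> (SIGMA a:{a. a dvd k}. {..<a})" and q: "q \<in> (SIGMA a:{a. a dvd k}. {..<a})"
      and e: "?f p = ?f q"
    obtain a b where ab: "p = (a, b)" by (cases p)
    obtain a' b' where ab': "q = (a', b')" by (cases q)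
    have "int a = int a' \<and> int b = int b' \<and> int (k div a) = int (k div a')"
      by (rule lat_inject) (use p q e ab ab' pos in auto)
    then show "p = q" by (simp add: ab ab')
  qed
  show "?f ` (SIGMA a:{a. a dvd k}. {..<a}) = lattices k"
  proof (intro equalityI subsetI)
    fix L assume "L \<in> ?f ` (SIGMA a:{a. a dvd k}. {..<a})"
    then obtain a b where ab: "a dvd k" "b < a" "L = lat (int a) (int b) (int (k div a))" by auto
    have "a * (k div a) = k" using ab(1) by simp
    then have "int a * int (k div a) = int k" by (metis of_nat_mult)
    then show "L \<in> lattices k" unfolding lattices_def mem_Collect_eq
      using ab pos[OF ab(1)] by (intro exI[of _ "int a"] exI[of _ "int b"] exI[of _ "int (k div a)"]) simp
  next
    fix L assume "L \<in> lattices k"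
    then obtain a b d where L: "L = lat a b d" "0 < a" "0 < d" "0 \<le> b" "b < a" "a * d = int k"
      by (auto simp: lattices_def)
    have kk: "nat a * nat d = k" using nat_mult_distrib[of a d] L by simp
    then have "nat a dvd k" "k div nat a = nat d" using L(2) by (auto simp: dvd_def)
    then have "L = ?f (nat a, nat b)" "(nat a, nat b) \<in> (SIGMA a:{a. a dvd k}. {..<a})"
      using L by (simp_all add: nat_less_eq_zless)
    then show "L \<in> ?f ` (SIGMA a:{a. a dvd k}. {..<a})" by (rule image_eqI)
  qed
qed

lemma finite_lattices: "0 < k \<Longrightarrow> finite (lattices k)"
  using bij_betw_finite[OF lattices_param] finite_divisors_nat by (metis finite_SigmaI finite_lessThan)

lemma sum_lattices:
  assumes k: "0 < k"
  shows "(\<Sum>L\<in>lattices k. g L) = (\<Sum>a | a dvd k. \<Sum>b<a. g (lat (int a) (int b) (int (k div a))))"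
proof -
  have "(\<Sum>L\<in>lattices k. g L) = (\<Sum>(a, b)\<in>(SIGMA a:{a. a dvd k}. {..<a}). g (lat (int a) (int b) (int (k div a))))"
    using sum.reindex_bij_betw[OF lattices_param[OF k], of g] by (simp add: case_prod_unfold)
  then show ?thesis using finite_divisors_nat[OF k] by (simp add: sum.Sigma)
qed

lemma card_lattices:
  assumes "0 < k" shows "card (lattices k) = (\<Sum>a | a dvd k. a)"
  using sum_lattices[OF assms, of "\<lambda>_. 1 :: nat"] by simp

section \<open>Two-torsion and reduction modulo two\<close>

text \<open>The number of elements of order at most two in the quotient of the plane by \<^term>\<open>lat a b d\<close>, and at
  the same time the order of that quotient reduced modulo two.\<close>

definition two_torsion :: "int \<Rightarrow> int \<Rightarrow> int \<Rightarrow> nat" where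
  "two_torsion a b d = (if odd a \<and> odd d then 1 else if odd a \<or> odd d \<or> odd b then 2 else 4)"

text \<open>For odd \<open>a\<close> one can divide by 2; for even \<open>a\<close> the solutions come in pairs \<open>z\<close>, \<open>z + a / 2\<close>.\<close>

lemma card_half_solutions:
  assumes a: "0 < (a :: int)"
  shows "card {x \<in> {0..<a}. a dvd 2 * x - c} = (if odd a then 1 else if even c then 2 else 0)"
proof -
  consider "odd a" | "even a" "even c" | "even a" "odd c" by blast
  then show ?thesis
  proof cases
    case 1
    \<comment> \<open>(a + 1) / 2 is the inverse of 2 modulo a.\<close>
    define z where "z = (c * ((a + 1) div 2)) mod a"
    have "2 * ((a + 1) div 2) = a + 1" using 1 by presburger
    then have "2 * (c * ((a + 1) div 2)) = c * a + c" by (metis distrib_left mult.left_commute mult_1_right)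
    moreover have "a dvd c * ((a + 1) div 2) - z" by (simp add: z_def minus_mod_eq_mult_div)
    then have "a dvd 2 * (c * ((a + 1) div 2)) - 2 * z" by (metis dvd_mult right_diff_distrib)
    ultimately have "a dvd c * a + (c - 2 * z)" by (simp add: algebra_simps)
    then have z: "a dvd c - 2 * z" by (simp add: dvd_add_right_iff)
    have "a dvd 2 * x - c \<longleftrightarrow> x = z" if x: "x \<in> {0..<a}" for x
    proof
      assume "a dvd 2 * x - c"
      then have "a dvd 2 * (x - z)" using dvd_add[OF _ z, of "2 * x - c"] by (simp add: algebra_simps)
      moreover have "coprime a 2" using 1 by simp
      ultimately have "a dvd x - z" using coprime_dvd_mult_right_iff[of a 2 "x - z"] by blast
      moreover have "0 \<le> z" "z < a" using a by (simp_all add: z_def)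
      then have "\<bar>x - z\<bar> < a" using x by auto
      ultimately show "x = z" using zdvd_imp_le[of a "\<bar>x - z\<bar>"] by fastforce
    next
      assume "x = z"
      then show "a dvd 2 * x - c" using z by (metis dvd_minus_iff minus_diff_eq)
    qed
    moreover have "z \<in> {0..<a}" using a by (simp add: z_def)
    ultimately have "{x \<in> {0..<a}. a dvd 2 * x - c} = {z}" by blast
    then show ?thesis using 1 by simp
  next
    case 2
    then obtain a' c' where e: "a = 2 * a'" "c = 2 * c'" by (auto elim!: evenE)
    have a': "0 < a'" using a e by simp
    define z where "z = c' mod a'"
    have z: "0 \<le> z" "z < a'" using a' by (simp_all add: z_def)
    have dz: "a' dvd x - c' \<longleftrightarrow> a' dvd x - z" for x
      by (metis z_def mod_eq_dvd_iff mod_mod_trivial)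
    have "a dvd 2 * x - c \<longleftrightarrow> x = z \<or> x = z + a'" if x: "x \<in> {0..<a}" for x
    proof -
      have "2 * a' dvd 2 * (x - c') \<longleftrightarrow> a' dvd x - c'"
        by (rule dvd_times_left_cancel_iff) simp
      then have "a dvd 2 * x - c \<longleftrightarrow> a' dvd x - z" unfolding dz[symmetric] e right_diff_distrib .
      also have "\<dots> \<longleftrightarrow> x = z \<or> x = z + a'"
      proof
        assume "a' dvd x - z"
        then obtain q where q: "x - z = a' * q" by (auto simp: dvd_def)
        have "a' * q < a' * 2" "a' * (- 1) < a' * q" unfolding q[symmetric] using x z e by simp_all
        then have "q < 2" "- 1 < q" using mult_less_cancel_left_pos[OF a'] by blast+
        then have "q = 0 \<or> q = 1" by linarith
        then show "x = z \<or> x = z + a'" using q by auto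
      qed auto
      finally show ?thesis .
    qed
    moreover have "z \<in> {0..<a}" "z + a' \<in> {0..<a}" using z e by auto
    ultimately have "{x \<in> {0..<a}. a dvd 2 * x - c} = {z, z + a'}" by blast
    then show ?thesis using 2 a' by simp
  next
    case 3
    have "\<not> a dvd 2 * x - c" for x
    proof
      assume "a dvd 2 * x - c"
      then have "2 dvd 2 * x - c" using 3(1) dvd_trans by blast
      then show False using 3(2) by simp
    qed
    then show ?thesis using 3 by simp
  qed
qed

text \<open>A half turn is negation, so it fixes the coset of \<open>u\<close> exactly if \<open>2 u\<close> lies in the lattice. For a
  reduced \<open>u = (x, y)\<close> this leaves \<open>y = 0\<close> and \<open>y = d / 2\<close>, each with a congruence for \<open>2 x\<close>.\<close>

lemma card_two_torsion:
  assumes ad: "0 < a" "0 < d"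
  shows "card {C \<in> cosets (lat a b d). rot 2 ` C = C} = two_torsion a b d"
proof -
  let ?L = "lat a b d"
  have A: "add_subgroup ?L" by (rule add_subgroup_lat)
  have L2: "rot 2 ` ?L = ?L"
  proof -
    have "rot (- 2) v \<in> ?L \<longleftrightarrow> v \<in> ?L" for v
      using add_subgroup_minus[OF A, of v] add_subgroup_minus[OF A, of "- v"] by (auto simp: rot_def prod_eq_iff uminus_prod_def)
    then show ?thesis using rot_image_mem by blast
  qed
  have "rot 2 ` (+) u ` ?L = (+) u ` ?L \<longleftrightarrow> smul 2 u \<in> ?L" for u
  proof -
    have "rot 2 u - u = - smul 2 u" by (simp add: rot_def prod_eq_iff smul_def)
    then show ?thesis
      unfolding rot_image_coset L2 coset_eq_iff[OF A]
      using add_subgroup_minus[OF A, of "smul 2 u"] add_subgroup_minus[OF A, of "- smul 2 u"] by auto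
  qed
  then have "{C \<in> cosets ?L. rot 2 ` C = C} = (\<lambda>u. (+) u ` ?L) ` {u. smul 2 u \<in> ?L}"
    unfolding cosets_def by blast
  then have "card {C \<in> cosets ?L. rot 2 ` C = C} = card (lat_res a b d ` {u. smul 2 u \<in> ?L})"
    using card_coset_image(1)[OF A, of "{u. smul 2 u \<in> ?L}" "\<lambda>u. u" "lat_res a b d"] lat_res_eq[OF ad] by simp
  also have "lat_res a b d ` {u. smul 2 u \<in> ?L} = {(y, x). y \<in> {0..<d} \<and> x \<in> {0..<a} \<and> (2 * x, 2 * y) \<in> ?L}"
  proof (intro equalityI subsetI)
    fix z assume "z \<in> lat_res a b d ` {u. smul 2 u \<in> ?L}"
    then obtain u where u: "smul 2 u \<in> ?L" "z = lat_res a b d u" by blast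
    obtain y x where yx: "z = (y, x)" by (cases z)
    have r: "y \<in> {0..<d}" "x \<in> {0..<a}" using lat_res_range[OF ad, of b] u(2) yx by (metis mem_Sigma_iff rangeI)+
    then have "lat_res a b d u = lat_res a b d (x, y)" using u(2) yx by (simp add: lat_res_fixed)
    then have "u - (x, y) \<in> ?L" using lat_res_eq[OF ad] by simp
    then have "smul 2 u - smul 2 (u - (x, y)) \<in> ?L" using add_subgroup_diff[OF A u(1) add_subgroup_smul[OF A]] by blast
    moreover have "smul 2 u - smul 2 (u - (x, y)) = (2 * x, 2 * y)" by (simp add: smul_def)
    ultimately show "z \<in> {(y, x). y \<in> {0..<d} \<and> x \<in> {0..<a} \<and> (2 * x, 2 * y) \<in> ?L}" using r yx by simp
  next
    fix z assume "z \<in> {(y, x). y \<in> {0..<d} \<and> x \<in> {0..<a} \<and> (2 * x, 2 * y) \<in> ?L}"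
    then have "z = lat_res a b d (snd z, fst z)" "smul 2 (snd z, fst z) \<in> ?L" by (auto simp: lat_res_fixed)
    then show "z \<in> lat_res a b d ` {u. smul 2 u \<in> ?L}" by blast
  qed
  also have "\<dots> = {0} \<times> {x \<in> {0..<a}. a dvd 2 * x - 0} \<union>
      (if even d then {d div 2} \<times> {x \<in> {0..<a}. a dvd 2 * x - b} else {})"
  proof -
    have "(2 * x, 2 * y) \<in> ?L \<longleftrightarrow> (y = 0 \<and> a dvd 2 * x - 0) \<or> (even d \<and> y = d div 2 \<and> a dvd 2 * x - b)"
      if y: "y \<in> {0..<d}" for x y
    proof
      assume "(2 * x, 2 * y) \<in> ?L"
      then obtain j where j: "2 * y = d * j" "a dvd 2 * x - b * j" by (auto simp: lat_mem)
      have "d * j < d * 2" "d * (- 1) < d * j" unfolding j(1)[symmetric] using y ad by simp_all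
      then have "j < 2" "- 1 < j" using mult_less_cancel_left_pos[OF ad(2)] by blast+
      then have "j = 0 \<or> j = 1" by linarith
      then show "(y = 0 \<and> a dvd 2 * x - 0) \<or> (even d \<and> y = d div 2 \<and> a dvd 2 * x - b)" using j by auto
    next
      assume "(y = 0 \<and> a dvd 2 * x - 0) \<or> (even d \<and> y = d div 2 \<and> a dvd 2 * x - b)"
      then show "(2 * x, 2 * y) \<in> ?L"
        unfolding lat_mem by (elim disjE) (auto intro: exI[of _ 0] exI[of _ 1])
    qed
    moreover have "0 \<in> {0..<d}" "even d \<Longrightarrow> d div 2 \<in> {0..<d}" using ad by auto
    ultimately show ?thesis by auto
  qed
  also have "card \<dots> = card {x \<in> {0..<a}. a dvd 2 * x - 0} + (if even d then card {x \<in> {0..<a}. a dvd 2 * x - b} else 0)"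
  proof (cases "even d")
    case True
    then have "d div 2 \<noteq> 0" using ad by auto
    define S where "S c = {x \<in> {0..<a}. a dvd 2 * x - c}" for c
    have fin: "finite (S c)" for c
      by (rule finite_subset[of _ "{0..<a}"]) (auto simp: S_def)
    have "card ({0} \<times> S 0 \<union> {d div 2} \<times> S b) = card ({0 :: int} \<times> S 0) + card ({d div 2} \<times> S b)"
    proof (rule card_Un_disjoint)
      show "finite ({0 :: int} \<times> S 0)" "finite ({d div 2} \<times> S b)"
        by (intro finite_cartesian_product fin finite.insertI finite.emptyI)+
      show "{0} \<times> S 0 \<inter> {d div 2} \<times> S b = {}"
        using \<open>d div 2 \<noteq> 0\<close> by (simp add: Times_Int_Times)
    qed
    then show ?thesis
      unfolding S_def[symmetric] if_P[OF True] card_cartesian_product_singleton .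
  qed (simp add: card_cartesian_product_singleton)
  also have "\<dots> = two_torsion a b d"
    unfolding card_half_solutions[OF ad(1)] by (simp add: two_torsion_def)
  finally show ?thesis .
qed

lemma shear_2_mem:
  assumes m: "m mod 4 = 2"
  shows "(x, y) \<in> shear m (lat a b d) \<longleftrightarrow> (\<exists>i j. even (x - a * i - b * j) \<and> even (y - d * j))"
proof
  assume "(x, y) \<in> shear m (lat a b d)"
  then obtain i j w where "(x, y) = smul i (a, 0) + smul j (b, d) + (w - rot m w)"
    unfolding shear_def lat_span by blast
  moreover have "w - rot m w = (2 * fst w, 2 * snd w)" using m by (simp add: rot_def prod_eq_iff)
  ultimately have "x - a * i - b * j = 2 * fst w" "y - d * j = 2 * snd w" by (simp_all add: algebra_simps)
  then show "\<exists>i j. even (x - a * i - b * j) \<and> even (y - d * j)" by (metis dvd_triv_left)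
next
  assume "\<exists>i j. even (x - a * i - b * j) \<and> even (y - d * j)"
  then obtain i j where e: "even (x - a * i - b * j)" "even (y - d * j)" by blast
  obtain p where p: "x - a * i - b * j = 2 * p" using e(1) by (rule evenE)
  obtain q where q: "y - d * j = 2 * q" using e(2) by (rule evenE)
  have "(x, y) = (smul i (a, 0) + smul j (b, d)) + ((p, q) - rot m (p, q))"
    using m p q by (simp add: rot_def algebra_simps)
  moreover have "smul i (a, 0) + smul j (b, d) \<in> lat a b d" unfolding lat_span by blast
  ultimately show "(x, y) \<in> shear m (lat a b d)" using shearI by metis
qed

lemma add_subgroup_shear:
  assumes L: "add_subgroup L" shows "add_subgroup (shear m L)"
  unfolding add_subgroup_def
proof (intro conjI ballI)
  have "0 + (0 - rot m 0) \<in> shear m L" by (rule shearI[OF add_subgroup_0[OF L]])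
  then show "0 \<in> shear m L" by simp
  fix v w assume "v \<in> shear m L" "w \<in> shear m L"
  then obtain l a l' a' where "l \<in> L" "v = l + (a - rot m a)" "l' \<in> L" "w = l' + (a' - rot m a')"
    by (auto simp: shear_def)
  then have "v - w = (l - l') + ((a - a') - rot m (a - a'))" "l - l' \<in> L"
    using add_subgroup_diff[OF L] by (simp_all add: algebra_simps)
  then show "v - w \<in> shear m L" using shearI by metis
qed

lemma range_bool:
  assumes "P u" "\<not> P v" shows "range P = (UNIV :: bool set)"
proof -
  have "b \<in> range P" for b
  proof (cases b)
    case True
    then show ?thesis using assms(1) by (intro image_eqI[of _ P u]) simp_all
  next
    case False
    then show ?thesis using assms(2) by (intro image_eqI[of _ P v]) simp_all
  qed
  then show ?thesis by blast
qed

text \<open>The shear is the sum of the lattice and \<open>2 \<int>\<^sup>2\<close>, so membership is a condition on parities, which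
  depends on the parities of \<open>a\<close>, \<open>b\<close> and \<open>d\<close>.\<close>

lemma card_cosets_shear_2:
  assumes m: "m mod 4 = 2"
  shows "card (cosets (shear m (lat a b d))) = two_torsion a b d" "finite (cosets (shear m (lat a b d)))"
proof -
  let ?S = "shear m (lat a b d)"
  have A: "add_subgroup ?S" by (rule add_subgroup_shear[OF add_subgroup_lat])
  have one: "\<exists>j :: int. j = 0" "\<exists>j :: int. j = 1" by auto
  have "card (cosets ?S) = two_torsion a b d \<and> finite (cosets ?S)"
  proof -
    consider "odd a" "odd d" | "odd a" "even d" | "even a" "odd d" | "even a" "even d" "odd b" | "even a" "even d" "even b"
      by blast
    then show ?thesis
    proof cases
      case 1
      have "(x, y) \<in> ?S" for x y
        unfolding shear_2_mem[OF m] using 1 by (intro exI[of _ "x - b * y"] exI[of _ y]) auto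
      then have "u - v \<in> ?S \<longleftrightarrow> True = True" for u v by (metis surj_pair)
      then show ?thesis using card_cosets[OF A, of "\<lambda>_. True"] 1 by (simp add: two_torsion_def)
    next
      case 2
      have "(x, y) \<in> ?S \<longleftrightarrow> even y" for x y
      proof -
        have "even (x - a * x - b * 0) \<and> even (y - d * 0)" if "even y" using 2 that by simp
        then show ?thesis unfolding shear_2_mem[OF m] using 2 by (auto simp del: mult_zero_right)
      qed
      then have "u - v \<in> ?S \<longleftrightarrow> even (snd u) = even (snd v)" for u v by (cases u; cases v) auto
      moreover have "range (\<lambda>u :: int \<times> int. even (snd u)) = UNIV"
        by (rule range_bool[of _ "(0, 0)" "(0, 1)"]) simp_all
      ultimately show ?thesis using card_cosets[OF A, of "\<lambda>u. even (snd u)"] 2 by (simp add: two_torsion_def)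
    next
      case 3
      have "(x, y) \<in> ?S \<longleftrightarrow> even (x - b * y)" for x y
        unfolding shear_2_mem[OF m] using 3 by (auto intro!: exI[of _ 0] exI[of _ y])
      then have "u - v \<in> ?S \<longleftrightarrow> even (fst u - b * snd u) = even (fst v - b * snd v)" for u v
        by (cases u; cases v) auto
      moreover have "range (\<lambda>u :: int \<times> int. even (fst u - b * snd u)) = UNIV"
        by (rule range_bool[of _ "(0, 0)" "(1, 0)"]) simp_all
      ultimately show ?thesis using card_cosets[OF A, of "\<lambda>u. even (fst u - b * snd u)"] 3 by (simp add: two_torsion_def)
    next
      case 4
      have "(x, y) \<in> ?S \<longleftrightarrow> even y" for x y
      proof -
        have "even (x - a * 0 - b * x) \<and> even (y - d * x)" if "even y" using 4 that by simp
        then show ?thesis unfolding shear_2_mem[OF m] using 4 by (auto simp del: mult_zero_right)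
      qed
      then have "u - v \<in> ?S \<longleftrightarrow> even (snd u) = even (snd v)" for u v by (cases u; cases v) auto
      moreover have "range (\<lambda>u :: int \<times> int. even (snd u)) = UNIV"
        by (rule range_bool[of _ "(0, 0)" "(0, 1)"]) simp_all
      ultimately show ?thesis using card_cosets[OF A, of "\<lambda>u. even (snd u)"] 4 by (simp add: two_torsion_def)
    next
      case 5
      have "(x, y) \<in> ?S \<longleftrightarrow> even x \<and> even y" for x y
        unfolding shear_2_mem[OF m] using 5 by auto
      then have "u - v \<in> ?S \<longleftrightarrow> (even (fst u), even (snd u)) = (even (fst v), even (snd v))" for u v
        by (cases u; cases v) auto
      moreover have "range (\<lambda>u :: int \<times> int. (even (fst u), even (snd u))) = UNIV"
      proof -
        have "(p, q) \<in> range (\<lambda>u :: int \<times> int. (even (fst u), even (snd u)))" for p q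
          by (rule image_eqI[of _ _ "(of_bool (\<not> p), of_bool (\<not> q))"]) auto
        then show ?thesis by auto
      qed
      moreover have "card (UNIV :: (bool \<times> bool) set) = 4" by (simp add: card_prod)
      ultimately show ?thesis using card_cosets[OF A, of "\<lambda>u. (even (fst u), even (snd u))"] 5 by (simp add: two_torsion_def)
    qed
  qed
  then show "card (cosets ?S) = two_torsion a b d" "finite (cosets ?S)" by auto
qed

section \<open>Counting ideals and the cosets they fix\<close>

definition ideals :: "nat \<Rightarrow> (int \<times> int) set set" where
  "ideals k = {L \<in> lattices k. \<forall>v\<in>L. rot 1 v \<in> L}"

lemma gauss_mul_commute: "gauss_mul p q = gauss_mul q p"
  by (cases p; cases q) (simp add: gauss_mul_simp algebra_simps)

lemma gauss_norm_0 [simp]: "gauss_norm 0 = 0"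
  by (simp add: gauss_norm_def)

lemma gauss_mul_0 [simp]: "gauss_mul q 0 = 0"
  by (cases q) (simp add: gauss_mul_simp zero_prod_def)

lemma gauss_mul_cancel: "v \<noteq> 0 \<Longrightarrow> gauss_mul p v = gauss_mul q v \<longleftrightarrow> p = q"
proof
  assume v: "v \<noteq> 0" and "gauss_mul p v = gauss_mul q v"
  then have "gauss_mul (p - q) v = 0" by (simp add: gauss_mul_add)
  then have "gauss_norm (p - q) * gauss_norm v = 0" using gauss_norm_gauss_mul[of "p - q" v] by simp
  then show "p = q" using v gauss_norm_eq_0[of v] gauss_norm_eq_0[of "p - q"] by simp
qed simp

lemma gauss_mul_rot_shift: "gauss_mul q (rot j v) = gauss_mul (rot j q) v"
  using mod4_cases[of j] by (cases q; cases v) (auto simp: gauss_mul_simp rot_def)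

lemma gauss_ideal_rot_eq: "gauss_ideal (rot j v) = gauss_ideal v"
proof -
  have "gauss_mul q v \<in> range (\<lambda>q. gauss_mul (rot j q) v)" for q
    by (rule image_eqI[of _ _ "rot (- j) q"]) simp_all
  then show ?thesis unfolding gauss_ideal_def gauss_mul_rot_shift by blast
qed

lemma quadrant:
  assumes "v \<noteq> 0" obtains j where "0 < fst (rot j v)" "0 \<le> snd (rot j (v :: int \<times> int))"
proof -
  obtain s t where v: "v = (s, t)" by (cases v)
  consider "0 < s" "0 \<le> t" | "0 \<le> s" "t < 0" | "s < 0" "t \<le> 0" | "s \<le> 0" "0 < t"
    using assms unfolding v zero_prod_def by fastforce
  then show ?thesis
  proof cases
    case 1 then show ?thesis using that[of 0] by (simp add: v)
  next
    case 2 then show ?thesis using that[of 1] by (simp add: v rot_def)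
  next
    case 3 then show ?thesis using that[of 2] by (simp add: v rot_def)
  next
    case 4 then show ?thesis using that[of 3] by (simp add: v rot_def)
  qed
qed

lemma gauss_norm_one: "gauss_norm q = 1 \<Longrightarrow> q \<in> {(1, 0), (-1, 0), (0, 1), (0, -1)}"
proof -
  assume n: "gauss_norm q = 1"
  obtain x y where q: "q = (x, y)" by (cases q)
  have e: "x\<^sup>2 + y\<^sup>2 = 1" using n by (simp add: q gauss_norm_def)
  have "x\<^sup>2 \<le> 1" "y\<^sup>2 \<le> 1" using e zero_le_power2[of x] zero_le_power2[of y] by linarith+
  then have "\<bar>x\<bar> \<le> 1" "\<bar>y\<bar> \<le> 1" by (simp_all add: abs_square_le_1)
  then have "x \<in> {-1, 0, 1}" "y \<in> {-1, 0, 1}" by auto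
  then show ?thesis using e q by auto
qed

text \<open>The generators of an ideal are the quarter turns of one of them, and exactly one of these lies in
  the quadrant \<open>s > 0\<close>, \<open>t \<ge> 0\<close>.\<close>

lemma ideals_bij:
  assumes k: "0 < k"
  shows "bij_betw gauss_ideal {(s, t). (0::int) < s \<and> (0::int) \<le> t \<and> s\<^sup>2 + t\<^sup>2 = int k} (ideals k)"
  unfolding bij_betw_def
proof
  let ?Q = "{(s, t). (0::int) < s \<and> (0::int) \<le> t \<and> s\<^sup>2 + t\<^sup>2 = int k}"
  have Q: "v \<in> ?Q \<longleftrightarrow> 0 < fst v \<and> 0 \<le> snd v \<and> gauss_norm v = int k" for v by (cases v) (simp add: gauss_norm_def)
  show "inj_on gauss_ideal ?Q"
  proof (rule inj_onI)
    fix v w assume v: "v \<in> ?Q" and w: "w \<in> ?Q" and e: "gauss_ideal v = gauss_ideal w"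
    have "v \<in> gauss_ideal w" using e gauss_ideal_self[of v] by simp
    then obtain q where q: "v = gauss_mul q w" by (auto simp: gauss_ideal_def)
    have "gauss_norm q * int k = int k" using gauss_norm_gauss_mul[of q w] v w q unfolding Q by simp
    then have "gauss_norm q = 1" using k by simp
    then have "q \<in> {(1, 0), (-1, 0), (0, 1), (0, -1)}" by (rule gauss_norm_one)
    then have "q = (1, 0)" using v w q unfolding Q by (cases w) (auto simp: gauss_mul_simp)
    then show "v = w" using q by simp
  qed
  show "gauss_ideal ` ?Q = ideals k"
  proof (intro equalityI subsetI)
    fix L assume "L \<in> gauss_ideal ` ?Q"
    then obtain v where v: "v \<in> ?Q" "L = gauss_ideal v" by blast
    then have "v \<noteq> 0" "nat (gauss_norm v) = k" unfolding Q by auto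
    then show "L \<in> ideals k" using gauss_ideal_lattice[of v] gauss_ideal_rot v(2) by (simp add: ideals_def)
  next
    fix L assume L: "L \<in> ideals k"
    then obtain v where v: "v \<noteq> 0" "L = gauss_ideal v" using ideal_principal by (metis (no_types, lifting) ideals_def mem_Collect_eq)
    obtain j where j: "0 < fst (rot j v)" "0 \<le> snd (rot j v)" using quadrant[OF v(1)] .
    have "rot j v \<noteq> 0" using j(1) by auto
    then have "L \<in> lattices (nat (gauss_norm (rot j v)))" using gauss_ideal_lattice[of "rot j v"] v(2) by (simp add: gauss_ideal_rot_eq)
    then have "nat (gauss_norm (rot j v)) = k" using lattices_disjoint L unfolding ideals_def by blast
    then have mem: "rot j v \<in> ?Q" unfolding Q using j k gauss_norm_nonneg[of "rot j v"] by auto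
    have "L = gauss_ideal (rot j v)" using v(2) by (simp add: gauss_ideal_rot_eq)
    then show "L \<in> gauss_ideal ` ?Q" using mem by (rule image_eqI)
  qed
qed

lemma card_ideals: "0 < k \<Longrightarrow> card (ideals k) = tau k"
  unfolding tau_def by (rule bij_betw_same_card[OF ideals_bij, symmetric])

text \<open>The Gaussian integer \<open>-1 + i\<close> is the prime that divides 2.\<close>

lemma even_gauss: "even (fst q + snd q) \<longleftrightarrow> (\<exists>r. q = gauss_mul (-1, 1) r)"
proof
  obtain x y where q: "q = (x, y)" by (cases q)
  assume "even (fst q + snd q)"
  then obtain z where z: "x + y = 2 * z" unfolding q fst_conv snd_conv by (rule evenE)
  have "q = gauss_mul (-1, 1) (y - z, - z)" using z by (simp add: q gauss_mul_simp)
  then show "\<exists>r. q = gauss_mul (-1, 1) r" by blast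
next
  assume "\<exists>r. q = gauss_mul (-1, 1) r"
  then obtain r where "q = gauss_mul (-1, 1) r" by blast
  then show "even (fst q + snd q)" by (cases r) (simp add: gauss_mul_simp)
qed

lemma even_gauss_norm: "even (gauss_norm q) \<longleftrightarrow> even (fst q + snd q)"
  by (simp add: gauss_norm_def)

lemma rot_minus_self: "rot 1 u - u = gauss_mul (-1, 1) u"
  by (cases u) (simp add: gauss_mul_simp rot_def)

lemma ideal_rot_image:
  assumes "\<And>v. v \<in> L \<Longrightarrow> rot 1 v \<in> L" shows "rot j ` L = (L :: (int \<times> int) set)"
proof -
  have c: "rot i v \<in> L" if "v \<in> L" for i v using rot_multiple_closed[OF assms that, of i] by simp
  have "rot (- j) v \<in> L \<longleftrightarrow> v \<in> L" for v using c[of v "- j"] c[of "rot (- j) v" j] by auto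
  then show ?thesis using rot_image_mem by blast
qed

text \<open>The coset of \<open>u\<close> is fixed if \<open>(-1 + i) u\<close> lies in the ideal generated by \<open>v\<close>. If \<open>-1 + i\<close> divides \<open>v\<close>,
  which it does for even \<open>k\<close>, these \<open>u\<close> are the multiples of the quotient \<open>g\<close> and form two cosets;
  otherwise they form the ideal itself.\<close>

lemma card_fixed_cosets_ideal:
  assumes L: "L \<in> ideals k"
  shows "card {C \<in> cosets L. rot 1 ` C = C} = (if even k then 2 else 1)"
proof -
  have lk: "L \<in> lattices k" and r: "\<And>v. v \<in> L \<Longrightarrow> rot 1 v \<in> L" using L by (auto simp: ideals_def)
  have A: "add_subgroup L" using lk by (rule lattices_add_subgroup)
  obtain v where v: "v \<noteq> 0" "L = gauss_ideal v" using ideal_principal[OF lk r] by blast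
  have nk: "gauss_norm v = int k"
    using lattices_disjoint[OF lk] gauss_ideal_lattice[OF v(1)] v(2) gauss_norm_nonneg[of v] by fastforce
  have fxd: "{C \<in> cosets L. rot 1 ` C = C} = (\<lambda>u. (+) u ` L) ` {u. gauss_mul (-1, 1) u \<in> L}"
  proof -
    have rL: "rot 1 ` L = L" by (rule ideal_rot_image) (rule r)
    have "rot 1 ` (+) u ` L = (+) u ` L \<longleftrightarrow> gauss_mul (-1, 1) u \<in> L" for u
      unfolding rot_image_coset rL coset_eq_iff[OF A] rot_minus_self ..
    then show ?thesis unfolding cosets_def by blast
  qed
  show ?thesis
  proof (cases "even k")
    case True
    then have "even (gauss_norm v)" using nk by simp
    then obtain g where g: "v = gauss_mul (-1, 1) g" unfolding even_gauss_norm even_gauss by blast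
    have g0: "g \<noteq> 0" using v(1) g by auto
    have Lg: "gauss_mul p g \<in> L \<longleftrightarrow> even (fst p + snd p)" for p
    proof -
      have "gauss_mul p g \<in> L \<longleftrightarrow> (\<exists>r. gauss_mul p g = gauss_mul (gauss_mul (-1, 1) r) g)"
        unfolding v(2) g gauss_ideal_def by (auto simp: gauss_mul_assoc gauss_mul_commute[of _ "(-1, 1)"])
      then show ?thesis by (simp only: gauss_mul_cancel[OF g0] even_gauss)
    qed
    have "gauss_mul (-1, 1) u \<in> L \<longleftrightarrow> u \<in> range (\<lambda>p. gauss_mul p g)" for u
    proof -
      have "gauss_mul (-1, 1) u \<in> L \<longleftrightarrow> (\<exists>p. gauss_mul (-1, 1) u = gauss_mul (-1, 1) (gauss_mul p g))"
        unfolding v(2) g gauss_ideal_def by (auto simp: gauss_mul_assoc gauss_mul_commute[of _ "(-1, 1)"])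
      also have "\<dots> \<longleftrightarrow> (\<exists>p. gauss_mul u (-1, 1) = gauss_mul (gauss_mul p g) (-1, 1))"
        by (simp only: gauss_mul_commute[of "(-1, 1)"])
      also have "\<dots> \<longleftrightarrow> u \<in> range (\<lambda>p. gauss_mul p g)"
        by (subst gauss_mul_cancel) (auto simp: zero_prod_def)
      finally show ?thesis .
    qed
    then have "{u. gauss_mul (-1, 1) u \<in> L} = range (\<lambda>p. gauss_mul p g)" by blast
    then have "{C \<in> cosets L. rot 1 ` C = C} = range (\<lambda>p. (+) (gauss_mul p g) ` L)"
      unfolding fxd by (simp add: image_image)
    also have "card \<dots> = card (range (\<lambda>p :: int \<times> int. even (fst p + snd p)))"
    proof (rule card_coset_image(1)[OF A])
      show "gauss_mul p g - gauss_mul q g \<in> L \<longleftrightarrow> even (fst p + snd p) = even (fst q + snd q)" for p q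
        unfolding gauss_mul_add(2)[symmetric] Lg by auto
    qed
    also have "range (\<lambda>p :: int \<times> int. even (fst p + snd p)) = UNIV"
      by (rule range_bool[of _ "(0, 0)" "(1, 0)"]) simp_all
    finally show ?thesis using True by simp
  next
    case False
    have "u \<in> L" if u: "gauss_mul (-1, 1) u \<in> L" for u
    proof -
      obtain q where q: "gauss_mul (-1, 1) u = gauss_mul q v" using u unfolding v(2) gauss_ideal_def by blast
      have "gauss_norm (-1, 1) * gauss_norm u = gauss_norm q * gauss_norm v" using gauss_norm_gauss_mul[of "(-1, 1)" u] gauss_norm_gauss_mul[of q v] q by simp
      then have "2 * gauss_norm u = gauss_norm q * int k" by (simp add: nk) (simp add: gauss_norm_def)
      then have "even (gauss_norm q * int k)" by (metis dvd_triv_left)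
      then have "even (gauss_norm q)" using False by simp
      then obtain p where "q = gauss_mul (-1, 1) p" unfolding even_gauss_norm even_gauss by blast
      then have "gauss_mul (-1, 1) u = gauss_mul (-1, 1) (gauss_mul p v)" using q by (simp add: gauss_mul_assoc)
      then have "gauss_mul u (-1, 1) = gauss_mul (gauss_mul p v) (-1, 1)" by (simp only: gauss_mul_commute)
      then have "u = gauss_mul p v" by (subst (asm) gauss_mul_cancel) (auto simp: zero_prod_def)
      then show ?thesis by (simp add: v(2) gauss_ideal_def)
    qed
    moreover have "gauss_mul (-1, 1) 0 \<in> L" using add_subgroup_0[OF A] by simp
    moreover have "(+) u ` L = L" if "u \<in> L" for u
      using coset_eq_iff[OF A, of u 0] that by simp
    moreover have "0 \<in> {u. gauss_mul (-1, 1) u \<in> L}" using add_subgroup_0[OF A] by simp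
    ultimately have "(\<lambda>u. (+) u ` L) ` {u. gauss_mul (-1, 1) u \<in> L} = {L}" by blast
    then show ?thesis using False unfolding fxd by simp
  qed
qed

section \<open>Conjugacy classes of subgroups of given height\<close>

lemma pairs_iff:
  "(L, C) \<in> pairs m k \<longleftrightarrow> L \<in> lattices k \<and> (\<forall>v\<in>L. rot (int m) v \<in> L) \<and> C \<in> cosets (shear (int m) L)"
  unfolding pairs_def cosets_def by blast

lemma fixed_pairs:
  "{x \<in> pairs m k. rot_pair j x = x} =
    (SIGMA L:{L \<in> lattices k. (\<forall>v\<in>L. rot (int m) v \<in> L) \<and> rot j ` L = L}. {C \<in> cosets (shear (int m) L). rot j ` C = C})"
proof (intro Set.set_eqI)
  fix x :: "(int \<times> int) set \<times> (int \<times> int) set"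
  obtain L C where x: "x = (L, C)" by (cases x)
  show "x \<in> {x \<in> pairs m k. rot_pair j x = x} \<longleftrightarrow>
    x \<in> (SIGMA L:{L \<in> lattices k. (\<forall>v\<in>L. rot (int m) v \<in> L) \<and> rot j ` L = L}. {C \<in> cosets (shear (int m) L). rot j ` C = C})"
    unfolding x by (simp add: pairs_iff rot_pair_def) blast
qed

lemma lattice_rot_2: "L \<in> lattices k \<Longrightarrow> rot 2 ` L = L"
proof -
  assume "L \<in> lattices k"
  then have A: "add_subgroup L" by (rule lattices_add_subgroup)
  have "rot (- 2) v \<in> L \<longleftrightarrow> v \<in> L" for v
    using add_subgroup_minus[OF A, of v] add_subgroup_minus[OF A, of "- v"] by (auto simp: rot_def uminus_prod_def)
  then show ?thesis using rot_image_mem by blast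
qed

lemma rot_1_image_iff:
  "rot 1 ` L = L \<longleftrightarrow> (\<forall>v\<in>L. rot 1 v \<in> (L :: (int \<times> int) set))"
  using ideal_rot_image[of L 1] by blast

text \<open>The number of conjugacy classes of subgroups in \<^term>\<open>subs m k\<close>, by \<open>subs_classes_bij\<close>.\<close>

definition class_count :: "nat \<Rightarrow> nat \<Rightarrow> nat" where
  "class_count m k = card (rot_orbit ` pairs m k)"

lemma pairs_sum:
  assumes k: "0 < k" and fin: "\<And>L. L \<in> lattices k \<Longrightarrow> (\<forall>v\<in>L. rot (int m) v \<in> L) \<Longrightarrow> finite (cosets (shear (int m) L))"
  shows "card {x \<in> pairs m k. rot_pair j x = x} =
      (\<Sum>L\<in>{L \<in> lattices k. (\<forall>v\<in>L. rot (int m) v \<in> L) \<and> rot j ` L = L}. card {C \<in> cosets (shear (int m) L). rot j ` C = C})"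
    and "finite (pairs m k)"
proof -
  show "card {x \<in> pairs m k. rot_pair j x = x} =
      (\<Sum>L\<in>{L \<in> lattices k. (\<forall>v\<in>L. rot (int m) v \<in> L) \<and> rot j ` L = L}. card {C \<in> cosets (shear (int m) L). rot j ` C = C})"
    unfolding fixed_pairs using finite_lattices[OF k] fin by (intro card_SigmaI) auto
  have "finite {x \<in> pairs m k. rot_pair 0 x = x}"
    unfolding fixed_pairs using finite_lattices[OF k] fin by (intro finite_SigmaI) auto
  then show "finite (pairs m k)" by simp
qed

lemma rot_pair_pairs:
  assumes "x \<in> pairs m k" shows "rot_pair j x \<in> pairs m k"
proof -
  obtain L u where x: "x = (L, (+) u ` shear (int m) L)" "L \<in> lattices k" "\<forall>v\<in>L. rot (int m) v \<in> L"
    using assms by (auto simp: pairs_def)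
  have "rot_pair j x = (rot j ` L, (+) (rot j u) ` shear (int m) (rot j ` L))"
    by (simp add: rot_pair_def x(1) rot_image_coset rot_image_shear)
  moreover have "rot j ` L \<in> lattices k" by (rule lattices_rot[OF x(2)])
  moreover have "\<forall>v\<in>rot j ` L. rot (int m) v \<in> rot j ` L" using x(3) rot_commute[of "int m" j] by fastforce
  ultimately show ?thesis unfolding pairs_def by blast
qed

text \<open>Quarter turns have period four on pairs, and one and three quarter turns fix the same pairs.\<close>

lemma class_count_burnside:
  assumes "finite (pairs m k)"
  shows "4 * class_count m k = card {x \<in> pairs m k. rot_pair 0 x = x} + 2 * card {x \<in> pairs m k. rot_pair 1 x = x}
    + card {x \<in> pairs m k. rot_pair 2 x = x}"
proof -
  have "rot_orbit ` pairs m k = (\<lambda>x. {x, rot_pair 1 x, rot_pair 1 (rot_pair 1 x), rot_pair 1 (rot_pair 1 (rot_pair 1 x))}) ` pairs m k"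
    by (rule image_cong[OF HOL.refl]) (rule rot_orbit_eq)
  moreover have "rot_pair 1 (rot_pair 1 x) = rot_pair 2 x" for x by (simp add: rot_pair_add[symmetric])
  ultimately show ?thesis
    using card_orbits_period_4[OF assms, of "rot_pair 1"] rot_pair_pairs rot_pair_4 unfolding class_count_def by simp
qed

lemma shear_0: "m mod 4 = 0 \<Longrightarrow> shear m L = L"
  by (auto simp: shear_def rot_id)

text \<open>For odd \<open>m\<close> the vectors \<open>w - rot m w\<close> are those with even coordinate sum.\<close>

lemma shear_odd_mem:
  assumes "odd m"
  shows "v \<in> shear m L \<longleftrightarrow> (\<exists>l\<in>L. even (fst (v - l) + snd (v - l)))"
proof
  assume "v \<in> shear m L"
  then obtain l w where l: "l \<in> L" "v = l + (w - rot m w)" by (auto simp: shear_def)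
  have "m mod 4 = 1 \<or> m mod 4 = 3" using assms by presburger
  then have "even (fst (w - rot m w) + snd (w - rot m w))" by (auto simp: rot_def)
  then have "even (fst (v - l) + snd (v - l))" using l(2) by simp
  then show "\<exists>l\<in>L. even (fst (v - l) + snd (v - l))" using l(1) by blast
next
  assume "\<exists>l\<in>L. even (fst (v - l) + snd (v - l))"
  then obtain l where l0: "l \<in> L" "even (fst (v - l) + snd (v - l))" by blast
  obtain z where "fst (v - l) + snd (v - l) = 2 * z" using l0(2) by (rule evenE)
  with l0(1) have l: "l \<in> L" "fst (v - l) + snd (v - l) = 2 * z" by blast+
  have "m mod 4 = 1 \<or> m mod 4 = 3" using assms by presburger
  then have "\<exists>w. v - l = w - rot m w"
  proof
    assume "m mod 4 = 1"
    then show ?thesis using l(2) by (intro exI[of _ "(fst (v - l) - z, z)"]) (simp add: rot_def prod_eq_iff)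
  next
    assume "m mod 4 = 3"
    then show ?thesis using l(2) by (intro exI[of _ "(z, snd (v - l) - z)"]) (simp add: rot_def prod_eq_iff)
  qed
  then obtain w where "v = l + (w - rot m w)" by (metis add.commute diff_add_cancel)
  then show "v \<in> shear m L" using l(1) shearI by metis
qed

text \<open>The shear contains all vectors with even coordinate sum. It contains another one exactly if the
  generator \<open>v\<close> has odd coordinate sum, that is, if its norm \<open>k\<close> is odd. Every coset is fixed because
  \<open>rot 1 u - u\<close> has even coordinate sum.\<close>

lemma card_cosets_shear_odd:
  assumes m: "odd m" and L: "L \<in> ideals k"
  shows "card (cosets (shear m L)) = (if even k then 2 else 1)" "finite (cosets (shear m L))"
    "C \<in> cosets (shear m L) \<Longrightarrow> rot 1 ` C = C"
proof -
  have lk: "L \<in> lattices k" and r: "\<And>v. v \<in> L \<Longrightarrow> rot 1 v \<in> L" using L by (auto simp: ideals_def)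
  have A: "add_subgroup L" using lk by (rule lattices_add_subgroup)
  have B: "add_subgroup (shear m L)" by (rule add_subgroup_shear[OF A])
  obtain v where v: "v \<noteq> 0" "L = gauss_ideal v" using ideal_principal[OF lk r] by blast
  have nk: "gauss_norm v = int k"
    using lattices_disjoint[OF lk] gauss_ideal_lattice[OF v(1)] v(2) gauss_norm_nonneg[of v] by fastforce
  have E: "w \<in> shear m L" if "even (fst w + snd w)" for w
    unfolding shear_odd_mem[OF m] using add_subgroup_0[OF A] that by (intro bexI[of _ 0]) simp_all
  have "card (cosets (shear m L)) = (if even k then 2 else 1) \<and> finite (cosets (shear m L))"
  proof (cases "even k")
    case True
    have "even (fst l + snd l)" if "l \<in> L" for l
    proof -
      obtain q where q: "l = gauss_mul q v" using \<open>l \<in> L\<close> unfolding v(2) gauss_ideal_def by blast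
      have "even (gauss_norm l)" using True nk gauss_norm_gauss_mul[of q v] q by simp
      then show ?thesis by (simp add: even_gauss_norm)
    qed
    then have mem: "w \<in> shear m L \<longleftrightarrow> even (fst w + snd w)" for w
      using E unfolding shear_odd_mem[OF m] by fastforce
    have "u - w \<in> shear m L \<longleftrightarrow> even (fst u + snd u) = even (fst w + snd w)" for u w
      unfolding mem by auto
    moreover have "range (\<lambda>p :: int \<times> int. even (fst p + snd p)) = UNIV"
      by (rule range_bool[of _ "(0, 0)" "(1, 0)"]) simp_all
    ultimately show ?thesis using card_cosets[OF B, of "\<lambda>u. even (fst u + snd u)"] True by simp
  next
    case False
    have vL: "v \<in> L" using v(2) gauss_ideal_self by simp
    have o: "odd (fst v + snd v)" using False nk even_gauss_norm[of v] by simp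
    have "w \<in> shear m L" for w
    proof (cases "even (fst w + snd w)")
      case False
      then show ?thesis unfolding shear_odd_mem[OF m] using o vL by (intro bexI[of _ v]) auto
    qed (rule E)
    then show ?thesis using card_cosets[OF B, of "\<lambda>_. True"] False by simp
  qed
  then show "card (cosets (shear m L)) = (if even k then 2 else 1)" "finite (cosets (shear m L))" by auto
  assume "C \<in> cosets (shear m L)"
  then obtain u where u: "C = (+) u ` shear m L" by (auto simp: cosets_def)
  have "rot 1 ` shear m L = shear m L" by (simp add: rot_image_shear ideal_rot_image[OF r])
  moreover have "rot 1 u - u \<in> shear m L" by (rule E) (cases u, simp add: rot_def)
  ultimately show "rot 1 ` C = C" unfolding u rot_image_coset by (simp add: coset_eq_iff[OF B])
qed

text \<open>The number of cosets fixed by the quarter turn over an ideal of index \<open>k\<close>, for every height.\<close>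

definition parity_weight :: "nat \<Rightarrow> nat" where
  "parity_weight k = (if even k then 2 else 1)"

definition two_torsion_sum :: "nat \<Rightarrow> nat" where
  "two_torsion_sum k = (\<Sum>a | a dvd k. \<Sum>b<a. two_torsion (int a) (int b) (int (k div a)))"

text \<open>Only ideals are invariant, and the turns fix all pairs over them, so every pair is a class.\<close>

lemma class_count_odd:
  assumes m: "odd m" and k: "0 < k"
  shows "class_count m k = parity_weight k * tau k"
proof -
  have inv: "(\<forall>v\<in>L. rot (int m) v \<in> L) \<longleftrightarrow> (\<forall>v\<in>L. rot 1 v \<in> L)" for L
    using odd_lattice_ideal[OF m, of L] rot_multiple_closed[of L 1 _ "int m"] by auto
  have I: "{L \<in> lattices k. (\<forall>v\<in>L. rot (int m) v \<in> L) \<and> rot j ` L = L} = ideals k" for j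
    unfolding inv ideals_def using ideal_rot_image by blast
  have mo: "odd (int m)" using m by simp
  have fin: "finite (cosets (shear (int m) L))" if "L \<in> lattices k" "\<forall>v\<in>L. rot (int m) v \<in> L" for L
    using card_cosets_shear_odd(2)[OF mo] that unfolding inv by (simp add: ideals_def)
  have fxd: "rot j ` C = C" if "L \<in> ideals k" "C \<in> cosets (shear (int m) L)" for j L C
  proof (rule ideal_rot_image)
    show "rot 1 v \<in> C" if "v \<in> C" for v
      using card_cosets_shear_odd(3)[OF mo \<open>L \<in> ideals k\<close> \<open>C \<in> cosets (shear (int m) L)\<close>] that by blast
  qed
  have "card {x \<in> pairs m k. rot_pair j x = x} = (\<Sum>L\<in>ideals k. parity_weight k)" for j
  proof -
    have "card {C \<in> cosets (shear (int m) L). rot j ` C = C} = parity_weight k" if "L \<in> ideals k" for L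
    proof -
      have "{C \<in> cosets (shear (int m) L). rot j ` C = C} = cosets (shear (int m) L)" using fxd[OF that] by blast
      then show ?thesis using card_cosets_shear_odd(1)[OF mo that] by (simp add: parity_weight_def)
    qed
    moreover have "card {x \<in> pairs m k. rot_pair j x = x} =
        (\<Sum>L\<in>ideals k. card {C \<in> cosets (shear (int m) L). rot j ` C = C})"
      using pairs_sum(1)[OF k, of m j] fin unfolding I by blast
    ultimately show ?thesis by simp
  qed
  then show ?thesis
    using class_count_burnside[OF pairs_sum(2)[OF k fin]] card_ideals[OF k] by (simp del: rot_pair_0)
qed

text \<open>The sum of an ideal and \<open>2 \<int>\<^sup>2\<close> is an ideal, to which \<open>card_fixed_cosets_ideal\<close> applies.\<close>

lemma ideal_shear_2:
  assumes m: "m mod 4 = 2" and L: "L \<in> ideals k"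
  obtains k' where "shear m L \<in> ideals k'" "even k' \<longleftrightarrow> even k"
proof -
  have lk: "L \<in> lattices k" and r: "\<And>v. v \<in> L \<Longrightarrow> rot 1 v \<in> L" using L by (auto simp: ideals_def)
  have A: "add_subgroup L" using lk by (rule lattices_add_subgroup)
  have B: "add_subgroup (shear m L)" by (rule add_subgroup_shear[OF A])
  have "0 + (w - rot m w) \<in> shear m L" for w by (rule shearI[OF add_subgroup_0[OF A]])
  from this[of "(1, 0)"] this[of "(0, 1)"] have "(2, 0) \<in> shear m L" "(0, 2) \<in> shear m L"
    using m by (simp_all add: rot_def)
  then obtain k' where k': "shear m L \<in> lattices k'" using add_subgroup_lattice[OF B, of 2 2] by auto
  have "rot 1 ` shear m L = shear m L" by (simp add: rot_image_shear ideal_rot_image[OF r])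
  then have 1: "shear m L \<in> ideals k'" using k' rot_1_image_iff[of "shear m L"] by (simp add: ideals_def)
  obtain a b d where ab: "L = lat a b d" "0 < a" "0 < d" "a * d = int k" using lk by (auto simp: lattices_def)
  have "k' = two_torsion a b d" using card_cosets_lattice(1)[OF k'] card_cosets_shear_2(1)[OF m] ab(1) by simp
  then have "even k' \<longleftrightarrow> even (a * d)" by (simp add: two_torsion_def)
  then show ?thesis using that[OF 1] ab(4) by simp
qed

text \<open>All lattices are invariant and half turns fix all pairs; the pairs fixed by quarter turns are
  those over ideals whose coset is fixed.\<close>

lemma class_count_half:
  assumes m: "m mod 4 = 2" and k: "0 < k"
  shows "4 * class_count m k = 2 * two_torsion_sum k + 2 * (parity_weight k * tau k)"
proof -
  have mi: "int m mod 4 = 2" using m by presburger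
  have inv: "rot (int m) v \<in> L" if "L \<in> lattices k" "v \<in> L" for L v
  proof -
    have "rot (int m) v = - v" using mi by (simp add: rot_def prod_eq_iff)
    then show ?thesis using add_subgroup_minus[OF lattices_add_subgroup] that by metis
  qed
  have fin: "finite (cosets (shear (int m) L))" if "L \<in> lattices k" for L
    using card_cosets_shear_2(2)[OF mi] that by (auto simp: lattices_def)
  have two: "{C \<in> cosets (shear (int m) L). rot j ` C = C} = cosets (shear (int m) L)"
    if j: "j = 0 \<or> j = 2" and L: "L \<in> lattices k" for j L
  proof -
    have A: "add_subgroup L" using L by (rule lattices_add_subgroup)
    have B: "add_subgroup (shear (int m) L)" by (rule add_subgroup_shear[OF A])
    have "rot 2 ` (+) u ` shear (int m) L = (+) u ` shear (int m) L" for u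
    proof -
      have "0 + ((- u) - rot (int m) (- u)) \<in> shear (int m) L" by (rule shearI[OF add_subgroup_0[OF A]])
      moreover have "0 + ((- u) - rot (int m) (- u)) = rot 2 u - u" using mi by (simp add: rot_def prod_eq_iff)
      ultimately have "rot 2 u - u \<in> shear (int m) L" by simp
      then show ?thesis
        unfolding rot_image_coset by (simp add: rot_image_shear lattice_rot_2[OF L] coset_eq_iff[OF B])
    qed
    then have "rot j ` C = C" if "C \<in> cosets (shear (int m) L)" for C
      using j that unfolding cosets_def by (elim disjE imageE) simp_all
    then show ?thesis by blast
  qed
  have s2: "card {x \<in> pairs m k. rot_pair j x = x} = two_torsion_sum k" if j: "j = 0 \<or> j = 2" for j
  proof -
    have "rot j ` L = L" if "L \<in> lattices k" for L
      using j lattice_rot_2[OF that] by (elim disjE) simp_all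
    then have "{L \<in> lattices k. (\<forall>v\<in>L. rot (int m) v \<in> L) \<and> rot j ` L = L} = lattices k"
      using inv by blast
    then have "card {x \<in> pairs m k. rot_pair j x = x} =
        (\<Sum>L\<in>lattices k. card {C \<in> cosets (shear (int m) L). rot j ` C = C})"
      using pairs_sum(1)[OF k fin] by simp
    also have "\<dots> = (\<Sum>L\<in>lattices k. card (cosets (shear (int m) L)))"
      using two[OF j] by (intro sum.cong) auto
    also have "\<dots> = two_torsion_sum k"
      unfolding sum_lattices[OF k] two_torsion_sum_def card_cosets_shear_2(1)[OF mi] ..
    finally show ?thesis .
  qed
  have "card {x \<in> pairs m k. rot_pair 1 x = x} = (\<Sum>L\<in>ideals k. parity_weight k)"
  proof -
    have I: "{L \<in> lattices k. (\<forall>v\<in>L. rot (int m) v \<in> L) \<and> rot 1 ` L = L} = ideals k"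
      using inv rot_1_image_iff by (auto simp: ideals_def)
    have "card {C \<in> cosets (shear (int m) L). rot 1 ` C = C} = parity_weight k" if L: "L \<in> ideals k" for L
    proof -
      obtain k' where "shear (int m) L \<in> ideals k'" "even k' \<longleftrightarrow> even k" using ideal_shear_2[OF mi L] .
      then show ?thesis using card_fixed_cosets_ideal by (simp add: parity_weight_def)
    qed
    moreover have "card {x \<in> pairs m k. rot_pair 1 x = x} =
        (\<Sum>L\<in>ideals k. card {C \<in> cosets (shear (int m) L). rot 1 ` C = C})"
      using pairs_sum(1)[OF k, of m 1] fin unfolding I by blast
    ultimately show ?thesis by simp
  qed
  then show ?thesis
    using class_count_burnside[OF pairs_sum(2)[OF k fin]] card_ideals[OF k] s2 by (simp del: rot_pair_0)
qed

text \<open>The shear of a lattice is the lattice itself, so all cosets of all lattices occur. Half turns fix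
  the two-torsion, quarter turns one or two cosets over each ideal.\<close>

lemma class_count_full:
  assumes m: "4 dvd m" and k: "0 < k"
  shows "4 * class_count m k = k * (\<Sum>a | a dvd k. a) + 2 * (parity_weight k * tau k) + two_torsion_sum k"
proof -
  have mi: "int m mod 4 = 0" using m by presburger
  have sh: "shear (int m) L = L" for L by (rule shear_0[OF mi])
  have fin: "finite (cosets (shear (int m) L))" if "L \<in> lattices k" for L
    unfolding sh using card_cosets_lattice(2)[OF that] .
  have c: "card {x \<in> pairs m k. rot_pair j x = x} =
      (\<Sum>L\<in>{L \<in> lattices k. rot j ` L = L}. card {C \<in> cosets L. rot j ` C = C})" for j
    using pairs_sum(1)[OF k fin, of j] by (simp add: sh rot_id[OF mi])
  have "card {x \<in> pairs m k. rot_pair 0 x = x} = k * (\<Sum>a | a dvd k. a)"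
    unfolding c using card_cosets_lattice(1) card_lattices[OF k] by (simp add: mult.commute)
  moreover have "card {x \<in> pairs m k. rot_pair 1 x = x} = parity_weight k * tau k"
  proof -
    have "{L \<in> lattices k. rot 1 ` L = L} = ideals k" using rot_1_image_iff by (auto simp: ideals_def)
    then have "card {x \<in> pairs m k. rot_pair 1 x = x} = (\<Sum>L\<in>ideals k. card {C \<in> cosets L. rot 1 ` C = C})"
      unfolding c by simp
    also have "\<dots> = (\<Sum>L\<in>ideals k. parity_weight k)"
      by (intro sum.cong) (auto simp: card_fixed_cosets_ideal parity_weight_def)
    finally show ?thesis using card_ideals[OF k] by simp
  qed
  moreover have "card {x \<in> pairs m k. rot_pair 2 x = x} = two_torsion_sum k"
  proof -
    have "{L \<in> lattices k. rot 2 ` L = L} = lattices k" using lattice_rot_2 by blast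
    then have "card {x \<in> pairs m k. rot_pair 2 x = x} = (\<Sum>L\<in>lattices k. card {C \<in> cosets L. rot 2 ` C = C})"
      unfolding c by simp
    also have "\<dots> = two_torsion_sum k"
      unfolding sum_lattices[OF k] two_torsion_sum_def
    proof (intro sum.cong HOL.refl)
      fix a b assume "a \<in> {a. a dvd k}" "b \<in> {..<a}"
      then have "0 < int a" "0 < int (k div a)" using k by (auto simp: div_greater_zero_iff dvd_imp_le)
      then show "card {C \<in> cosets (lat (int a) (int b) (int (k div a))). rot 2 ` C = C} = two_torsion (int a) (int b) (int (k div a))"
        by (rule card_two_torsion)
    qed
    finally show ?thesis .
  qed
  ultimately show ?thesis using class_count_burnside[OF pairs_sum(2)[OF k fin]] by simp
qed

section \<open>Sums over divisors\<close>

lemma twice_dvd_iff: "0 < (n::nat) \<Longrightarrow> k dvd n \<and> even (n div k) \<longleftrightarrow> 2 * k dvd n"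
  by (cases "k = 0") (auto simp: dvd_def)

lemma mult_dvd_iff_div:
  fixes n d k :: nat
  assumes "0 < d" shows "d * k dvd n \<longleftrightarrow> d dvd n \<and> k dvd n div d"
  using assms by (auto simp: dvd_def)

lemma finite_divisors_pred: "0 < (n::nat) \<Longrightarrow> finite {k. k dvd n \<and> P k}"
  by (rule finite_subset[OF _ finite_divisors_nat[of n]]) auto

text \<open>A sum over the divisors of \<open>n / d\<close>, which is 0 if \<open>n / d\<close> is not an integer.\<close>

definition div_sum :: "(nat \<Rightarrow> 'a::comm_monoid_add) \<Rightarrow> nat \<Rightarrow> nat \<Rightarrow> 'a" where
  "div_sum F n d = (if d dvd n then \<Sum>k | k dvd n div d. F k else 0)"

lemma div_sum_1: "div_sum F n 1 = (\<Sum>k | k dvd n. F k)"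
  by (simp add: div_sum_def)

lemma div_sum_div: "0 < c \<Longrightarrow> c dvd n \<Longrightarrow> div_sum F (n div c) d = div_sum F n (c * d)"
  unfolding div_sum_def by (simp add: mult_dvd_iff_div div_mult2_eq)

lemma div_sum_eq_0: "\<not> c dvd n \<Longrightarrow> div_sum F n (c * d) = 0"
  unfolding div_sum_def by (auto dest: dvd_mult_left)

lemma sum_pos_divisors:
  assumes "0 < n" "0 < d"
  shows "(\<Sum>k\<in>pos_divisors (real n / real d). F k) = div_sum F n d"
  unfolding div_sum_def using assms by (simp add: pos_divisors_divide)

lemma div_sum_split:
  assumes n: "0 < n"
  shows "div_sum F n 1 = (\<Sum>k | k dvd n \<and> odd (n div k). F k) + div_sum F n 2"
proof -
  have U: "{k. k dvd n} = {k. k dvd n \<and> odd (n div k)} \<union> {k. k dvd n \<and> even (n div k)}" by blast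
  have S: "sum F ({k. k dvd n \<and> odd (n div k)} \<union> {k. k dvd n \<and> even (n div k)}) =
      sum F {k. k dvd n \<and> odd (n div k)} + sum F {k. k dvd n \<and> even (n div k)}"
    by (intro sum.union_disjoint finite_divisors_pred[OF n]) blast
  have E: "sum F {k. k dvd n \<and> even (n div k)} = div_sum F n 2"
    unfolding div_sum_def twice_dvd_iff[OF n] by (simp add: mult_dvd_iff_div)
  show ?thesis by (simp only: div_sum_1 U S E)
qed

lemma sum_even_half:
  fixes G :: "nat \<Rightarrow> 'a::comm_monoid_add"
  assumes n: "0 < n"
  shows "(\<Sum>k | k dvd n \<and> P (n div k). if even k then G (k div 2) else 0) =
    (if even n then \<Sum>j | j dvd n div 2 \<and> P (n div 2 div j). G j else 0)"
proof -
  have "(\<Sum>k | k dvd n \<and> P (n div k). if even k then G (k div 2) else 0) =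
      (\<Sum>k\<in>{k \<in> {k. k dvd n \<and> P (n div k)}. even k}. G (k div 2))"
    using finite_divisors_pred[OF n] by (subst sum.inter_filter[symmetric]) auto
  also have "{k \<in> {k. k dvd n \<and> P (n div k)}. even k} = (\<lambda>j. 2 * j) ` {j. 2 * j dvd n \<and> P (n div (2 * j))}"
    by (auto elim!: evenE)
  also have "(\<Sum>k\<in>(\<lambda>j. 2 * j) ` {j. 2 * j dvd n \<and> P (n div (2 * j))}. G (k div 2)) =
      (\<Sum>j | 2 * j dvd n \<and> P (n div (2 * j)). G j)"
    by (subst sum.reindex) (auto simp: inj_on_def)
  also have "\<dots> = (if even n then \<Sum>j | j dvd n div 2 \<and> P (n div 2 div j). G j else 0)"
    by (simp add: mult_dvd_iff_div div_mult2_eq)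
  finally show ?thesis .
qed

lemma sum_odd_quotient:
  fixes F G :: "nat \<Rightarrow> real"
  assumes n: "0 < n"
  shows "(\<Sum>k | k dvd n \<and> odd (n div k). F k + (if even k then G (k div 2) else 0)) =
    div_sum F n 1 - div_sum F n 2 + (div_sum G n 2 - div_sum G n 4)"
proof -
  have "(\<Sum>k | k dvd n \<and> odd (n div k). if even k then G (k div 2) else 0) = div_sum G n 2 - div_sum G n 4"
  proof (cases "even n")
    case True
    then have n2: "0 < n div 2" using n by auto
    show ?thesis
      unfolding sum_even_half[OF n, where P = odd]
      using True div_sum_split[OF n2, of G] div_sum_div[of 2 n G 1] div_sum_div[of 2 n G 2] by simp
  next
    case False
    then show ?thesis
      unfolding sum_even_half[OF n, where P = odd] using div_sum_eq_0[of 2 n G 1] div_sum_eq_0[of 2 n G 2] by simp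
  qed
  then show ?thesis using div_sum_split[OF n, of F] by (simp add: sum.distrib)
qed

lemma sum_all_divisors:
  fixes F G :: "nat \<Rightarrow> real"
  assumes n: "0 < n"
  shows "(\<Sum>k | k dvd n. F k + (if even k then G (k div 2) else 0)) = div_sum F n 1 + div_sum G n 2"
  using sum_even_half[OF n, where P = "\<lambda>_. True" and G = G] by (simp add: sum.distrib div_sum_def)

lemma sum_complementary_divisors:
  assumes n: "0 < (n::nat)"
  shows "(\<Sum>m | m dvd n \<and> P m. F m (n div m)) = (\<Sum>k | k dvd n \<and> P (n div k). F (n div k) k)"
  by (rule sum.reindex_bij_witness[where i = "\<lambda>k. n div k" and j = "\<lambda>m. n div m"])
    (use n in \<open>auto simp: div_div_eq_right dvd_div_eq_mult elim!: dvdE\<close>)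

section \<open>The sums of two-torsion\<close>

abbreviation divisor_sum :: "nat \<Rightarrow> nat" where
  "divisor_sum k \<equiv> (\<Sum>a | a dvd k. a)"

lemma sum_two_torsion:
  "(\<Sum>b<a. two_torsion (int a) (int b) (int d)) = a + (if even (a * d) then a else 0) + (if even a \<and> even d then a else 0)"
proof (cases "even a \<and> even d")
  case False
  then have "two_torsion (int a) (int b) (int d) = (if odd a \<and> odd d then 1 else 2)" for b
    by (auto simp: two_torsion_def)
  then show ?thesis using False by auto
next
  case True
  then obtain c where c: "a = 2 * c" by (auto elim: evenE)
  have "(\<Sum>b<2 * c. if odd b then 2 else 4 :: nat) = 6 * c" by (induction c) simp_all
  moreover have "two_torsion (int a) (int b) (int d) = (if odd b then 2 else 4)" for b
    using True by (simp add: two_torsion_def)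
  ultimately show ?thesis using True c by simp
qed

text \<open>The odd divisors of \<open>2 N\<close> and of \<open>N\<close> are the same, and the even divisors of \<open>2 N\<close> are the doubles of
  the divisors of \<open>N\<close>; halving an even divisor with even cofactor gives a divisor of \<open>N\<close> with even
  cofactor, and these are halves of even divisors in turn.\<close>

lemma divisor_sum_double:
  assumes N: "0 < N"
  shows "divisor_sum (2 * N) + (\<Sum>a | a dvd 2 * N. if even a \<and> even (2 * N div a) then a else 0) = 3 * divisor_sum N"
proof -
  define Od where "Od = (\<Sum>a | a dvd N. if odd a then a else 0)"
  have split: "divisor_sum k = (\<Sum>a | a dvd k. if odd a then a else 0) + (\<Sum>a | a dvd k. if even a then 2 * (a div 2) else 0)" for k
    unfolding sum.distrib[symmetric] by (intro sum.cong) auto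
  have odd2: "(\<Sum>a | a dvd 2 * N. if odd a then a else 0) = Od"
  proof -
    have "{a. a dvd N} \<subseteq> {a. a dvd 2 * N}" by auto
    moreover have "\<forall>a\<in>{a. a dvd 2 * N} - {a. a dvd N}. (if odd a then a else 0) = 0"
    proof
      fix a assume a: "a \<in> {a. a dvd 2 * N} - {a. a dvd N}"
      have "even a"
      proof (rule ccontr)
        assume "odd a"
        then have "coprime a 2" by simp
        then show False using a coprime_dvd_mult_right_iff[of a 2 N] by auto
      qed
      then show "(if odd a then a else 0) = 0" by simp
    qed
    ultimately show ?thesis unfolding Od_def
      using finite_divisors_nat[of "2 * N"] N by (intro sum.mono_neutral_right) auto
  qed
  have e1: "(\<Sum>a | a dvd 2 * N. if even a then 2 * (a div 2) else 0) = 2 * divisor_sum N"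
    using sum_even_half[where n = "2 * N" and P = "\<lambda>_. True" and G = "\<lambda>j. 2 * j"] N by (simp add: sum_distrib_left)
  have e2: "(\<Sum>a | a dvd N. if even a then 2 * (a div 2) else 0) = (\<Sum>a | a dvd N \<and> even (N div a). 2 * a)"
    using sum_even_half[OF N, where P = "\<lambda>_. True" and G = "\<lambda>j. 2 * j"]
    unfolding twice_dvd_iff[OF N] by (simp add: mult_dvd_iff_div)
  have "(\<Sum>a | a dvd 2 * N. if even a \<and> even (2 * N div a) then a else 0) =
      (\<Sum>a | a dvd 2 * N \<and> even (2 * N div a). if even a then 2 * (a div 2) else 0)"
  proof -
    have "finite {a. a dvd 2 * N}" using finite_divisors_nat[of "2 * N"] N by simp
    then show ?thesis by (intro sum.mono_neutral_cong_right) auto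
  qed
  also have "\<dots> = (\<Sum>a | a dvd N \<and> even (N div a). 2 * a)"
    using sum_even_half[where n = "2 * N" and P = even and G = "\<lambda>j. 2 * j"] N by simp
  finally show ?thesis using split[of "2 * N"] split[of N] odd2 e1 e2 unfolding Od_def by simp
qed

lemma two_torsion_sum_eq:
  assumes k: "0 < k"
  shows "two_torsion_sum k = divisor_sum k + (if even k then 3 * divisor_sum (k div 2) else 0)"
proof -
  have "two_torsion_sum k = (\<Sum>a | a dvd k. a + (if even k then a else 0) + (if even a \<and> even (k div a) then a else 0))"
    unfolding two_torsion_sum_def sum_two_torsion by (intro sum.cong) auto
  also have "\<dots> = divisor_sum k + (if even k then divisor_sum k else 0) + (\<Sum>a | a dvd k. if even a \<and> even (k div a) then a else 0)"
    by (simp add: sum.distrib)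
  also have "\<dots> = divisor_sum k + (if even k then 3 * divisor_sum (k div 2) else 0)"
  proof (cases "even k")
    case True
    then obtain N where "k = 2 * N" by (rule evenE)
    then show ?thesis using divisor_sum_double[of N] k by simp
  next
    case False
    then have "(\<Sum>a | a dvd k. if even a \<and> even (k div a) then a else 0) = 0"
      by (intro sum.neutral) (auto dest: dvd_trans)
    then show ?thesis using False by simp
  qed
  finally show ?thesis .
qed

text \<open>Multiplication by \<open>1 + i\<close> takes the Gaussian integers of norm \<open>n\<close> onto those of norm \<open>2 n\<close>; a quarter
  turn brings the product back to the quadrant \<open>s > 0\<close>, \<open>t \<ge> 0\<close> if necessary.\<close>

lemma tau_double: "tau (2 * n) = tau n"
proof -
  let ?A = "\<lambda>n. {(s, t). (0::int) < s \<and> (0::int) \<le> t \<and> s\<^sup>2 + t\<^sup>2 = int n}"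
  let ?f = "\<lambda>(s :: int, t). if t < s then (s - t, s + t) else (s + t, t - s)"
  let ?g = "\<lambda>(p :: int, q). if p \<le> q then ((p + q) div 2, (q - p) div 2) else ((p - q) div 2, (p + q) div 2)"
  have sq: "(s - t)\<^sup>2 + (s + t)\<^sup>2 = 2 * (s\<^sup>2 + t\<^sup>2)" "(s + t)\<^sup>2 + (t - s)\<^sup>2 = 2 * (s\<^sup>2 + t\<^sup>2)" for s t :: int
    by (simp_all add: power2_eq_square algebra_simps)
  have 1: "\<forall>v\<in>?A n. ?g (?f v) = v" by auto
  have bck: "?f (?g v) = v \<and> ?g v \<in> ?A n" if v: "v \<in> ?A (2 * n)" for v
  proof -
    obtain p q where pq: "v = (p, q)" "0 < p" "0 \<le> q" "p\<^sup>2 + q\<^sup>2 = 2 * int n" using v by (cases v) auto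
    have "even (p\<^sup>2 + q\<^sup>2)" using pq(4) by simp
    then have "even (p + q)" by simp
    then obtain x where x: "p + q = 2 * x" by (rule evenE)
    then have p: "p = 2 * x - q" by simp
    show ?thesis
    proof (cases "p \<le> q")
      case True
      have g: "?g v = (x, q - x)" using True by (simp add: pq(1) p)
      have "2 * int n = 2 * (x\<^sup>2 + (q - x)\<^sup>2)" unfolding pq(4)[symmetric] p by (simp add: power2_eq_square algebra_simps)
      then show ?thesis unfolding g using True pq p by auto
    next
      case False
      have g: "?g v = (x - q, x)" using False by (simp add: pq(1) p)
      have "2 * int n = 2 * ((x - q)\<^sup>2 + x\<^sup>2)" unfolding pq(4)[symmetric] p by (simp add: power2_eq_square algebra_simps)
      then show ?thesis unfolding g using False pq p by auto
    qed
  qed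
  have "bij_betw ?f (?A n) (?A (2 * n))"
  proof (rule bij_betw_byWitness[where f' = ?g])
    show "?f ` ?A n \<subseteq> ?A (2 * n)" using sq by (auto split: if_splits)
    show "\<forall>v\<in>?A n. ?g (?f v) = v" by (rule 1)
    show "\<forall>v\<in>?A (2 * n). ?f (?g v) = v" by (rule ballI) (rule conjunct1[OF bck])
    show "?g ` ?A (2 * n) \<subseteq> ?A n" by (rule image_subsetI) (rule conjunct2[OF bck])
  qed
  from bij_betw_same_card[OF this] show ?thesis unfolding tau_def by simp
qed

lemma weighted_tau: "real (parity_weight k * tau k) = real (tau k) + (if even k then real (tau (k div 2)) else 0)"
  using tau_double[of "k div 2"] by (auto simp: parity_weight_def)

section \<open>Classes of subgroups of a given type\<close>

text \<open>A coset of the shear is determined by any coset of the lattice inside it.\<close>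

lemma finite_pairs:
  assumes k: "0 < k" shows "finite (pairs m k)"
proof (rule pairs_sum(2)[OF k])
  fix L assume L: "L \<in> lattices k"
  have A: "add_subgroup L" using L by (rule lattices_add_subgroup)
  let ?S = "shear (int m) L"
  have B: "add_subgroup ?S" by (rule add_subgroup_shear[OF A])
  have sub: "L \<subseteq> ?S" using shearI[of _ L 0 "int m"] by auto
  have eq: "(+) u ` ?S = {c + l | c l. c \<in> (+) u ` L \<and> l \<in> ?S}" for u
  proof (intro equalityI subsetI)
    fix x assume "x \<in> (+) u ` ?S"
    then obtain l where l: "l \<in> ?S" "x = (u + 0) + l" by auto
    then show "x \<in> {c + l | c l. c \<in> (+) u ` L \<and> l \<in> ?S}" using add_subgroup_0[OF A] by blast
  next
    fix x assume "x \<in> {c + l | c l. c \<in> (+) u ` L \<and> l \<in> ?S}"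
    then obtain l' l where "l' \<in> L" "l \<in> ?S" "x = u + (l' + l)" by (auto simp: add.assoc)
    then show "x \<in> (+) u ` ?S" using add_subgroup_add[OF B] sub by blast
  qed
  have "cosets ?S \<subseteq> (\<lambda>C. {c + l | c l. c \<in> C \<and> l \<in> ?S}) ` cosets L"
    by (simp only: cosets_def image_image eq order_refl)
  then show "finite (cosets ?S)" using card_cosets_lattice(2)[OF L] finite_surj by blast
qed

lemma index_subgroups_Tw:
  assumes n: "0 < n"
  shows "index_subgroups (Tw 1) n = (\<Union>m\<in>{m. m dvd n}. subs m (n div m))"
proof (intro equalityI subsetI)
  fix H assume H: "H \<in> index_subgroups (Tw 1) n"
  then obtain m k where m: "0 < m" "H \<in> subs m k" using finite_index_subs by (auto simp: index_subgroups_def)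
  have "m * k = n" using subs_index[OF m(2,1)] H by (simp add: index_subgroups_def)
  then have "m dvd n" "k = n div m" using m(1) by auto
  then show "H \<in> (\<Union>m\<in>{m. m dvd n}. subs m (n div m))" using m(2) by blast
next
  fix H assume "H \<in> (\<Union>m\<in>{m. m dvd n}. subs m (n div m))"
  then obtain m where m: "m dvd n" "H \<in> subs m (n div m)" by blast
  then have "0 < m" using n by (auto intro: Nat.gr0I)
  then show "H \<in> index_subgroups (Tw 1) n"
    using subs_index[OF m(2)] m by (simp add: index_subgroups_def subs_def)
qed

text \<open>Conjugation does not change heights.\<close>

lemma subs_conj_height:
  assumes "H \<in> subs m k" "H' \<in> subs m' k'" and c: "conj_class (Tw 1) H = conj_class (Tw 1) H'"
  shows "m = m'"
proof -
  have "m' dvd m" if H: "H \<in> subs m k" and H': "H' \<in> subs m' k'"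
    and c: "conj_class (Tw 1) H = conj_class (Tw 1) H'" for H H' m m' k k'
  proof -
    obtain g where g: "H' = (\<lambda>h. g \<otimes>\<^bsub>Tw 1\<^esub> h \<otimes>\<^bsub>Tw 1\<^esub> inv\<^bsub>Tw 1\<^esub> g) ` H"
      using c conj_class_eq_iff[OF group_Tw, of H 1 H'] by auto
    obtain w j where wj: "g = (w, j)" by (cases g)
    obtain u where "(u, int m) \<in> H" using H by (auto simp: subs_def)
    then have "(w - rot (int m) w + rot j u, int m) \<in> H'"
      unfolding g wj using Tw_conj[of w j u "int m"] by (metis image_eqI)
    then have "int m' dvd int m" using H' unfolding subs_def by blast
    then show ?thesis by simp
  qed
  from this[OF assms] this[OF assms(2,1) c[symmetric]] show ?thesis by (rule dvd_antisym[rotated])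
qed

lemma twist_cases: "twist m \<in> {1, 2, 4}"
  by (simp add: twist_def)

lemma Tw_iso_iff:
  assumes "e \<in> {1, 2, 4}" "e' \<in> {1, 2, 4}"
  shows "Tw e \<cong> Tw e' \<longleftrightarrow> e = e'"
proof
  assume "Tw e \<cong> Tw e'"
  moreover from this have "Tw e' \<cong> Tw e" by (rule group.iso_sym[OF group_Tw])
  ultimately show "e = e'" using assms Tw_not_iso by auto
qed (use iso_set_refl[of "Tw e"] in \<open>auto simp: is_iso_def\<close>)

lemma move_subgroup:
  assumes "subgroup H (Tw 1)"
  shows "subgroup (move 1 ` H) (motion_grp (range (move 1)))"
proof (rule group_hom.subgroup_img_is_subgroup[OF _ assms])
  show "group_hom (Tw 1) (motion_grp (range (move 1))) (move 1)"
    using move_iso[of 1] motions.grp[OF motions_move] group_Tw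
    by (simp add: group_hom_def group_hom_axioms_def iso_def)
qed

text \<open>Both statements express the affine conjugacy of \<open>subs_geometry\<close>, for the groups and for their
  orbit spaces.\<close>

lemma subs_type:
  assumes H: "H \<in> subs m k" and m: "0 < m"
  shows "(Tw 1)\<lparr>carrier := H\<rparr> \<cong> Tw (twist m)"
    and "orbit_space (move 1 ` H) homeomorphic_space orbit_space (range (move (twist m)))"
proof -
  have s: "subgroup H (Tw 1)" using H by (simp add: subs_def)
  obtain F where F: "homeomorphic_map euclidean euclidean F"
    "move 1 ` H = (\<lambda>\<gamma>. F \<circ> \<gamma> \<circ> finv F) ` range (move (twist m))"
    by (rule subs_geometry[OF H m])
  have M: "motions (move 1 ` H) 1"
    by (rule motions.motions_subgroup[OF motions_move move_subgroup[OF s]])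
  have "orbit_space (range (move (twist m))) homeomorphic_space orbit_space (move 1 ` H)"
    by (rule orbit_space_conj_homeomorphic[OF motions_move M F])
  then show "orbit_space (move 1 ` H) homeomorphic_space orbit_space (range (move (twist m)))"
    by (subst homeomorphic_space_sym)
  have "bij F" using F(1) by (auto simp: homeomorphic_eq_everything_map bij_def)
  then have 1: "motion_grp (range (move (twist m))) \<cong> motion_grp (move 1 ` H)"
    by (rule motion_grp_conj_iso[OF _ _ F(2)]) (auto simp: move_bij)
  have 2: "Tw (twist m) \<cong> motion_grp (range (move (twist m)))" using move_iso by (rule is_isoI)
  have "(Tw 1)\<lparr>carrier := H\<rparr> \<cong> (motion_grp (range (move 1)))\<lparr>carrier := move 1 ` H\<rparr>"
    by (rule is_isoI[OF iso_restrict[OF move_iso group_Tw motions.grp[OF motions_move] s]])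
  then have 3: "(Tw 1)\<lparr>carrier := H\<rparr> \<cong> motion_grp (move 1 ` H)" by simp
  have "Tw (twist m) \<cong> motion_grp (move 1 ` H)" using iso_trans[OF 2 1] .
  then have "motion_grp (move 1 ` H) \<cong> Tw (twist m)" by (rule group.iso_sym[OF group_Tw])
  then show "(Tw 1)\<lparr>carrier := H\<rparr> \<cong> Tw (twist m)" using 3 iso_trans by blast
qed

lemma subs_iso_iff:
  assumes H: "H \<in> subs m k" and m: "0 < m" and e: "e \<in> {1, 2, 4}"
  shows "(Tw 1)\<lparr>carrier := H\<rparr> \<cong> Tw e \<longleftrightarrow> twist m = e"
proof -
  have s: "subgroup H (Tw 1)" using H by (simp add: subs_def)
  have "group ((Tw 1)\<lparr>carrier := H\<rparr>)" by (rule subgroup.subgroup_is_group[OF s group_Tw])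
  then have "Tw (twist m) \<cong> (Tw 1)\<lparr>carrier := H\<rparr>" using group.iso_sym subs_type(1)[OF H m] by blast
  then have "(Tw 1)\<lparr>carrier := H\<rparr> \<cong> Tw e \<longleftrightarrow> Tw (twist m) \<cong> Tw e"
    using subs_type(1)[OF H m] iso_trans by blast
  then show ?thesis using Tw_iso_iff[OF twist_cases e] by simp
qed

text \<open>Homeomorphic orbit spaces have isomorphic groups, and different twists give different groups.\<close>

lemma subs_homeomorphic_iff:
  assumes H: "H \<in> subs m k" and m: "0 < m" and e: "e \<in> {1, 2, 4}"
  shows "orbit_space (move 1 ` H) homeomorphic_space orbit_space (range (move e)) \<longleftrightarrow> twist m = e"
proof
  assume a: "orbit_space (move 1 ` H) homeomorphic_space orbit_space (range (move e))"
  have "orbit_space (range (move (twist m))) homeomorphic_space orbit_space (range (move e))"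
    using subs_type(2)[OF H m] a homeomorphic_space_sym homeomorphic_space_trans by blast
  then have 1: "motion_grp (range (move (twist m))) \<cong> motion_grp (range (move e))"
    by (rule homeomorphic_orbit_spaces_iso[OF motions_move motions_move])
  have 2: "Tw i \<cong> motion_grp (range (move i))" for i using move_iso by (rule is_isoI)
  have "motion_grp (range (move e)) \<cong> Tw e" by (rule group.iso_sym[OF group_Tw 2])
  then have "Tw (twist m) \<cong> Tw e" using iso_trans[OF iso_trans[OF 2 1]] by blast
  then show "twist m = e" using Tw_iso_iff[OF twist_cases e] by simp
qed (use subs_type(2)[OF H m] in auto)

text \<open>The type of a subgroup depends only on its height \<open>m\<close>, and conjugate subgroups have the same
  height.\<close>

lemma classes_of_type:
  assumes n: "0 < n" and e: "e \<in> {1, 2, 4}"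
  defines "\<C> \<equiv> conj_class (Tw 1) ` {K \<in> index_subgroups (Tw 1) n. (Tw 1)\<lparr>carrier := K\<rparr> \<cong> Tw e}"
  shows "finite \<C>" and "card \<C> = (\<Sum>m | m dvd n \<and> twist m = e. class_count m (n div m))"
proof -
  let ?M = "{m. m dvd n \<and> twist m = e}"
  have pos: "0 < m \<and> 0 < n div m" if "m dvd n" for m
    using that n by (auto simp: div_greater_zero_iff dvd_imp_le intro: Nat.gr0I)
  have "{K \<in> index_subgroups (Tw 1) n. (Tw 1)\<lparr>carrier := K\<rparr> \<cong> Tw e} = (\<Union>m\<in>?M. subs m (n div m))"
    unfolding index_subgroups_Tw[OF n] using subs_iso_iff[OF _ _ e] pos by blast
  then have C: "\<C> = (\<Union>m\<in>?M. conj_class (Tw 1) ` subs m (n div m))"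
    unfolding \<C>_def by (simp only: image_UN)
  have each: "finite (conj_class (Tw 1) ` subs m (n div m)) \<and> card (conj_class (Tw 1) ` subs m (n div m)) = class_count m (n div m)"
    if "m \<in> ?M" for m
  proof -
    have m: "0 < m" "0 < n div m" using that pos by blast+
    obtain h where h: "bij_betw h (conj_class (Tw 1) ` subs m (n div m)) (rot_orbit ` pairs m (n div m))"
      by (rule subs_classes_bij[OF m(1)])
    then show ?thesis
      using bij_betw_finite[OF h] bij_betw_same_card[OF h] finite_pairs[OF m(2), of m] by (simp add: class_count_def)
  qed
  have finM: "finite ?M" by (rule finite_divisors_pred[OF n])
  show "finite \<C>" unfolding C using finM each by blast
  have "card \<C> = (\<Sum>m\<in>?M. card (conj_class (Tw 1) ` subs m (n div m)))"
    unfolding C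
  proof (rule card_UN_disjoint[OF finM])
    show "\<forall>i\<in>?M. \<forall>j\<in>?M. i \<noteq> j \<longrightarrow> conj_class (Tw 1) ` subs i (n div i) \<inter> conj_class (Tw 1) ` subs j (n div j) = {}"
      using subs_conj_height by blast
  qed (use each in blast)
  then show "card \<C> = (\<Sum>m | m dvd n \<and> twist m = e. class_count m (n div m))" using each by simp
qed

section \<open>The counting formulas\<close>

lemma twist_iff: "twist m = 1 \<longleftrightarrow> odd m" "twist m = 2 \<longleftrightarrow> m mod 4 = 2" "twist m = 4 \<longleftrightarrow> 4 dvd m"
  unfolding twist_def by presburger+

lemma even_half_odd: "m mod 4 = 2 \<Longrightarrow> m = 2 * (m div 2) \<and> odd (m div 2)" for m :: nat
  by presburger

lemma double_odd: "odd q \<Longrightarrow> 2 * q mod 4 = 2" for q :: nat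
  by presburger

lemma div_sum_add: "div_sum (\<lambda>k. F k + G k) n d = div_sum F n d + (div_sum G n d :: real)"
  by (simp add: div_sum_def sum.distrib)

lemma div_sum_cmult: "div_sum (\<lambda>k. c * F k) n d = c * (div_sum F n d :: real)"
  by (simp add: div_sum_def sum_distrib_left)

text \<open>The sum runs over \<open>k = n / m\<close>, the divisors of \<open>n\<close> with odd cofactor.\<close>

lemma classes_sum_G4:
  assumes n: "0 < n"
  shows "real (\<Sum>m | m dvd n \<and> twist m = 1. class_count m (n div m)) =
    div_sum (\<lambda>a. real (tau a)) n 1 - div_sum (\<lambda>a. real (tau a)) n 4"
proof -
  have "real (\<Sum>m | m dvd n \<and> twist m = 1. class_count m (n div m)) =
      real (\<Sum>k | k dvd n \<and> odd (n div k). class_count (n div k) k)"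
    using sum_complementary_divisors[OF n, of class_count odd] by (simp only: twist_iff)
  also have "\<dots> = (\<Sum>k | k dvd n \<and> odd (n div k). real (tau k) + (if even k then real (tau (k div 2)) else 0))"
    unfolding of_nat_sum
  proof (rule sum.cong[OF HOL.refl])
    fix k assume k: "k \<in> {k. k dvd n \<and> odd (n div k)}"
    then have "0 < k" using n by (auto intro: Nat.gr0I)
    then show "real (class_count (n div k) k) = real (tau k) + (if even k then real (tau (k div 2)) else 0)"
      using k class_count_odd[of "n div k" k] weighted_tau[of k] by simp
  qed
  also have "\<dots> = div_sum (\<lambda>a. real (tau a)) n 1 - div_sum (\<lambda>a. real (tau a)) n 4"
    using sum_odd_quotient[OF n, of "\<lambda>a. real (tau a)" "\<lambda>a. real (tau a)"] by linarith
  finally show ?thesis .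
qed

text \<open>With \<open>n = 2 N\<close> the sum runs over the divisors \<open>k\<close> of \<open>N\<close> with odd cofactor.\<close>

lemma classes_sum_G2:
  assumes n: "0 < n"
  shows "real (\<Sum>m | m dvd n \<and> twist m = 2. class_count m (n div m)) =
    1 / 2 * (div_sum (\<lambda>a. real (divisor_sum a)) n 2 + 2 * div_sum (\<lambda>a. real (divisor_sum a)) n 4
      - 3 * div_sum (\<lambda>a. real (divisor_sum a)) n 8 + div_sum (\<lambda>a. real (tau a)) n 2 - div_sum (\<lambda>a. real (tau a)) n 8)"
proof (cases "even n")
  case False
  have "\<not> m mod 4 = 2" if "m dvd n" for m
  proof
    assume "m mod 4 = 2"
    then have "even m" by presburger
    then show False using False that dvd_trans by blast
  qed
  then have empty: "{m. m dvd n \<and> m mod 4 = 2} = {}" by blast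
  have "div_sum F n 2 = 0" "div_sum F n 4 = 0" "div_sum F n 8 = 0" for F :: "nat \<Rightarrow> real"
    using False div_sum_eq_0[of 2 n F 1] div_sum_eq_0[of 2 n F 2] div_sum_eq_0[of 2 n F 4] by simp_all
  then show ?thesis unfolding twist_iff empty by simp
next
  case True
  define N where "N = n div 2"
  have N: "0 < N" "n = 2 * N" using True n by (auto simp: N_def)
  let ?s = "\<lambda>a. real (divisor_sum a)" and ?t = "\<lambda>a. real (tau a)"
  let ?F = "\<lambda>k. ?s k + ?t k" and ?G = "\<lambda>k. 3 * ?s k + ?t k"
  have set: "{k. k dvd n \<and> (n div k) mod 4 = 2} = {k. k dvd N \<and> odd (N div k)}"
  proof (intro equalityI subsetI CollectI)
    fix k assume "k \<in> {k. k dvd n \<and> (n div k) mod 4 = 2}"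
    then have k: "k dvd n" "(n div k) mod 4 = 2" by auto
    define q where "q = n div k div 2"
    have q: "n div k = 2 * q" "odd q"
      using k(2) even_half_odd[of "n div k"] unfolding q_def by auto
    have "0 < k" using k(1) n by (auto intro: Nat.gr0I)
    moreover have "N = k * q"
    proof -
      have "n = k * (2 * q)" using k(1) q(1) by (metis dvd_mult_div_cancel)
      then show ?thesis using N(2) by simp
    qed
    ultimately show "k dvd N \<and> odd (N div k)" using q(2) by simp
  next
    fix k assume "k \<in> {k. k dvd N \<and> odd (N div k)}"
    then have k: "k dvd N" "odd (N div k)" by auto
    then have "n div k = 2 * (N div k)" by (simp add: N(2) div_mult_swap)
    moreover have "(2 * (N div k)) mod 4 = 2" by (rule double_odd[OF k(2)])
    ultimately show "k dvd n \<and> (n div k) mod 4 = 2" using k(1) by (simp add: N(2))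
  qed
  have "2 * real (\<Sum>m | m dvd n \<and> twist m = 2. class_count m (n div m)) =
      (\<Sum>k | k dvd N \<and> odd (N div k). 2 * real (class_count (n div k) k))"
    using sum_complementary_divisors[OF n, of class_count "\<lambda>m. m mod 4 = 2"]
    by (simp only: twist_iff set of_nat_sum sum_distrib_left)
  also have "\<dots> = (\<Sum>k | k dvd N \<and> odd (N div k). ?F k + (if even k then ?G (k div 2) else 0))"
  proof (rule sum.cong[OF HOL.refl])
    fix k assume k: "k \<in> {k. k dvd N \<and> odd (N div k)}"
    then have k0: "0 < k" using N(1) by (auto intro: Nat.gr0I)
    have "(n div k) mod 4 = 2" using k set by blast
    from class_count_half[OF this k0]
    have "2 * real (class_count (n div k) k) = real (two_torsion_sum k) + real (parity_weight k * tau k)" by linarith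
    then show "2 * real (class_count (n div k) k) = ?F k + (if even k then ?G (k div 2) else 0)"
      unfolding weighted_tau two_torsion_sum_eq[OF k0] by simp
  qed
  also have "\<dots> = div_sum ?F N 1 - div_sum ?F N 2 + (div_sum ?G N 2 - div_sum ?G N 4)"
    by (rule sum_odd_quotient[OF N(1)])
  also have "\<dots> = div_sum ?F n 2 - div_sum ?F n 4 + (div_sum ?G n 4 - div_sum ?G n 8)"
  proof -
    have "div_sum F N d = div_sum F n (2 * d)" for F :: "nat \<Rightarrow> real" and d
      using div_sum_div[of 2 n F d] True by (simp add: N_def)
    then show ?thesis by simp
  qed
  finally show ?thesis unfolding div_sum_add div_sum_cmult by simp
qed

text \<open>With \<open>n = 4 N\<close> the sum runs over all divisors \<open>k\<close> of \<open>N\<close>.\<close>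

lemma classes_sum_G1:
  assumes n: "0 < n"
  shows "real (\<Sum>m | m dvd n \<and> twist m = 4. class_count m (n div m)) =
    1 / 4 * (div_sum (\<lambda>a. real (a * divisor_sum a)) n 4 + div_sum (\<lambda>a. real (divisor_sum a)) n 4
      + 3 * div_sum (\<lambda>a. real (divisor_sum a)) n 8 + 2 * div_sum (\<lambda>a. real (tau a)) n 4 + 2 * div_sum (\<lambda>a. real (tau a)) n 8)"
proof (cases "4 dvd n")
  case False
  then have empty: "{m. m dvd n \<and> 4 dvd m} = {}" using dvd_trans by blast
  have "div_sum F n 4 = 0" "div_sum F n 8 = 0" for F :: "nat \<Rightarrow> real"
    using False div_sum_eq_0[of 4 n F 1] div_sum_eq_0[of 4 n F 2] by simp_all
  then show ?thesis unfolding twist_iff empty by simp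
next
  case True
  define N where "N = n div 4"
  have N: "0 < N" "n = 4 * N" using True n by (auto simp: N_def)
  let ?s = "\<lambda>a. real (divisor_sum a)" and ?t = "\<lambda>a. real (tau a)" and ?o = "\<lambda>a. real (a * divisor_sum a)"
  let ?F = "\<lambda>k. ?o k + (?s k + 2 * ?t k)" and ?G = "\<lambda>k. 3 * ?s k + 2 * ?t k"
  have set: "{k. k dvd n \<and> 4 dvd n div k} = {k. k dvd N}"
  proof (intro equalityI subsetI CollectI)
    fix k assume "k \<in> {k. k dvd n \<and> 4 dvd n div k}"
    then have k: "k dvd n" "4 dvd n div k" by auto
    then have "k * 4 dvd n" by (metis dvd_mult_div_cancel mult_dvd_mono dvd_refl)
    then show "k dvd N" by (simp add: N(2) mult.commute[of k])
  next
    fix k assume "k \<in> {k. k dvd N}"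
    then have k: "k dvd N" by simp
    then have "n div k = 4 * (N div k)" by (simp add: N(2) div_mult_swap)
    then show "k dvd n \<and> 4 dvd n div k" using k by (simp add: N(2))
  qed
  have "4 * real (\<Sum>m | m dvd n \<and> twist m = 4. class_count m (n div m)) =
      (\<Sum>k | k dvd N. 4 * real (class_count (n div k) k))"
    using sum_complementary_divisors[OF n, of class_count "\<lambda>m. 4 dvd m"]
    by (simp only: twist_iff set of_nat_sum sum_distrib_left)
  also have "\<dots> = (\<Sum>k | k dvd N. ?F k + (if even k then ?G (k div 2) else 0))"
  proof (rule sum.cong[OF HOL.refl])
    fix k assume k: "k \<in> {k. k dvd N}"
    then have k0: "0 < k" using N(1) by (auto intro: Nat.gr0I)
    have "4 dvd n div k" using k set by blast
    from class_count_full[OF this k0]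
    have "4 * real (class_count (n div k) k) = ?o k + 2 * real (parity_weight k * tau k) + real (two_torsion_sum k)" by linarith
    then show "4 * real (class_count (n div k) k) = ?F k + (if even k then ?G (k div 2) else 0)"
      unfolding weighted_tau two_torsion_sum_eq[OF k0] by simp
  qed
  also have "\<dots> = div_sum ?F N 1 + div_sum ?G N 2"
    by (rule sum_all_divisors[OF N(1)])
  also have "\<dots> = div_sum ?F n 4 + div_sum ?G n 8"
  proof -
    have "div_sum F N d = div_sum F n (4 * d)" for F :: "nat \<Rightarrow> real" and d
      using div_sum_div[of 4 n F d] True by (simp add: N_def)
    then show ?thesis by simp
  qed
  finally show ?thesis unfolding div_sum_add div_sum_cmult by simp
qed

lemma sigma1_of_nat: "0 < k \<Longrightarrow> sigma1 (real k) = divisor_sum k"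
  by (simp add: sigma1_def pos_divisors_of_nat)

lemma pos_divisors_pos: "k \<in> pos_divisors x \<Longrightarrow> 0 < k"
  by (simp add: pos_divisors_def)

lemma sigma2_div_sum:
  assumes "0 < n" "0 < d"
  shows "real (sigma2 (real n / real d)) = div_sum (\<lambda>a. real (divisor_sum a)) n d"
proof -
  have "real (sigma2 (real n / real d)) = (\<Sum>k\<in>pos_divisors (real n / real d). real (divisor_sum k))"
    unfolding sigma2_def of_nat_sum
    by (intro sum.cong HOL.refl) (simp add: sigma1_of_nat[OF pos_divisors_pos])
  then show ?thesis unfolding sum_pos_divisors[OF assms] .
qed

lemma omega_div_sum:
  assumes "0 < n" "0 < d"
  shows "real (omega (real n / real d)) = div_sum (\<lambda>a. real (a * divisor_sum a)) n d"
proof -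
  have "real (omega (real n / real d)) = (\<Sum>k\<in>pos_divisors (real n / real d). real (k * divisor_sum k))"
    unfolding omega_def of_nat_sum
    by (intro sum.cong HOL.refl) (simp add: sigma1_of_nat[OF pos_divisors_pos])
  then show ?thesis unfolding sum_pos_divisors[OF assms] .
qed

lemma index_subgroups_motions:
  assumes n: "0 < n" and H: "H \<in> index_subgroups (motion_grp (range (move 1))) n"
  obtains m k where "H = move 1 ` k" "k \<in> subs m (n div m)" "m dvd n" "0 < m"
proof -
  have "H \<in> (`) (move 1) ` index_subgroups (Tw 1) n"
    using H iso_index_subgroups[OF move_iso group_Tw motions.grp[OF motions_move]] by blast
  then obtain K where K: "H = move 1 ` K" "K \<in> index_subgroups (Tw 1) n" by blast
  then obtain m where m: "m dvd n" "K \<in> subs m (n div m)" unfolding index_subgroups_Tw[OF n] by blast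
  moreover have "0 < m" using m(1) n by (auto intro: Nat.gr0I)
  ultimately show ?thesis using that K(1) by blast
qed

lemma covering_total_space:
  assumes n: "0 < n" and c: "nfold_covering n N p manifold_G4"
  obtains m where "m dvd n" "N homeomorphic_space orbit_space (range (move (twist m)))"
proof -
  interpret motions "range (move 1)" 1 by (rule motions_move)
  have c': "nfold_covering n N p (orbit_space (range (move 1)))" using c by (simp add: manifold_orbit_spaces)
  then have "covering_map N p (orbit_space (range (move 1)))" "connected_space N" by (auto simp: nfold_covering_def)
  then obtain H f where H: "orbit_cover (range (move 1)) H N p f" by (rule covering_uniformized)
  have "H \<in> index_subgroups (motion_grp (range (move 1))) n"
    using orbit_coverD(1)[OF H] orbit_cover_nfold[OF H] c' by (simp add: index_subgroups_def)
  then obtain m K where m: "H = move 1 ` K" "K \<in> subs m (n div m)" "m dvd n" "0 < m"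
    by (rule index_subgroups_motions[OF n])
  have "N homeomorphic_space orbit_space (range (move (twist m)))"
    using orbit_cover_homeomorphic[OF H] subs_type(2)[OF m(2,4)] homeomorphic_space_trans unfolding m(1) by blast
  then show ?thesis using that m(3) by blast
qed

text \<open>The type of the covering space singles out the same subgroups as the isomorphism type.\<close>

lemma covering_classes_count:
  assumes n: "0 < n" and e: "e \<in> {1, 2, 4}"
  obtains b where "bij_betw b (covering_classes (orbit_space (range (move e))) manifold_G4 n)
    (conj_class (Tw 1) ` {K \<in> index_subgroups (Tw 1) n. (Tw 1)\<lparr>carrier := K\<rparr> \<cong> Tw e})"
proof -
  interpret motions "range (move 1)" 1 by (rule motions_move)
  let ?G = "motion_grp (range (move 1))" and ?M = "orbit_space (range (move e))"
  let ?A = "{H \<in> index_subgroups ?G n. orbit_space H homeomorphic_space ?M}"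
  obtain b where b: "bij_betw b (covering_classes ?M (orbit_space (range (move 1))) n)
      (conj_class ?G ` {H. subgroup H ?G \<and> finite (rcosets\<^bsub>?G\<^esub> H) \<and> card (rcosets\<^bsub>?G\<^esub> H) = n \<and>
        orbit_space H homeomorphic_space ?M})"
    by (rule covering_classes_bij)
  have "{H. subgroup H ?G \<and> finite (rcosets\<^bsub>?G\<^esub> H) \<and> card (rcosets\<^bsub>?G\<^esub> H) = n \<and>
      orbit_space H homeomorphic_space ?M} = ?A"
    by (auto simp: index_subgroups_def)
  with b have b: "bij_betw b (covering_classes ?M manifold_G4 n) (conj_class ?G ` ?A)"
    by (simp add: manifold_orbit_spaces)
  have P: "(Tw 1)\<lparr>carrier := K\<rparr> \<cong> Tw e \<longleftrightarrow> orbit_space (move 1 ` K) homeomorphic_space ?M"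
    if K: "K \<in> index_subgroups (Tw 1) n" for K
  proof -
    obtain m where m: "m dvd n" "K \<in> subs m (n div m)"
      using K unfolding index_subgroups_Tw[OF n] by auto
    have m0: "0 < m" by (rule dvd_pos_nat[OF n m(1)])
    show ?thesis using subs_iso_iff[OF m(2) m0 e] subs_homeomorphic_iff[OF m(2) m0 e] by blast
  qed
  obtain c where c: "bij_betw c (conj_class (Tw 1) ` {K \<in> index_subgroups (Tw 1) n. (Tw 1)\<lparr>carrier := K\<rparr> \<cong> Tw e})
      (conj_class ?G ` ?A)"
    by (rule classes_transport[where P = "\<lambda>K. (Tw 1)\<lparr>carrier := K\<rparr> \<cong> Tw e"
        and P' = "\<lambda>H. orbit_space H homeomorphic_space ?M", OF move_iso group_Tw grp P])
  show ?thesis by (rule that[OF bij_betw_trans[OF b bij_betw_inv_into[OF c]]])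
qed

lemma subgroup_classes_count:
  assumes G: "group G" "G \<cong> Tw 1" and P: "P \<cong> Tw e" "group P"
  obtains b where "bij_betw b (subgroup_classes P G n)
    (conj_class (Tw 1) ` {K \<in> index_subgroups (Tw 1) n. (Tw 1)\<lparr>carrier := K\<rparr> \<cong> Tw e})"
proof -
  obtain f where f: "f \<in> iso G (Tw 1)" using G(2) by (auto simp: is_iso_def)
  have PP: "Tw e \<cong> P" by (rule group.iso_sym[OF P(2,1)])
  have "G\<lparr>carrier := K\<rparr> \<cong> P \<longleftrightarrow> (Tw 1)\<lparr>carrier := f ` K\<rparr> \<cong> Tw e" if K: "K \<in> index_subgroups G n" for K
  proof -
    have s: "subgroup K G" using K by (simp add: index_subgroups_def)
    have 1: "G\<lparr>carrier := K\<rparr> \<cong> (Tw 1)\<lparr>carrier := f ` K\<rparr>"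
      by (rule is_isoI[OF iso_restrict[OF f G(1) group_Tw s]])
    have 2: "(Tw 1)\<lparr>carrier := f ` K\<rparr> \<cong> G\<lparr>carrier := K\<rparr>"
      by (rule group.iso_sym[OF subgroup.subgroup_is_group[OF s G(1)] 1])
    show ?thesis
    proof
      assume "G\<lparr>carrier := K\<rparr> \<cong> P"
      then show "(Tw 1)\<lparr>carrier := f ` K\<rparr> \<cong> Tw e" by (rule iso_trans[OF iso_trans[OF 2] P(1)])
    next
      assume "(Tw 1)\<lparr>carrier := f ` K\<rparr> \<cong> Tw e"
      then show "G\<lparr>carrier := K\<rparr> \<cong> P" by (rule iso_trans[OF iso_trans[OF 1] PP])
    qed
  qed
  then obtain b where b: "bij_betw b (conj_class G ` {K \<in> index_subgroups G n. G\<lparr>carrier := K\<rparr> \<cong> P})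
      (conj_class (Tw 1) ` {K \<in> index_subgroups (Tw 1) n. (Tw 1)\<lparr>carrier := K\<rparr> \<cong> Tw e})"
    by (rule classes_transport[where P = "\<lambda>K. G\<lparr>carrier := K\<rparr> \<cong> P"
        and P' = "\<lambda>K. (Tw 1)\<lparr>carrier := K\<rparr> \<cong> Tw e", OF f G(1) group_Tw])
  have "{K \<in> index_subgroups G n. G\<lparr>carrier := K\<rparr> \<cong> P} = subgroups_iso P G n"
    by (auto simp: index_subgroups_def subgroups_iso_def)
  then show ?thesis using that b by (simp add: subgroup_classes_def)
qed

lemma covering_and_subgroup_counts:
  assumes n: "0 < n" and e: "e \<in> {1, 2, 4}" and P: "P \<cong> Tw e" "group P" and M: "M = orbit_space (range (move e))"
  shows "finite (covering_classes M manifold_G4 n) \<and> finite (subgroup_classes P pi1_G4 n) \<and>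
    card (covering_classes M manifold_G4 n) = c_sub P pi1_G4 n \<and>
    c_sub P pi1_G4 n = (\<Sum>m | m dvd n \<and> twist m = e. class_count m (n div m))"
proof -
  let ?C = "conj_class (Tw 1) ` {K \<in> index_subgroups (Tw 1) n. (Tw 1)\<lparr>carrier := K\<rparr> \<cong> Tw e}"
  have G: "group pi1_G4" unfolding pi1_G4_def by (rule group_presented_group)
  obtain b where b: "bij_betw b (covering_classes M manifold_G4 n) ?C"
    unfolding M by (rule covering_classes_count[OF n e])
  obtain c where c: "bij_betw c (subgroup_classes P pi1_G4 n) ?C"
    by (rule subgroup_classes_count[OF G pi1_G4_iso P])
  show ?thesis
    using classes_of_type[OF n e] bij_betw_finite[OF b] bij_betw_finite[OF c]
      bij_betw_same_card[OF b] bij_betw_same_card[OF c] by (simp add: c_sub_def)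
qed

theorem theorem4:
  fixes n :: nat
  assumes "0 < n"
  shows
    "(\<forall>(N :: 'a topology) p. nfold_covering n N p manifold_G4 \<longrightarrow>
        (odd n \<longrightarrow> N homeomorphic_space manifold_G4) \<and>
        (even n \<and> \<not> 4 dvd n \<longrightarrow>
          N homeomorphic_space manifold_G4 \<or> N homeomorphic_space manifold_G2) \<and>
        (4 dvd n \<longrightarrow>
          N homeomorphic_space manifold_G4 \<or> N homeomorphic_space manifold_G2 \<or>
          N homeomorphic_space manifold_G1)) \<and>
     (finite (covering_classes manifold_G4 manifold_G4 n) \<and>
      finite (subgroup_classes pi1_G4 pi1_G4 n) \<and>
      card (covering_classes manifold_G4 manifold_G4 n) = c_sub pi1_G4 pi1_G4 n \<and>
      real (c_sub pi1_G4 pi1_G4 n) =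
        (\<Sum>a\<in>pos_divisors n. real (tau a)) - (\<Sum>a\<in>pos_divisors (n / 4). real (tau a))) \<and>
     (finite (covering_classes manifold_G2 manifold_G4 n) \<and>
      finite (subgroup_classes pi1_G2 pi1_G4 n) \<and>
      card (covering_classes manifold_G2 manifold_G4 n) = c_sub pi1_G2 pi1_G4 n \<and>
      real (c_sub pi1_G2 pi1_G4 n) =
        1 / 2 * (real (sigma2 (n / 2)) + 2 * real (sigma2 (n / 4)) - 3 * real (sigma2 (n / 8))
          + (\<Sum>a\<in>pos_divisors (n / 2). real (tau a)) - (\<Sum>a\<in>pos_divisors (n / 8). real (tau a)))) \<and>
     (finite (covering_classes manifold_G1 manifold_G4 n) \<and>
      finite (subgroup_classes pi1_G1 pi1_G4 n) \<and>
      card (covering_classes manifold_G1 manifold_G4 n) = c_sub pi1_G1 pi1_G4 n \<and>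
      real (c_sub pi1_G1 pi1_G4 n) =
        1 / 4 * (real (omega (n / 4)) + real (sigma2 (n / 4)) + 3 * real (sigma2 (n / 8))
          + 2 * (\<Sum>a\<in>pos_divisors (n / 4). real (tau a))
          + 2 * (\<Sum>a\<in>pos_divisors (n / 8). real (tau a))))"
proof -
  note n = assms
  have g1: "group pi1_G1"
    unfolding pi1_G1_def by (intro DirProd_group group_integer_group)
  have g2: "group pi1_G2" unfolding pi1_G2_def by (rule group_presented_group)
  have g4: "group pi1_G4" unfolding pi1_G4_def by (rule group_presented_group)
  have types: "(odd n \<longrightarrow> N homeomorphic_space manifold_G4) \<and>
      (even n \<and> \<not> 4 dvd n \<longrightarrow> N homeomorphic_space manifold_G4 \<or> N homeomorphic_space manifold_G2) \<and>
      (4 dvd n \<longrightarrow> N homeomorphic_space manifold_G4 \<or> N homeomorphic_space manifold_G2 \<or>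
        N homeomorphic_space manifold_G1)"
    if c: "nfold_covering n N p manifold_G4" for N :: "'a topology" and p
  proof -
    obtain m where m: "m dvd n" "N homeomorphic_space orbit_space (range (move (twist m)))"
      by (rule covering_total_space[OF n c])
    have "odd n \<Longrightarrow> twist m = 1" "\<not> 4 dvd n \<Longrightarrow> twist m \<noteq> 4"
      using dvd_trans[of 2 m n] dvd_trans[of 4 m n] m(1) by (auto simp: twist_iff)
    then show ?thesis using m(2) twist_cases[of m] unfolding manifold_orbit_spaces
      by (cases "4 dvd n"; cases "odd n") auto
  qed
  have "(\<Sum>a\<in>pos_divisors (real n / real d). real (tau a)) = div_sum (\<lambda>a. real (tau a)) n d" if "0 < d" for d
    by (rule sum_pos_divisors[OF n that])
  note sums = this
  have "(\<Sum>a\<in>pos_divisors (real n). real (tau a)) = div_sum (\<lambda>a. real (tau a)) n 1"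
    using sums[of 1] by simp
  note div = this sums[of 2, simplified] sums[of 4, simplified] sums[of 8, simplified]
    sigma2_div_sum[OF n, of 2, OF zero_less_numeral, unfolded of_nat_numeral]
    sigma2_div_sum[OF n, of 4, OF zero_less_numeral, unfolded of_nat_numeral]
    sigma2_div_sum[OF n, of 8, OF zero_less_numeral, unfolded of_nat_numeral]
    omega_div_sum[OF n, of 4, OF zero_less_numeral, unfolded of_nat_numeral]
  note c4 = covering_and_subgroup_counts[OF n _ pi1_G4_iso g4 manifold_orbit_spaces(3), simplified]
    and c2 = covering_and_subgroup_counts[OF n _ pi1_G2_iso g2 manifold_orbit_spaces(2), simplified]
    and c1 = covering_and_subgroup_counts[OF n _ pi1_G1_iso g1 manifold_orbit_spaces(1), simplified]
  have s4: "real (c_sub pi1_G4 pi1_G4 n) =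
      (\<Sum>a\<in>pos_divisors n. real (tau a)) - (\<Sum>a\<in>pos_divisors (n / 4). real (tau a))"
    unfolding div classes_sum_G4[OF n, symmetric] by (simp only: c4)
  have s2: "real (c_sub pi1_G2 pi1_G4 n) =
      1 / 2 * (real (sigma2 (n / 2)) + 2 * real (sigma2 (n / 4)) - 3 * real (sigma2 (n / 8))
        + (\<Sum>a\<in>pos_divisors (n / 2). real (tau a)) - (\<Sum>a\<in>pos_divisors (n / 8). real (tau a)))"
    unfolding div classes_sum_G2[OF n, symmetric] by (simp only: c2)
  have s1: "real (c_sub pi1_G1 pi1_G4 n) =
      1 / 4 * (real (omega (n / 4)) + real (sigma2 (n / 4)) + 3 * real (sigma2 (n / 8))
        + 2 * (\<Sum>a\<in>pos_divisors (n / 4). real (tau a))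
        + 2 * (\<Sum>a\<in>pos_divisors (n / 8). real (tau a)))"
    unfolding div classes_sum_G1[OF n, symmetric] by (simp only: c1)
  show ?thesis
    by (rule conjI, rule allI, rule allI, rule impI, erule types)
      (rule conjI[OF _ conjI]; rule conjI[OF _ conjI[OF _ conjI]]; rule s4 s2 s1 c4[THEN conjunct1]
        c4[THEN conjunct2, THEN conjunct1] c4[THEN conjunct2, THEN conjunct2, THEN conjunct1]
        c2[THEN conjunct1] c2[THEN conjunct2, THEN conjunct1] c2[THEN conjunct2, THEN conjunct2, THEN conjunct1]
        c1[THEN conjunct1] c1[THEN conjunct2, THEN conjunct1] c1[THEN conjunct2, THEN conjunct2, THEN conjunct1])
qed

end
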